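(* Let $2\le p_0,p_1\le\infty$ and let $\Omega\subset\mathbb{C}\setminus\{0\}$ be open. Let $V,W\in\{L^2_\sigma(\mathbb{R}^d),L^2(\mathbb{R}^d;\mathbb{C}^{d\times d})\}$ and $(T(z))_{z\in\Omega}\subset\mathcal{L}(V,W)$. For $0\le\theta\le1$ define $p_\theta$ by $$\frac1{p_\theta}=\frac{1-\theta}{p_0}+\frac\theta{p_1}.$$ Then the following assertions hold. 1. If $(T(z))_{z\in\Omega}$ satisfies $L^2$-$L^{p_0}$ decay estimates of order $\nu_0\ge0$ and $L^2$-$L^{p_1}$ decay estimates of order $\nu_1\ge0$, then $(T(z))_{z\in\Omega}$ satisfies $L^2$-$L^{p_\theta}$ decay estimates of order $\nu_0(1-\theta)+\nu_1\theta\ge0$. 2. If $(T(z))_{z\in\Omega}$ satisfies $L^2$-$L^{p_0}$ decay estimates of order $\nu\ge0$ and $L^2$-$L^{p_1}$ bounds, then $(T(z))_{z\in\Omega}$ satisfies $L^2$-$L^{p_\theta}$ decay estimates of order $\nu(1-\theta)\ge0$.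
   Context: Here $d\ge2$ and $L^2_\sigma(\mathbb{R}^d)=\{f\in L^2(\mathbb{R}^d;\mathbb{C}^d):\operatorname{div}f=0\}$. For an open ball $B=B(x,r)$ put $B_n=B(x,2^nr)$, $C_0(B)=B$, $C_n(B)=B_n\setminus\overline{B_{n-1}}$ for $n\ge1$. Definition ($L^2$-$L^p$ decay estimates): $(T(z))_{z\in\Omega}\subset\mathcal{L}(V,W)$ satisfies $L^2$-$L^p$ decay estimates of order $\nu\ge0$ for $p\in[2,\infty]$ if there exist $M,N\ge0$ and a constant $C>0$ such that $$\|T(z)f\|_{L^p(B)}\le C\,r^{-d(\frac12-\frac1p)}\max\Big\{\Big(\frac{r^2}{|z|}\Big)^M,\Big(\frac{r^2}{|z|}\Big)^{-N}\Big\}\bigg(\sum_{n=0}^\infty2^{-\nu n}\|f\|_{L^2(C_n(B))}^2\bigg)^{\frac12}$$ for all $z\in\Omega$, all balls $B=B(x,r)\subset\mathbb{R}^d$ and all $f\in V$. Definition ($L^2$-$L^p$ bounds): for $2\le p\le\infty$, $(T(z))_{z\in\Omega}\subset\mathcal{L}(V,W)$ satisfies $L^2$-$L^p$ bounds if there is $C>0$ with $\|T(z)f\|_{L^p}\le C|z|^{-\frac d2(\frac12-\frac1p)}\|f\|_{L^2}$ for all $z\in\Omega$ and $f\in V$. *)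

theory Defs
  imports "HOL-Analysis.Analysis" "HOL-Probability.Essential_Supremum"
begin

text \<open>
  Elements of \<open>L\<^sup>p\<close> are represented by Lebesgue measurable functions; equality in \<open>L\<^sup>p\<close> is
  equality almost everywhere. Complex vectors and matrices carry the Euclidean (Frobenius) norm,
  that is, the library norm of \<^typ>\<open>complex^'d\<close> and \<^typ>\<open>complex^'d^'d\<close>.
\<close>

subsection \<open>Complex scalars acting on vectors and matrices\<close>

class complex_scale =
  fixes cscale :: "complex \<Rightarrow> 'a \<Rightarrow> 'a"

instantiation complex :: complex_scale
begin
definition cscale_complex :: "complex \<Rightarrow> complex \<Rightarrow> complex"
  where "cscale_complex c z = c * z"
instance ..
end

instantiation vec :: (complex_scale, finite) complex_scale
begin
definition cscale_vec :: "complex \<Rightarrow> 'a^'b \<Rightarrow> 'a^'b"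
  where "cscale_vec c v = (\<chi> i. cscale c (v $ i))"
instance ..
end

subsection \<open>Lebesgue norms\<close>

text \<open>Used for \<open>a > 0\<close> only, where \<open>\<infinity>\<^sup>a = \<infinity>\<close> and \<open>0\<^sup>a = 0\<close>.\<close>
definition ennreal_powr :: "ennreal \<Rightarrow> real \<Rightarrow> ennreal"
  where "ennreal_powr x a = (if x = top then top else ennreal (enn2real x powr a))"

text \<open>The norm of \<open>L\<^sup>p(A)\<close> for \<open>1 \<le> p \<le> \<infinity>\<close>; it is \<open>\<infinity>\<close> for a measurable function that is not
  in \<open>L\<^sup>p(A)\<close>, so a finite upper bound includes membership.\<close>
definition Lp_norm :: "ennreal \<Rightarrow> 'm::euclidean_space set \<Rightarrow> ('m \<Rightarrow> 'a::real_normed_vector) \<Rightarrow> ennreal"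
  where "Lp_norm p A f =
    (if p = top then esssup (restrict_space lebesgue A) (\<lambda>x. ennreal (norm (f x)))
     else ennreal_powr (\<integral>\<^sup>+x\<in>A. ennreal (norm (f x) powr enn2real p) \<partial>lebesgue) (1 / enn2real p))"

definition L2_fields :: "('m::euclidean_space \<Rightarrow> 'a::real_normed_vector) set"
  where "L2_fields = {f. f \<in> borel_measurable lebesgue \<and> Lp_norm 2 UNIV f < top}"

subsection \<open>Divergence-free fields\<close>

definition partial_deriv :: "'d::finite \<Rightarrow> (real^'d \<Rightarrow> complex) \<Rightarrow> real^'d \<Rightarrow> complex"
  where "partial_deriv i \<phi> x = frechet_derivative \<phi> (at x) (axis i 1)"

primrec C_k :: "nat \<Rightarrow> (real^'d::finite \<Rightarrow> complex) \<Rightarrow> bool" where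
  "C_k 0 \<phi> \<longleftrightarrow> continuous_on UNIV \<phi>"
| "C_k (Suc k) \<phi> \<longleftrightarrow> \<phi> differentiable_on UNIV \<and> (\<forall>i. C_k k (partial_deriv i \<phi>))"

definition test_functions :: "(real^'d::finite \<Rightarrow> complex) set"
  where "test_functions = {\<phi>. (\<forall>k. C_k k \<phi>) \<and> compact (closure {x. \<phi> x \<noteq> 0})}"

text \<open>The condition \<open>div f = 0\<close> is meant in the sense of distributions. The integrals below are
  absolutely convergent.\<close>
definition L2_sigma :: "(real^'d::finite \<Rightarrow> complex^'d) set"
  where "L2_sigma = {f \<in> L2_fields.
    \<forall>\<phi>\<in>test_functions. (LINT x|lebesgue. (\<Sum>i\<in>UNIV. f x $ i * partial_deriv i \<phi> x)) = 0}"

subsection \<open>Bounded operators\<close>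

text \<open>On representatives, linearity can only be required almost everywhere. Linearity and
  boundedness together imply that \<open>S\<close> respects equality almost everywhere, so \<open>S\<close> induces an
  operator between the spaces of equivalence classes, and every such operator arises in this way.\<close>
definition bounded_ops ::
  "(real^'d::finite \<Rightarrow> 'a::{real_normed_vector,complex_scale}) set
    \<Rightarrow> (real^'d \<Rightarrow> 'b::{real_normed_vector,complex_scale}) set
    \<Rightarrow> ((real^'d \<Rightarrow> 'a) \<Rightarrow> (real^'d \<Rightarrow> 'b)) set"
  where "bounded_ops V W = {S.
    (\<forall>f\<in>V. S f \<in> W) \<and>
    (\<forall>f\<in>V. \<forall>g\<in>V. AE x in lebesgue. S (\<lambda>y. f y + g y) x = S f x + S g x) \<and>
    (\<forall>c. \<forall>f\<in>V. AE x in lebesgue. S (\<lambda>y. cscale c (f y)) x = cscale c (S f x)) \<and>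
    (\<exists>K::real. \<forall>f\<in>V. Lp_norm 2 UNIV (S f) \<le> ennreal K * Lp_norm 2 UNIV f)}"

subsection \<open>Decay estimates and bounds\<close>

primrec annulus :: "'m::euclidean_space \<Rightarrow> real \<Rightarrow> nat \<Rightarrow> 'm set" where
  "annulus x r 0 = ball x r"
| "annulus x r (Suc n) = ball x (2 ^ Suc n * r) - closure (ball x (2 ^ n * r))"

text \<open>The term \<open>enn2real (1 / p)\<close> is \<open>1/p\<close> as a real number, with \<open>1/\<infinity> = 0\<close>.\<close>
definition decay_estimates ::
  "ennreal \<Rightarrow> real \<Rightarrow> complex set
    \<Rightarrow> (real^'d::finite \<Rightarrow> 'a::real_normed_vector) set
    \<Rightarrow> (complex \<Rightarrow> (real^'d \<Rightarrow> 'a) \<Rightarrow> (real^'d \<Rightarrow> 'b::real_normed_vector)) \<Rightarrow> bool"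
  where "decay_estimates p \<nu> \<Omega> V T \<longleftrightarrow> 2 \<le> p \<and> 0 \<le> \<nu> \<and>
    (\<exists>M\<ge>0. \<exists>N\<ge>0. \<exists>C>0. \<forall>z\<in>\<Omega>. \<forall>x. \<forall>r>0. \<forall>f\<in>V.
      Lp_norm p (ball x r) (T z f)
        \<le> ennreal (C * r powr (- real CARD('d) * (1/2 - enn2real (1 / p)))
                    * max ((r\<^sup>2 / cmod z) powr M) ((r\<^sup>2 / cmod z) powr (- N)))
          * ennreal_powr (\<Sum>n. ennreal (2 powr (- \<nu> * real n)) * (Lp_norm 2 (annulus x r n) f)\<^sup>2) (1/2))"

definition L2_Lp_bounds ::
  "ennreal \<Rightarrow> complex set
    \<Rightarrow> (real^'d::finite \<Rightarrow> 'a::real_normed_vector) set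
    \<Rightarrow> (complex \<Rightarrow> (real^'d \<Rightarrow> 'a) \<Rightarrow> (real^'d \<Rightarrow> 'b::real_normed_vector)) \<Rightarrow> bool"
  where "L2_Lp_bounds p \<Omega> V T \<longleftrightarrow> 2 \<le> p \<and>
    (\<exists>C>0. \<forall>z\<in>\<Omega>. \<forall>f\<in>V.
      Lp_norm p UNIV (T z f)
        \<le> ennreal (C * cmod z powr (- (real CARD('d) / 2) * (1/2 - enn2real (1 / p))))
          * Lp_norm 2 UNIV f)"

end

theory Submission
  imports Defs
begin

text \<open>Hoelder's inequality alone interpolates in the wrong direction: it bounds \<open>\<parallel>T f\<parallel>\<close> in the intermediate space by a
product of the two weighted \<open>L\<^sup>2\<close> norms of \<open>f\<close>, and that product dominates the norm with the interpolated weight.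
The linearity of \<open>T\<close> must be used, by cutting \<open>f\<close> into pieces on which the two weights are comparable.

Work with reciprocal exponents \<open>a = 1/p \<in> [0, 1/2]\<close>, which interpolate linearly and include \<open>p = \<infinity>\<close>. An
\<open>L\<^sup>2\<close>-\<open>L\<^sup>p\<close> bound is a decay estimate of order \<open>0\<close>, because the powers of \<open>r\<^sup>2/|z|\<close> are free
(\<open>L2_Lp_bounds_imp_decay\<close>); so the second assertion is a case of the first. If one of the two given estimates is
at least as strong as the claimed one both in exponent and in order, Hoelder's inequality on the ball suffices
(\<open>decay_estimates_weaken\<close>). In the remaining case the exponents differ, the interpolation parameter lies strictly
between \<open>0\<close> and \<open>1\<close>, and after a symmetry \<open>\<nu>\<^sub>1 < \<nu>\<^sub>0\<close>; in particular the interpolated order \<open>\<nu>\<close> is positive.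

Let \<open>B\<^sub>n\<close> be the ball of radius \<open>2\<^sup>n r\<close> and let \<open>h\<^sub>n \<in> V\<close> agree with \<open>f\<close> on a fixed fraction of \<open>B\<^sub>n\<close>, vanish
off \<open>B\<^sub>n\<close>, and satisfy \<open>\<parallel>h\<^sub>n\<parallel> \<le> C b\<^sub>n\<close> with \<open>b\<^sub>n = \<parallel>f\<parallel>\<close> in \<open>L\<^sup>2(B\<^sub>n)\<close>. The pieces \<open>u\<^sub>n = h\<^sub>n - h\<^sub>n\<^sub>-\<^sub>1\<close> live at distance about
\<open>2\<^sup>n r\<close>, so both endpoint estimates apply to \<open>T u\<^sub>n\<close> with explicit geometric factors relative to
\<open>c\<^sub>n = 2 powr (- \<nu> n / 2) b\<^sub>n\<close>. Summing a geometric series in \<open>2 powr (- \<nu>)\<close> shows that \<open>\<Sum>c\<^sub>n\<^sup>2\<close> is controlled by the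
weighted norm in the claim (\<open>ball_weighted_sum\<close>); here the large overlap of the balls costs nothing since \<open>\<nu> > 0\<close>.
Finally \<open>(\<Sum>|T u\<^sub>n|)\<^sup>2\<close> is expanded into products \<open>|T u\<^sub>n| |T u\<^sub>m|\<close>. Estimating the two factors at parameters slightly
above and slightly below \<open>\<theta>\<close> gives a gain that is geometric in \<open>|n - m|\<close>, and Schur's test sums the products in
\<open>L\<^sup>p\<^sup>/\<^sup>2\<close>, a normed space because \<open>p \<ge> 2\<close> (\<open>Lp_bounded_interpolate_sum\<close>). These steps are assembled in
\<open>interpolation_core\<close>.

For \<open>V = L\<^sup>2\<close> the truncation \<open>h\<^sub>n\<close> is multiplication by an indicator. For divergence-free fields a cutoff \<open>\<chi> f\<close> has
to be corrected. On a cube a divergence-free \<open>f\<close> is \<open>f\<^sub>j = \<Sum>\<^sub>i \<partial>\<^sub>i A\<^sub>i\<^sub>j\<close> for an antisymmetric \<open>A\<close>, and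
\<open>h\<^sub>j = \<Sum>\<^sub>i \<partial>\<^sub>i (\<chi> A\<^sub>i\<^sub>j) = \<chi> f\<^sub>j + \<Sum>\<^sub>i \<partial>\<^sub>i\<chi> A\<^sub>i\<^sub>j\<close> is again divergence-free. Singling out one axis \<open>0\<close>, one may take \<open>A\<close> with
entries in the row and column of that axis only: \<open>A\<^sub>0\<^sub>k\<close> is the antiderivative of \<open>f\<^sub>k\<close> along the axis, averaged over
its starting point, and one single entry is corrected by the antiderivative, along a second axis, of the averaged
flux of \<open>f\<^sub>0\<close>. Since only integrals over segments occur, \<open>A\<close> is bounded in \<open>L\<^sup>2\<close> by \<open>f\<close> on the cube. All this is
carried out weakly: moving the operators onto a test function \<open>\<phi>\<close> turns \<open>\<integral> h \<sqdot> \<nabla>\<phi>\<close> into \<open>\<integral> f \<sqdot> \<nabla>\<psi>\<close> for another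
test function \<open>\<psi>\<close> (\<open>cut_field_weak\<close>). Scaling transports the result to all balls (\<open>truncatable_L2_sigma\<close>).\<close>

section \<open>Norm bounds in terms of the reciprocal exponent, and interpolation of sums\<close>

text \<open>The norm of \<open>g \<ge> 0\<close> in \<open>L\<^sup>1\<^sup>/\<^sup>a\<close> is at most \<open>K\<close>. A predicate with a real bound, instead of a norm, treats the
essentially bounded case \<open>a = 0\<close> on the same footing and keeps all computations in the reals.\<close>
definition Lp_bounded :: "'m measure \<Rightarrow> real \<Rightarrow> real \<Rightarrow> ('m \<Rightarrow> real) \<Rightarrow> bool"
  where "Lp_bounded M a K g \<longleftrightarrow>
    (if a = 0 then AE x in M. g x \<le> K
     else (\<integral>\<^sup>+x. ennreal (g x powr (1/a)) \<partial>M) \<le> ennreal (K powr (1/a)))"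

text \<open>Bounds are proved for functions of norm at most one, where pointwise convexity inequalities integrate directly.\<close>
lemma Lp_bounded_normalize:
  assumes "a > 0" "K > 0" "\<And>x. g x \<ge> 0" and [measurable]: "g \<in> borel_measurable M"
  shows "Lp_bounded M a K g \<longleftrightarrow> (\<integral>\<^sup>+x. ennreal ((g x / K) powr (1/a)) \<partial>M) \<le> 1"
proof -
  have "(\<integral>\<^sup>+x. ennreal (g x powr (1/a)) \<partial>M)
      = (\<integral>\<^sup>+x. ennreal (K powr (1/a)) * ennreal ((g x / K) powr (1/a)) \<partial>M)"
    using assms by (intro nn_integral_cong) (simp add: ennreal_mult[symmetric] powr_divide)
  also have "\<dots> = ennreal (K powr (1/a)) * (\<integral>\<^sup>+x. ennreal ((g x / K) powr (1/a)) \<partial>M)"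
    by (rule nn_integral_cmult) measurable
  finally have *: "(\<integral>\<^sup>+x. ennreal (g x powr (1/a)) \<partial>M) = \<dots>" .
  have "ennreal (K powr (1/a)) * I \<le> ennreal (K powr (1/a)) \<longleftrightarrow> I \<le> 1" for I
  proof -
    have "K powr (1/a) > 0" using assms by simp
    then show ?thesis
      by (metis ennreal_mult_le_mult_iff ennreal_neq_top mult.right_neutral
          ennreal_eq_0_iff linorder_not_le)
  qed
  then show ?thesis using assms by (simp add: Lp_bounded_def *)
qed

lemma Lp_bounded_powr:
  assumes "Lp_bounded M a K g" "a \<ge> 0" "s > 0" "K > 0" "\<And>x. g x \<ge> 0"
  shows "Lp_bounded M (s * a) (K powr s) (\<lambda>x. g x powr s)"
proof (cases "a = 0")
  case True
  with assms have "AE x in M. g x \<le> K" by (simp add: Lp_bounded_def)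
  then have "AE x in M. g x powr s \<le> K powr s"
    by eventually_elim (use assms in \<open>auto intro: powr_mono2\<close>)
  then show ?thesis using True by (simp add: Lp_bounded_def)
next
  case False
  then show ?thesis using assms by (simp add: Lp_bounded_def powr_powr)
qed

lemma Lp_bounded_mono:
  assumes "Lp_bounded M a K g" "a \<ge> 0" "0 < K" "K \<le> L" "AE x in M. h x \<le> g x" "\<And>x. h x \<ge> 0"
  shows "Lp_bounded M a L h"
proof (cases "a = 0")
  case True
  with assms(1) have "AE x in M. g x \<le> K" by (simp add: Lp_bounded_def)
  with assms(5) have "AE x in M. h x \<le> L"
    by eventually_elim (use assms(4) in simp)
  then show ?thesis using True by (simp add: Lp_bounded_def)
next
  case False
  have "(\<integral>\<^sup>+x. ennreal (h x powr (1/a)) \<partial>M) \<le> (\<integral>\<^sup>+x. ennreal (g x powr (1/a)) \<partial>M)"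
    using assms(5) by (intro nn_integral_mono_AE)
      (auto elim!: eventually_mono intro!: ennreal_leI powr_mono2 assms(6) simp: assms(2))
  also have "\<dots> \<le> ennreal (K powr (1/a))" using assms(1) False by (simp add: Lp_bounded_def)
  also have "\<dots> \<le> ennreal (L powr (1/a))"
    using assms by (intro ennreal_leI powr_mono2) auto
  finally show ?thesis using False by (simp add: Lp_bounded_def)
qed

lemma Lp_bounded_mult_bounded:
  assumes "b > 0" "AE x in M. g x \<le> K" "Lp_bounded M b L h" "K > 0" "L > 0"
    "\<And>x. g x \<ge> 0" "\<And>x. h x \<ge> 0"
    and [measurable]: "h \<in> borel_measurable M"
  shows "Lp_bounded M b (K * L) (\<lambda>x. g x * h x)"
proof -
  have "(\<integral>\<^sup>+x. ennreal ((g x * h x) powr (1/b)) \<partial>M)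
      \<le> (\<integral>\<^sup>+x. ennreal (K powr (1/b)) * ennreal (h x powr (1/b)) \<partial>M)"
    using assms(2)
  proof (intro nn_integral_mono_AE, eventually_elim)
    fix x assume "g x \<le> K"
    then have "(g x * h x) powr (1/b) \<le> (K * h x) powr (1/b)"
      using assms by (intro powr_mono2 mult_right_mono mult_nonneg_nonneg) auto
    then show "ennreal ((g x * h x) powr (1/b)) \<le> ennreal (K powr (1/b)) * ennreal (h x powr (1/b))"
      using assms by (simp add: powr_mult ennreal_mult[symmetric])
  qed
  also have "\<dots> = ennreal (K powr (1/b)) * (\<integral>\<^sup>+x. ennreal (h x powr (1/b)) \<partial>M)"
    by (rule nn_integral_cmult) measurable
  also have "\<dots> \<le> ennreal (K powr (1/b)) * ennreal (L powr (1/b))"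
    using assms by (intro mult_left_mono) (auto simp: Lp_bounded_def)
  also have "\<dots> = ennreal ((K * L) powr (1/b))"
    using assms by (simp add: powr_mult ennreal_mult[symmetric])
  finally show ?thesis using assms by (simp add: Lp_bounded_def)
qed

text \<open>Hoelder's inequality: in reciprocal exponents it is additive. It is the integrated form of Young's inequality for
the normalized functions.\<close>
lemma Lp_bounded_mult:
  assumes "Lp_bounded M a K g" "Lp_bounded M b L h" "a \<ge> 0" "b \<ge> 0" "K > 0" "L > 0"
    "\<And>x. g x \<ge> 0" "\<And>x. h x \<ge> 0"
    and [measurable]: "g \<in> borel_measurable M" "h \<in> borel_measurable M"
  shows "Lp_bounded M (a + b) (K * L) (\<lambda>x. g x * h x)"
proof -
  consider "a = 0" "b = 0" | "a = 0" "b > 0" | "a > 0" "b = 0" | "a > 0" "b > 0"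
    using assms(3,4) by linarith
  then show ?thesis
  proof cases
    case 1
    with assms have "AE x in M. g x \<le> K" "AE x in M. h x \<le> L" by (auto simp: Lp_bounded_def)
    then have "AE x in M. g x * h x \<le> K * L"
      by eventually_elim (use assms in \<open>auto intro!: mult_mono simp: less_imp_le\<close>)
    with 1 show ?thesis by (simp add: Lp_bounded_def)
  next
    case 2
    then show ?thesis using Lp_bounded_mult_bounded[where b=b and M=M and g=g and K=K and L=L and h=h] assms by (auto simp: Lp_bounded_def)
  next
    case 3
    then show ?thesis using Lp_bounded_mult_bounded[where b=a and M=M and g=h and K=L and L=K and h=g] assms
      by (auto simp: Lp_bounded_def mult.commute)
  next
    case 4
    let ?s = "a + b"
    have *: "((g x * h x) / (K * L)) powr (1/?s)
        \<le> a/?s * (g x / K) powr (1/a) + b/?s * (h x / L) powr (1/b)" for x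
    proof (cases "g x = 0 \<or> h x = 0")
      case True
      then show ?thesis using 4 by auto
    next
      case False
      have "((g x * h x) / (K * L)) powr (1/?s) =
         ((g x / K) powr (1/a)) powr (a/?s) * ((h x / L) powr (1/b)) powr (b/?s)"
        using 4 assms by (simp add: powr_powr powr_mult[symmetric])
      also have "\<dots> \<le> a/?s * (g x / K) powr (1/a) + b/?s * (h x / L) powr (1/b)"
        using 4 False assms(5,6) by (intro Youngs_inequality_0) (auto simp: add_divide_distrib[symmetric])
      finally show ?thesis .
    qed
    have "(\<integral>\<^sup>+x. ennreal (((g x * h x) / (K * L)) powr (1/?s)) \<partial>M)
      \<le> (\<integral>\<^sup>+x. ennreal (a/?s) * ennreal ((g x / K) powr (1/a))
            + ennreal (b/?s) * ennreal ((h x / L) powr (1/b)) \<partial>M)"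
      using 4 * by (intro nn_integral_mono)
        (auto simp: ennreal_mult[symmetric] ennreal_plus[symmetric] simp del: ennreal_plus intro!: ennreal_leI)
    also have "\<dots> = ennreal (a/?s) * (\<integral>\<^sup>+x. ennreal ((g x / K) powr (1/a)) \<partial>M)
            + ennreal (b/?s) * (\<integral>\<^sup>+x. ennreal ((h x / L) powr (1/b)) \<partial>M)"
      by (simp add: nn_integral_add nn_integral_cmult)
    also have "\<dots> \<le> ennreal (a/?s) * 1 + ennreal (b/?s) * 1"
      using 4 assms Lp_bounded_normalize[of a K g M] Lp_bounded_normalize[of b L h M]
      by (intro add_mono mult_left_mono) auto
    also have "\<dots> = 1"
      using 4 by (simp add: ennreal_plus[symmetric] add_divide_distrib[symmetric] del: ennreal_plus)
    finally show ?thesis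
      using 4 assms by (subst Lp_bounded_normalize) auto
  qed
qed

lemma convex_on_powr_nonneg:
  assumes "p \<ge> 1" shows "convex_on {0..} (\<lambda>x::real. x powr p)"
proof -
  show ?thesis
  proof (rule convex_onI)
    fix t x y :: real assume t: "0 < t" "t < 1" and "x \<in> {0..}" "y \<in> {0..}"
    then consider "x > 0" "y > 0" | "x = 0" "y \<ge> 0" | "x \<ge> 0" "y = 0" by fastforce
    then show "((1 - t) *\<^sub>R x + t *\<^sub>R y) powr p \<le> (1 - t) * x powr p + t * y powr p"
    proof cases
      case 1
      then show ?thesis using convex_onD[OF powr_convex[OF assms], of t x y] t by auto
    next
      case 2
      have "t powr p \<le> t powr 1" using t assms by (intro powr_mono') auto
      then have "t powr p * y powr p \<le> t * y powr p" using t by (intro mult_right_mono) auto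
      then show ?thesis using 2 t assms by (simp add: powr_mult)
    next
      case 3
      have "(1-t) powr p \<le> (1-t) powr 1" using t assms by (intro powr_mono') auto
      then have "(1-t) powr p * x powr p \<le> (1-t) * x powr p" using t by (intro mult_right_mono) auto
      then show ?thesis using 3 t assms by (simp add: powr_mult)
    qed
  qed simp
qed

text \<open>Minkowski's inequality: the sum of the \<open>g i\<close>, divided by the sum of the bounds, is a convex combination of the
normalized functions \<open>g i / K i\<close>.\<close>
lemma Lp_bounded_sum:
  assumes "finite I" "I \<noteq> {}" "0 < a" "a \<le> 1"
    and Lp_bounded: "\<And>i. i \<in> I \<Longrightarrow> Lp_bounded M a (K i) (g i)"
    and K: "\<And>i. i \<in> I \<Longrightarrow> K i > 0" and g: "\<And>i x. g i x \<ge> 0"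
    and [measurable]: "\<And>i. g i \<in> borel_measurable M"
  shows "Lp_bounded M a (\<Sum>i\<in>I. K i) (\<lambda>x. \<Sum>i\<in>I. g i x)"
proof -
  let ?K = "\<Sum>i\<in>I. K i"
  have Kpos: "?K > 0" using assms by (intro sum_pos) auto
  have *: "((\<Sum>i\<in>I. g i x) / ?K) powr (1/a) \<le> (\<Sum>i\<in>I. (K i / ?K) * (g i x / K i) powr (1/a))" for x
  proof -
    have "(\<Sum>i\<in>I. g i x) / ?K = (\<Sum>i\<in>I. (K i / ?K) *\<^sub>R (g i x / K i))"
      unfolding sum_divide_distrib
    proof (rule sum.cong)
      fix i assume "i \<in> I"
      with K[of i] show "g i x / ?K = (K i / ?K) *\<^sub>R (g i x / K i)" by simp
    qed simp
    moreover have "(\<Sum>i\<in>I. (K i / ?K) *\<^sub>R (g i x / K i)) powr (1/a)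
        \<le> (\<Sum>i\<in>I. (K i / ?K) * (g i x / K i) powr (1/a))"
    proof (rule convex_on_sum[OF assms(1,2) convex_on_powr_nonneg])
      show "1 \<le> 1/a" using assms by simp
      show "(\<Sum>i\<in>I. K i / ?K) = 1" using Kpos by (simp add: sum_divide_distrib[symmetric])
    qed (use K g Kpos in \<open>auto intro!: divide_nonneg_nonneg less_imp_le[OF K]\<close>)
    ultimately show ?thesis by simp
  qed
  have "(\<integral>\<^sup>+x. ennreal (((\<Sum>i\<in>I. g i x) / ?K) powr (1/a)) \<partial>M)
    \<le> (\<integral>\<^sup>+x. (\<Sum>i\<in>I. ennreal (K i / ?K) * ennreal ((g i x / K i) powr (1/a))) \<partial>M)"
  proof (rule nn_integral_mono)
    fix x
    have "ennreal (((\<Sum>i\<in>I. g i x) / ?K) powr (1/a))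
        \<le> ennreal (\<Sum>i\<in>I. (K i / ?K) * (g i x / K i) powr (1/a))" by (rule ennreal_leI[OF *])
    also have "\<dots> = (\<Sum>i\<in>I. ennreal ((K i / ?K) * (g i x / K i) powr (1/a)))"
      using K Kpos by (subst sum_ennreal) (auto intro!: mult_nonneg_nonneg divide_nonneg_nonneg less_imp_le[OF K])
    also have "\<dots> = (\<Sum>i\<in>I. ennreal (K i / ?K) * ennreal ((g i x / K i) powr (1/a)))"
      using K Kpos by (intro sum.cong refl ennreal_mult) (auto intro!: divide_nonneg_nonneg less_imp_le[OF K])
    finally show "ennreal (((\<Sum>i\<in>I. g i x) / ?K) powr (1/a)) \<le> \<dots>" .
  qed
  also have "\<dots> = (\<Sum>i\<in>I. ennreal (K i / ?K) * (\<integral>\<^sup>+x. ennreal ((g i x / K i) powr (1/a)) \<partial>M))"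
    by (subst nn_integral_sum) (auto intro!: sum.cong nn_integral_cmult)
  also have "\<dots> \<le> (\<Sum>i\<in>I. ennreal (K i / ?K) * 1)"
    using assms Lp_bounded_normalize[of a _ _ M] by (intro sum_mono mult_left_mono) auto
  also have "\<dots> = 1"
    using K Kpos by (simp add: sum_ennreal less_imp_le sum_divide_distrib[symmetric])
  finally show ?thesis
    using assms Kpos by (subst Lp_bounded_normalize) (auto intro: sum_nonneg)
qed

text \<open>Log-convexity of the norm in the reciprocal exponent, from Hoelder's inequality for \<open>g = g\<^sup>1\<^sup>-\<^sup>t g\<^sup>t\<close>.\<close>
lemma Lp_bounded_interpolate:
  assumes "Lp_bounded M a K g" "Lp_bounded M b L g" "a \<ge> 0" "b \<ge> 0" "0 < t" "t < 1" "K > 0" "L > 0"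
    "\<And>x. g x \<ge> 0" and [measurable]: "g \<in> borel_measurable M"
  shows "Lp_bounded M ((1 - t) * a + t * b) (K powr (1 - t) * L powr t) g"
proof -
  have "Lp_bounded M ((1 - t) * a + t * b) (K powr (1 - t) * L powr t) (\<lambda>x. g x powr (1 - t) * g x powr t)"
    using assms by (intro Lp_bounded_mult Lp_bounded_powr) auto
  also have "(\<lambda>x. g x powr (1 - t) * g x powr t) = g"
    using assms by (auto simp: powr_add[symmetric])
  finally show ?thesis .
qed

text \<open>Schur's test for the kernel \<open>s ^ |n - m|\<close>; the distance is written with \<open>max\<close> and \<open>min\<close> because subtraction of
natural numbers truncates.\<close>
lemma schur_geometric:
  fixes c :: "nat \<Rightarrow> real"
  assumes "0 < s" "s < 1" "finite A"
  shows "(\<Sum>(n, m)\<in>A \<times> A. c n * c m * s ^ (max n m - min n m)) \<le> 2 / (1 - s) * (\<Sum>n\<in>A. (c n)\<^sup>2)"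
proof -
  define k where "k n m = s ^ (max n m - min n m)" for n m :: nat
  have kpos: "k n m > 0" for n m using assms by (simp add: k_def)
  have row: "(\<Sum>m\<in>A. k n m) \<le> 2 / (1 - s)" for n
  proof -
    have g: "(\<Sum>j\<in>J. s ^ j) \<le> 1 / (1 - s)" if "finite J" for J
      using assms that by (subst suminf_geometric[symmetric])
        (auto intro!: sum_le_suminf summable_geometric)
    have "(\<Sum>m\<in>A. k n m) = (\<Sum>m\<in>{m\<in>A. m \<le> n}. k n m) + (\<Sum>m\<in>{m\<in>A. \<not> m \<le> n}. k n m)"
      using assms by (subst sum.union_disjoint[symmetric]) (auto intro!: sum.cong)
    also have "(\<Sum>m\<in>{m\<in>A. m \<le> n}. k n m) = (\<Sum>j\<in>(\<lambda>m. n - m) ` {m\<in>A. m \<le> n}. s ^ j)"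
      by (subst sum.reindex) (auto simp: inj_on_def k_def max_def min_def intro!: sum.cong)
    also have "\<dots> \<le> 1 / (1 - s)" using assms by (intro g) auto
    also have "(\<Sum>m\<in>{m\<in>A. \<not> m \<le> n}. k n m) = (\<Sum>j\<in>(\<lambda>m. m - n) ` {m\<in>A. \<not> m \<le> n}. s ^ j)"
      by (subst sum.reindex) (auto simp: inj_on_def k_def max_def min_def intro!: sum.cong)
    also have "\<dots> \<le> 1 / (1 - s)" using assms by (intro g) auto
    finally show ?thesis by simp
  qed
  have "(\<Sum>(n, m)\<in>A \<times> A. c n * c m * k n m) = (\<Sum>n\<in>A. \<Sum>m\<in>A. c n * c m * k n m)"
    by (simp add: sum.cartesian_product)
  also have "\<dots> \<le> (\<Sum>n\<in>A. \<Sum>m\<in>A. ((c n)\<^sup>2 / 2 + (c m)\<^sup>2 / 2) * k n m)"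
  proof (intro sum_mono mult_right_mono)
    fix n m
    have "0 \<le> (c n - c m)\<^sup>2" by simp
    then show "c n * c m \<le> (c n)\<^sup>2 / 2 + (c m)\<^sup>2 / 2" by (simp add: power2_diff)
    show "0 \<le> k n m" using kpos[of n m] by simp
  qed
  also have "\<dots> = (\<Sum>n\<in>A. \<Sum>m\<in>A. (c n)\<^sup>2 / 2 * k n m) + (\<Sum>n\<in>A. \<Sum>m\<in>A. (c m)\<^sup>2 / 2 * k n m)"
    by (simp add: distrib_right sum.distrib)
  also have "(\<Sum>n\<in>A. \<Sum>m\<in>A. (c m)\<^sup>2 / 2 * k n m) = (\<Sum>n\<in>A. \<Sum>m\<in>A. (c n)\<^sup>2 / 2 * k n m)"
    by (subst sum.swap) (simp add: k_def max.commute min.commute)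
  also have "(\<Sum>n\<in>A. \<Sum>m\<in>A. (c n)\<^sup>2 / 2 * k n m) + (\<Sum>n\<in>A. \<Sum>m\<in>A. (c n)\<^sup>2 / 2 * k n m)
      = (\<Sum>n\<in>A. (c n)\<^sup>2 * (\<Sum>m\<in>A. k n m))"
    by (simp add: sum.distrib[symmetric] sum_distrib_left sum_distrib_right mult.commute)
  also have "\<dots> \<le> (\<Sum>n\<in>A. (c n)\<^sup>2 * (2 / (1 - s)))"
    by (intro sum_mono mult_left_mono row) auto
  also have "\<dots> = 2 / (1 - s) * (\<Sum>n\<in>A. (c n)\<^sup>2)" by (simp add: sum_distrib_left mult.commute)
  finally show ?thesis by (simp add: k_def)
qed

text \<open>The real interpolation step. Every \<open>G n\<close> has one endpoint bound that decays in \<open>n\<close> and another that grows, balanced at the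
parameter \<open>t\<close>, where the bound is \<open>c n\<close>. Adding these balanced bounds would give the sum of the \<open>c n\<close>. The square
of \<open>\<Sum>G n\<close> does better: in a product of two terms with \<open>n \<le> m\<close>, bounding \<open>G n\<close> at \<open>t + \<tau>\<close> and \<open>G m\<close> at \<open>t - \<tau>\<close> leaves the
factor \<open>2 powr (- \<tau> d (m - n))\<close>, so only the square sum of the \<open>c n\<close> remains.\<close>
lemma Lp_bounded_interpolate_sum:
  fixes a0 a1 t d :: real
  assumes "a0 \<ge> 0" "a1 \<ge> 0" "a0 \<le> 1/2" "a1 \<le> 1/2" "a0 \<noteq> a1" "0 < t" "t < 1" "d > 0"
  obtains C where "C > 0" and
    "\<And>(M :: 'm measure) K0 K1 L c G. K0 > 0 \<Longrightarrow> K1 > 0 \<Longrightarrow> (\<And>n. c n > 0) \<Longrightarrow>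
      (\<And>n x. G n x \<ge> 0) \<Longrightarrow> (\<And>n. G n \<in> borel_measurable M) \<Longrightarrow>
      (\<And>n. n \<le> L \<Longrightarrow> Lp_bounded M a0 (K0 * (c n * 2 powr (- t * d * real n))) (G n)) \<Longrightarrow>
      (\<And>n. n \<le> L \<Longrightarrow> Lp_bounded M a1 (K1 * (c n * 2 powr ((1 - t) * d * real n))) (G n)) \<Longrightarrow>
      Lp_bounded M ((1 - t) * a0 + t * a1) (C * (K0 powr (1 - t) * K1 powr t) * sqrt (\<Sum>n\<le>L. (c n)\<^sup>2))
        (\<lambda>x. \<Sum>n\<le>L. G n x)"
proof -
  \<comment> \<open>half of the room, so that \<open>t + \<tau>\<close> and \<open>t - \<tau>\<close> are proper interpolation parameters\<close>
  define \<tau> where "\<tau> = min t (1 - t) / 2"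
  have tau: "0 < \<tau>" "\<tau> < t" "\<tau> < 1 - t" using assms by (auto simp: \<tau>_def min_def)
  define s where "s = 2 powr (- (\<tau> * d))"
  have s: "0 < s" "s < 1" using tau assms by (auto simp: s_def powr_less_one)
  define C where "C = sqrt (2 / (1 - s))"
  have "C > 0" using s by (simp add: C_def)
  moreover have "Lp_bounded M ((1 - t) * a0 + t * a1)
      (C * (K0 powr (1 - t) * K1 powr t) * sqrt (\<Sum>n\<le>L. (c n)\<^sup>2)) (\<lambda>x. \<Sum>n\<le>L. G n x)"
    if K: "K0 > 0" "K1 > 0" and c: "\<And>n. c n > 0" and G: "\<And>n x. G n x \<ge> 0"
      and Gm [measurable]: "\<And>n. G n \<in> borel_measurable M"
      and b0: "\<And>n. n \<le> L \<Longrightarrow> Lp_bounded M a0 (K0 * (c n * 2 powr (- t * d * real n))) (G n)"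
      and b1: "\<And>n. n \<le> L \<Longrightarrow> Lp_bounded M a1 (K1 * (c n * 2 powr ((1 - t) * d * real n))) (G n)"
    for M :: "'m measure" and K0 K1 L c G
  proof -
    define a where "a = (1 - t) * a0 + t * a1"
    define K where "K = K0 powr (1 - t) * K1 powr t"
    have "K > 0" using K unfolding K_def by simp
    have "a > 0"
    proof -
      have "a0 > 0 \<or> a1 > 0" using assms by linarith
      then show ?thesis
        unfolding a_def using assms by (auto intro: add_pos_nonneg add_nonneg_pos)
    qed
    have "a \<le> (1 - t) * (1/2) + t * (1/2)"
      unfolding a_def using assms by (intro add_mono mult_left_mono) auto
    then have "a \<le> 1/2" by (simp add: field_simps)
    have int: "Lp_bounded M ((1 - (t + e)) * a0 + (t + e) * a1)
        (K0 powr (1 - (t + e)) * K1 powr (t + e) * (c n * 2 powr (e * d * real n))) (G n)"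
      if "n \<le> L" "- t < e" "e < 1 - t" for n e
    proof -
      have "Lp_bounded M ((1 - (t + e)) * a0 + (t + e) * a1)
        ((K0 * (c n * 2 powr (- t * d * real n))) powr (1 - (t + e)) *
         (K1 * (c n * 2 powr ((1 - t) * d * real n))) powr (t + e)) (G n)"
        using assms that K c G by (intro Lp_bounded_interpolate b0 b1) auto
      also have "(K0 * (c n * 2 powr (- t * d * real n))) powr (1 - (t + e)) *
         (K1 * (c n * 2 powr ((1 - t) * d * real n))) powr (t + e) =
         K0 powr (1 - (t + e)) * K1 powr (t + e) * (c n powr (1 - (t + e)) * c n powr (t + e)) *
           (2 powr (- t * d * real n * (1 - (t + e))) * 2 powr ((1 - t) * d * real n * (t + e)))"
        using K c[of n] by (simp add: powr_mult powr_powr)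
      also have "c n powr (1 - (t + e)) * c n powr (t + e) = c n"
        using c[of n] by (simp add: powr_add[symmetric])
      also have "2 powr (- t * d * real n * (1 - (t + e))) * 2 powr ((1 - t) * d * real n * (t + e))
          = 2 powr (e * d * real n)"
        by (simp add: powr_add[symmetric] algebra_simps)
      finally show ?thesis by (simp add: mult.assoc)
    qed
    have prod: "Lp_bounded M (2 * a) (K\<^sup>2 * (c n * c m * s ^ (m - n))) (\<lambda>x. G n x * G m x)"
      if "n \<le> m" "m \<le> L" for n m
    proof -
      have "Lp_bounded M (((1 - (t + \<tau>)) * a0 + (t + \<tau>) * a1) + ((1 - (t + (-\<tau>))) * a0 + (t + (-\<tau>)) * a1))
        ((K0 powr (1 - (t + \<tau>)) * K1 powr (t + \<tau>) * (c n * 2 powr (\<tau> * d * real n))) *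
         (K0 powr (1 - (t + (-\<tau>))) * K1 powr (t + (-\<tau>)) * (c m * 2 powr ((-\<tau>) * d * real m))))
        (\<lambda>x. G n x * G m x)"
        using that tau assms K c G
        by (intro Lp_bounded_mult int) (auto intro!: add_nonneg_nonneg mult_nonneg_nonneg)
      also have "((1 - (t + \<tau>)) * a0 + (t + \<tau>) * a1) + ((1 - (t + (-\<tau>))) * a0 + (t + (-\<tau>)) * a1) = 2 * a"
        by (simp add: a_def algebra_simps)
      also have "(K0 powr (1 - (t + \<tau>)) * K1 powr (t + \<tau>) * (c n * 2 powr (\<tau> * d * real n))) *
         (K0 powr (1 - (t + (-\<tau>))) * K1 powr (t + (-\<tau>)) * (c m * 2 powr ((-\<tau>) * d * real m)))
         = (K0 powr (1 - (t + \<tau>)) * K0 powr (1 - (t + (-\<tau>)))) * (K1 powr (t + \<tau>) * K1 powr (t + (-\<tau>)))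
           * (c n * c m) * (2 powr (\<tau> * d * real n) * 2 powr ((-\<tau>) * d * real m))"
        by (simp add: mult_ac)
      also have "K0 powr (1 - (t + \<tau>)) * K0 powr (1 - (t + (-\<tau>))) = (K0 powr (1 - t))\<^sup>2"
        by (simp add: powr_add[symmetric] power2_eq_square algebra_simps)
      also have "K1 powr (t + \<tau>) * K1 powr (t + (-\<tau>)) = (K1 powr t)\<^sup>2"
        by (simp add: powr_add[symmetric] power2_eq_square)
      also have "2 powr (\<tau> * d * real n) * 2 powr ((-\<tau>) * d * real m) = s ^ (m - n)"
        using that by (simp add: s_def powr_add[symmetric] powr_realpow[symmetric] powr_powr of_nat_diff algebra_simps)
      finally show ?thesis by (simp add: K_def power_mult_distrib mult_ac)
    qed
    have prod': "Lp_bounded M (2 * a) (K\<^sup>2 * (c n * c m * s ^ (max n m - min n m))) (\<lambda>x. G n x * G m x)"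
      if "n \<le> L" "m \<le> L" for n m
      using prod[of n m] prod[of m n] that by (cases "n \<le> m") (auto simp: max_def min_def mult_ac)
    let ?I = "{..L} \<times> {..L}"
    define S where "S = (\<Sum>n\<le>L. (c n)\<^sup>2)"
    have "S > 0" unfolding S_def using c by (intro sum_pos) (auto simp: less_imp_neq[symmetric])
    have eq: "(\<lambda>x. \<Sum>i\<in>?I. G (fst i) x * G (snd i) x) = (\<lambda>x. (\<Sum>n\<le>L. G n x)\<^sup>2)"
      by (auto simp: power2_eq_square sum_product sum.cartesian_product case_prod_beta)
    have "Lp_bounded M (2 * a) (\<Sum>i\<in>?I. K\<^sup>2 * (c (fst i) * c (snd i) * s ^ (max (fst i) (snd i) - min (fst i) (snd i))))
       (\<lambda>x. \<Sum>i\<in>?I. G (fst i) x * G (snd i) x)"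
      using \<open>a > 0\<close> \<open>a \<le> 1/2\<close> \<open>K > 0\<close> c s G
      by (intro Lp_bounded_sum prod') auto
    then have "Lp_bounded M (2 * a) (2 / (1 - s) * K\<^sup>2 * S) (\<lambda>x. (\<Sum>n\<le>L. G n x)\<^sup>2)"
      unfolding eq
    proof (rule Lp_bounded_mono)
      have "(\<Sum>i\<in>?I. K\<^sup>2 * (c (fst i) * c (snd i) * s ^ (max (fst i) (snd i) - min (fst i) (snd i))))
         = K\<^sup>2 * (\<Sum>(n, m)\<in>?I. c n * c m * s ^ (max n m - min n m))"
        by (simp add: sum_distrib_left case_prod_beta)
      also have "\<dots> \<le> K\<^sup>2 * (2 / (1 - s) * S)"
        unfolding S_def using s by (intro mult_left_mono schur_geometric) auto
      finally show "(\<Sum>i\<in>?I. K\<^sup>2 * (c (fst i) * c (snd i) * s ^ (max (fst i) (snd i) - min (fst i) (snd i))))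
        \<le> 2 / (1 - s) * K\<^sup>2 * S" by (simp add: mult_ac)
      show "0 < (\<Sum>i\<in>?I. K\<^sup>2 * (c (fst i) * c (snd i) * s ^ (max (fst i) (snd i) - min (fst i) (snd i))))"
        using \<open>K > 0\<close> c s by (intro sum_pos) auto
    qed (use \<open>a > 0\<close> in auto)
    then have "Lp_bounded M (1/2 * (2 * a)) ((2 / (1 - s) * K\<^sup>2 * S) powr (1/2)) (\<lambda>x. (\<Sum>n\<le>L. G n x)\<^sup>2 powr (1/2))"
      using \<open>a > 0\<close> \<open>K > 0\<close> \<open>S > 0\<close> s by (intro Lp_bounded_powr) auto
    moreover have "(2 / (1 - s) * K\<^sup>2 * S) powr (1/2) = C * K * sqrt S"
      using \<open>K > 0\<close> \<open>S > 0\<close> s by (simp add: powr_half_sqrt C_def real_sqrt_mult real_sqrt_divide)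
    moreover have "(\<lambda>x. (\<Sum>n\<le>L. G n x)\<^sup>2 powr (1/2)) = (\<lambda>x. \<Sum>n\<le>L. G n x)"
      using G by (simp add: powr_half_sqrt sum_nonneg)
    moreover have "1/2 * (2 * a) = a" by simp
    ultimately show ?thesis unfolding a_def[symmetric] K_def[symmetric] S_def[symmetric] by metis
  qed
  ultimately show thesis by (rule that)
qed

section \<open>Smooth functions\<close>

text \<open>Smoothness in the sense of the test functions: all iterated partial derivatives exist and are continuous.\<close>
definition smooth :: "(real^'d::finite \<Rightarrow> complex) \<Rightarrow> bool"
  where "smooth \<phi> \<longleftrightarrow> (\<forall>k. C_k k \<phi>)"

lemma partial_deriv_eq:
  assumes "(\<phi> has_derivative D) (at x)"
  shows "partial_deriv i \<phi> x = D (axis i 1)"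
  unfolding partial_deriv_def using frechet_derivative_at[OF assms] by simp

lemma has_derivative_partials:
  fixes \<phi> :: "real^'d::finite \<Rightarrow> complex"
  assumes "\<phi> differentiable (at x)"
  shows "(\<phi> has_derivative (\<lambda>h. \<Sum>i\<in>UNIV. (h $ i) *\<^sub>R partial_deriv i \<phi> x)) (at x)"
proof -
  let ?D = "frechet_derivative \<phi> (at x)"
  have D: "(\<phi> has_derivative ?D) (at x)" using assms by (simp add: frechet_derivative_works)
  have lin: "linear ?D" using D by (rule has_derivative_linear)
  have "?D h = (\<Sum>i\<in>UNIV. (h $ i) *\<^sub>R partial_deriv i \<phi> x)" for h
  proof -
    have "?D h = ?D (\<Sum>i\<in>UNIV. (h $ i) *\<^sub>R axis i 1)"
      by (simp add: basis_expansion scalar_mult_eq_scaleR[symmetric])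
    also have "\<dots> = (\<Sum>i\<in>UNIV. (h $ i) *\<^sub>R ?D (axis i 1))"
      by (simp add: linear_sum[OF lin] linear_cmul[OF lin])
    finally show ?thesis by (simp add: partial_deriv_def)
  qed
  then have "?D = (\<lambda>h. \<Sum>i\<in>UNIV. (h $ i) *\<^sub>R partial_deriv i \<phi> x)" by auto
  with D show ?thesis by simp
qed

lemma C_k_differentiable: "C_k (Suc k) \<phi> \<Longrightarrow> \<phi> differentiable (at x)"
  by (auto simp: differentiable_on_def)

lemma C_k_Suc_imp: "C_k (Suc k) \<phi> \<Longrightarrow> C_k k \<phi>"
proof (induction k arbitrary: \<phi>)
  case 0
  then show ?case by (auto intro: differentiable_imp_continuous_on)
qed simp

lemma C_k_continuous: "C_k k \<phi> \<Longrightarrow> continuous_on UNIV \<phi>"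
  by (cases k) (auto intro: differentiable_imp_continuous_on)

lemma partial_deriv_add:
  assumes "\<phi> differentiable (at x)" "\<psi> differentiable (at x)"
  shows "partial_deriv i (\<lambda>x. \<phi> x + \<psi> x) x = partial_deriv i \<phi> x + partial_deriv i \<psi> x"
  using partial_deriv_eq[OF has_derivative_add[OF assms[unfolded frechet_derivative_works]]]
  by (simp add: partial_deriv_def)

lemma partial_deriv_mult:
  assumes "\<phi> differentiable (at x)" "\<psi> differentiable (at x)"
  shows "partial_deriv i (\<lambda>x. \<phi> x * \<psi> x) x = \<phi> x * partial_deriv i \<psi> x + partial_deriv i \<phi> x * \<psi> x"
  using partial_deriv_eq[OF has_derivative_mult[OF assms[unfolded frechet_derivative_works]]]
  by (simp add: partial_deriv_def)

lemma C_k_add: "C_k k \<phi> \<Longrightarrow> C_k k \<psi> \<Longrightarrow> C_k k (\<lambda>x. \<phi> x + \<psi> x)"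
proof (induction k arbitrary: \<phi> \<psi>)
  case (Suc k)
  have "partial_deriv i (\<lambda>x. \<phi> x + \<psi> x) = (\<lambda>x. partial_deriv i \<phi> x + partial_deriv i \<psi> x)" for i
    using Suc.prems by (intro ext partial_deriv_add C_k_differentiable)
  then show ?case using Suc by (auto intro: differentiable_on_add)
qed (auto intro: continuous_on_add)

lemma C_k_mult: "C_k k \<phi> \<Longrightarrow> C_k k \<psi> \<Longrightarrow> C_k k (\<lambda>x. \<phi> x * \<psi> x)"
proof (induction k arbitrary: \<phi> \<psi>)
  case (Suc k)
  have "partial_deriv i (\<lambda>x. \<phi> x * \<psi> x) = (\<lambda>x. \<phi> x * partial_deriv i \<psi> x + partial_deriv i \<phi> x * \<psi> x)" for i
    using Suc.prems by (intro ext partial_deriv_mult C_k_differentiable)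
  moreover have "C_k k (\<lambda>x. \<phi> x * partial_deriv i \<psi> x + partial_deriv i \<phi> x * \<psi> x)" for i
    using Suc.prems Suc.prems[THEN C_k_Suc_imp] by (intro C_k_add Suc.IH) auto
  moreover have "(\<lambda>x. \<phi> x * \<psi> x) differentiable_on UNIV"
    using Suc.prems by (auto simp: differentiable_on_def intro: differentiable_mult)
  ultimately show ?case by simp
qed (auto intro: continuous_on_mult)

lemma partial_deriv_const: "partial_deriv i (\<lambda>x. c) = (\<lambda>x. 0)"
  by (rule ext, subst partial_deriv_eq[OF has_derivative_const]) simp

lemma C_k_const: "C_k k (\<lambda>x. c)"
  by (induction k arbitrary: c) (auto simp: partial_deriv_const)

lemma smooth_add: "smooth \<phi> \<Longrightarrow> smooth \<psi> \<Longrightarrow> smooth (\<lambda>x. \<phi> x + \<psi> x)"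
  and smooth_mult: "smooth \<phi> \<Longrightarrow> smooth \<psi> \<Longrightarrow> smooth (\<lambda>x. \<phi> x * \<psi> x)"
  and smooth_const: "smooth (\<lambda>x. c)"
  by (auto simp: smooth_def intro: C_k_add C_k_mult C_k_const)

lemma smooth_minus: "smooth \<phi> \<Longrightarrow> smooth \<psi> \<Longrightarrow> smooth (\<lambda>x. \<phi> x - \<psi> x)"
  using smooth_add[of \<phi> "\<lambda>x. (-1) * \<psi> x"] smooth_mult[of "\<lambda>x. -1" \<psi>] by (simp add: smooth_const)

lemma smooth_differentiable: "smooth \<phi> \<Longrightarrow> \<phi> differentiable (at x)"
  unfolding smooth_def using C_k_differentiable by blast

lemma smooth_continuous: "smooth \<phi> \<Longrightarrow> continuous_on A \<phi>"
  unfolding smooth_def using C_k_continuous continuous_on_subset by blast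

lemma smooth_partial_deriv: "smooth \<phi> \<Longrightarrow> smooth (partial_deriv i \<phi>)"
  unfolding smooth_def by (metis C_k.simps(2))

lemma partial_deriv_minus:
  assumes "smooth \<phi>" "smooth \<psi>"
  shows "partial_deriv i (\<lambda>x. \<phi> x - \<psi> x) x = partial_deriv i \<phi> x - partial_deriv i \<psi> x"
  using partial_deriv_eq[OF has_derivative_diff[OF assms[THEN smooth_differentiable, unfolded frechet_derivative_works]]]
  by (simp add: partial_deriv_def)

lemma smooth_has_vector_derivative:
  fixes \<phi> :: "real^'d::finite \<Rightarrow> complex"
  assumes "smooth \<phi>"
  shows "((\<lambda>u. \<phi> (y + u *\<^sub>R axis i 1)) has_vector_derivative partial_deriv i \<phi> (y + u *\<^sub>R axis i 1)) (at u within A)"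
proof -
  let ?x = "y + u *\<^sub>R axis i 1"
  have D: "(\<phi> has_derivative frechet_derivative \<phi> (at ?x)) (at ?x)"
    using smooth_differentiable[OF assms] frechet_derivative_works by blast
  have "((\<lambda>u. y + u *\<^sub>R axis i (1::real)) has_derivative (\<lambda>h. h *\<^sub>R axis i 1)) (at u within A)"
    by (auto intro!: derivative_eq_intros)
  from has_derivative_compose[OF this D]
  show ?thesis
    unfolding has_vector_derivative_def partial_deriv_def
    by (simp add: linear_cmul[OF has_derivative_linear[OF D]])
qed

lemma partial_deriv_local_const:
  assumes "open U" "x \<in> U" "\<And>y. y \<in> U \<Longrightarrow> \<phi> y = c"
  shows "partial_deriv i \<phi> x = 0"
proof -
  have "(\<phi> has_derivative (\<lambda>h. 0)) (at x)"
    by (rule has_derivative_transform_within_open[where f="\<lambda>_. c" and s=U]) (use assms in auto)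
  from partial_deriv_eq[OF this] show ?thesis .
qed

lemma partial_deriv_local:
  assumes "open U" "x \<in> U" "\<And>y. y \<in> U \<Longrightarrow> \<phi> y = 0"
  shows "partial_deriv i \<phi> x = 0"
  using partial_deriv_local_const[OF assms] .

subsection \<open>Functions of one variable\<close>

text \<open>The one-dimensional counterpart of \<open>C_k\<close>, with values in the reals. Continuity of the last derivative is not
recorded, as it follows from the next order.\<close>
primrec k_differentiable :: "nat \<Rightarrow> (real \<Rightarrow> real) \<Rightarrow> bool" where
  "k_differentiable 0 g \<longleftrightarrow> True"
| "k_differentiable (Suc k) g \<longleftrightarrow> (\<forall>x. g field_differentiable (at x)) \<and> k_differentiable k (deriv g)"

lemma k_differentiable_Suc_imp: "k_differentiable (Suc k) g \<Longrightarrow> k_differentiable k g"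
  by (induction k arbitrary: g) auto

lemma k_differentiable_add: "k_differentiable k f \<Longrightarrow> k_differentiable k g \<Longrightarrow> k_differentiable k (\<lambda>x. f x + g x)"
proof (induction k arbitrary: f g)
  case (Suc k)
  then have "deriv (\<lambda>x. f x + g x) = (\<lambda>x. deriv f x + deriv g x)" by (intro ext deriv_add) auto
  with Suc show ?case by (auto intro: field_differentiable_add)
qed simp

lemma k_differentiable_mult: "k_differentiable k f \<Longrightarrow> k_differentiable k g \<Longrightarrow> k_differentiable k (\<lambda>x. f x * g x)"
proof (induction k arbitrary: f g)
  case (Suc k)
  then have "deriv (\<lambda>x. f x * g x) = (\<lambda>x. f x * deriv g x + deriv f x * g x)"
    by (intro ext deriv_mult) auto
  moreover have "k_differentiable k (\<lambda>x. f x * deriv g x + deriv f x * g x)"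
    using Suc.prems Suc.prems[THEN k_differentiable_Suc_imp] by (intro k_differentiable_add Suc.IH) auto
  ultimately show ?case using Suc.prems by (auto intro: field_differentiable_mult)
qed simp

lemma k_differentiable_const: "k_differentiable k (\<lambda>x. c)"
  by (induction k arbitrary: c) auto

lemma k_differentiable_affine: "k_differentiable k g \<Longrightarrow> k_differentiable k (\<lambda>x. g (a + s * x))"
proof (induction k arbitrary: g)
  case (Suc k)
  have D: "((\<lambda>x. g (a + s * x)) has_field_derivative s * deriv g (a + s * x)) (at x)" for x
  proof -
    have "(g has_field_derivative deriv g (a + s * x)) (at (a + s * x))"
      using Suc.prems field_differentiable_derivI by auto
    moreover have "((\<lambda>x. a + s * x) has_field_derivative s) (at x)"
      by (auto intro!: derivative_eq_intros)
    ultimately show ?thesis using DERIV_chain2 by (metis mult.commute)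
  qed
  then have "deriv (\<lambda>x. g (a + s * x)) = (\<lambda>x. s * deriv g (a + s * x))" by (auto intro: DERIV_imp_deriv)
  moreover have "k_differentiable k (\<lambda>x. s * deriv g (a + s * x))"
    using Suc by (intro k_differentiable_mult k_differentiable_const) auto
  ultimately show ?case using D by (auto simp: field_differentiable_def)
qed simp

text \<open>A family closed under differentiation that contains the flat function \<open>exp (- 1/x)\<close>, extended by \<open>0\<close>.\<close>
definition flat_exp :: "real poly \<Rightarrow> real \<Rightarrow> real"
  where "flat_exp q x = (if x > 0 then poly q (1/x) * exp (- 1/x) else 0)"

lemma poly_exp_tendsto_0: "((\<lambda>x. poly q x * exp (- x)) \<longlongrightarrow> (0::real)) at_top"
proof -
  have "((\<lambda>x. \<Sum>i\<le>degree q. coeff q i * (x ^ i / exp x)) \<longlongrightarrow> (\<Sum>i\<le>degree q. coeff q i * 0)) at_top"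
    by (intro tendsto_intros tendsto_power_div_exp_0)
  then show ?thesis
    by (simp add: poly_altdef sum_distrib_right exp_minus divide_inverse mult.assoc)
qed

lemma flat_exp_tendsto_0: "(flat_exp q \<longlongrightarrow> 0) (at 0)"
proof -
  have "((\<lambda>x. poly q (inverse x) * exp (- inverse x)) \<longlongrightarrow> 0) (at_right 0)"
    using filterlim_compose[OF poly_exp_tendsto_0 filterlim_inverse_at_top_right] by simp
  then have "(flat_exp q \<longlongrightarrow> 0) (at_right 0)"
    by (rule Lim_transform_eventually)
      (auto simp: flat_exp_def divide_inverse eventually_at_right_field intro: exI[of _ 1])
  moreover have "(flat_exp q \<longlongrightarrow> 0) (at_left 0)"
    by (rule Lim_transform_eventually[OF tendsto_const])
      (auto simp: flat_exp_def eventually_at_left_field intro: exI[of _ "-1"])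
  ultimately show ?thesis by (simp add: filterlim_split_at)
qed

lemma flat_exp_deriv:
  "(flat_exp q has_field_derivative flat_exp ([:0, 0, 1:] * (q - pderiv q)) x) (at x)"
proof -
  consider "x > 0" | "x < 0" | "x = 0" by linarith
  then show ?thesis
  proof cases
    case 1
    have "((\<lambda>x. poly q (1/x) * exp (- 1/x)) has_field_derivative
      flat_exp ([:0, 0, 1:] * (q - pderiv q)) x) (at x)"
      using 1 unfolding flat_exp_def
      by (auto intro!: derivative_eq_intros DERIV_chain2[OF poly_DERIV] simp: field_simps power2_eq_square)
    then show ?thesis
      by (rule has_field_derivative_transform_within_open[where S="{0<..}"]) (use 1 in \<open>auto simp: flat_exp_def\<close>)
  next
    case 2
    have "((\<lambda>x. 0) has_field_derivative flat_exp ([:0, 0, 1:] * (q - pderiv q)) x) (at x)"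
      using 2 by (simp add: flat_exp_def)
    then show ?thesis
      by (rule has_field_derivative_transform_within_open[where S="{..<0}"]) (use 2 in \<open>auto simp: flat_exp_def\<close>)
  next
    case 3
    have "(\<lambda>h. (flat_exp q (0 + h) - flat_exp q 0) / h) = flat_exp ([:0, 1:] * q)"
      by (auto simp: flat_exp_def field_simps)
    then show ?thesis
      using 3 flat_exp_tendsto_0[of "[:0, 1:] * q"] unfolding has_field_derivative_def
      by (simp add: DERIV_def[unfolded has_field_derivative_def] flat_exp_def[of _ 0])
  qed
qed

lemma k_differentiable_flat_exp: "k_differentiable k (flat_exp q)"
proof (induction k arbitrary: q)
  case (Suc k)
  have "deriv (flat_exp q) = flat_exp ([:0, 0, 1:] * (q - pderiv q))"
    by (intro ext DERIV_imp_deriv flat_exp_deriv)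
  then show ?case using Suc flat_exp_deriv by (auto simp: field_differentiable_def)
qed simp

text \<open>The step is the normalized primitive of the bump \<open>exp (- 1/x) exp (- 1/(1 - x))\<close> supported in the unit interval.\<close>
lemma smooth_step_exists:
  obtains P :: "real \<Rightarrow> real" where "\<And>k. k_differentiable k P" "\<And>x. x \<le> 0 \<Longrightarrow> P x = 0" "\<And>x. x \<ge> 1 \<Longrightarrow> P x = 1"
proof -
  define \<rho> where "\<rho> x = flat_exp 1 x * flat_exp 1 (1 + (-1) * x)" for x
  have \<rho>s: "k_differentiable k \<rho>" for k
    unfolding \<rho>_def by (intro k_differentiable_mult k_differentiable_affine k_differentiable_flat_exp)
  have "\<rho> differentiable (at x)" for x
    using \<rho>s[of "Suc 0"] by (auto intro: field_differentiable_imp_differentiable)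
  then have cont: "continuous_on A \<rho>" for A
    by (meson differentiable_at_imp_differentiable_on differentiable_imp_continuous_on)
  have \<rho>0: "\<rho> x = 0" if "x \<le> 0 \<or> x \<ge> 1" for x using that by (auto simp: \<rho>_def flat_exp_def)
  have \<rho>pos: "\<rho> x > 0" if "0 < x" "x < 1" for x using that by (auto simp: \<rho>_def flat_exp_def)
  have \<rho>nn: "\<rho> x \<ge> 0" for x using \<rho>0[of x] \<rho>pos[of x] by linarith
  define F where "F x = integral {-1..x} \<rho>" for x
  have F0: "F x = 0" if "x \<le> 0" for x
  proof -
    have "integral {-1..x} \<rho> = integral {-1..x} (\<lambda>x. 0)"
      using that by (intro integral_cong \<rho>0) auto
    then show ?thesis by (simp add: F_def)
  qed
  have F1: "F x = F 1" if "x \<ge> 1" for x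
  proof -
    have "integral {1..x} \<rho> = integral {1..x} (\<lambda>x. 0)"
      by (intro integral_cong \<rho>0) auto
    moreover have "integral {-1..1} \<rho> + integral {1..x} \<rho> = integral {-1..x} \<rho>"
      using that cont by (intro Henstock_Kurzweil_Integration.integral_combine integrable_continuous_real) auto
    ultimately show ?thesis by (simp add: F_def)
  qed
  have Fd: "(F has_field_derivative \<rho> x) (at x)" for x
  proof (cases "x < 0")
    case True
    have "((\<lambda>x. 0) has_field_derivative \<rho> x) (at x)" using True by (simp add: \<rho>0)
    then show ?thesis
      by (rule has_field_derivative_transform_within_open[where S="{..<0}"]) (use True in \<open>auto simp: F0\<close>)
  next
    case False
    have "((\<lambda>u. integral {-1..u} \<rho>) has_real_derivative \<rho> x) (at x within {-1..x+1})"
      using False cont by (intro integral_has_real_derivative) auto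
    then show ?thesis
      unfolding F_def using False at_within_interior[of x "{-1..x+1}"] by simp
  qed
  have "F 1 > 0"
  proof -
    have "F 1 \<ge> 0" unfolding F_def using \<rho>nn cont
      by (intro integral_nonneg integrable_continuous_real) auto
    moreover have "F 1 \<noteq> 0"
    proof
      assume "F 1 = 0"
      then have "\<forall>x\<in>cbox (-1) 1. \<rho> x = 0"
        unfolding F_def using \<rho>nn cont
        by (subst (asm) integral_eq_0_iff) (auto simp: box_real intro!: \<rho>nn)
      then have "\<rho> (1/2) = 0" by (auto simp: box_real)
      with \<rho>pos[of "1/2"] show False by simp
    qed
    ultimately show ?thesis by simp
  qed
  have "k_differentiable (Suc k) F" for k
  proof -
    have "deriv F = \<rho>" by (intro ext DERIV_imp_deriv Fd)
    then show ?thesis using Fd \<rho>s by (auto simp: field_differentiable_def)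
  qed
  then have "k_differentiable k F" for k by (rule k_differentiable_Suc_imp)
  then have "k_differentiable k (\<lambda>x. (1 / F 1) * F x)" for k by (intro k_differentiable_mult k_differentiable_const)
  then show thesis
  proof (rule that)
    show "1 / F 1 * F x = 1" if "x \<ge> 1" for x
      unfolding F1[OF that] using \<open>F 1 > 0\<close> by simp
  qed (simp add: F0)
qed

subsection \<open>Tensor products\<close>

text \<open>A product of functions of the single coordinates. A partial derivative only changes one factor, so smoothness and the
symmetry of mixed second derivatives can be read off from the factors.\<close>
definition tensor :: "('d::finite \<Rightarrow> real \<Rightarrow> real) \<Rightarrow> real^'d \<Rightarrow> complex"
  where "tensor b x = complex_of_real (\<Prod>i\<in>UNIV. b i (x $ i))"

lemma tensor_has_derivative:
  fixes b :: "'d::finite \<Rightarrow> real \<Rightarrow> real"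
  assumes "\<And>i x. b i field_differentiable (at x)"
  shows "tensor b differentiable (at x)" "partial_deriv j (tensor b) x = tensor (b(j := deriv (b j))) x"
proof -
  have 1: "((\<lambda>x::real^'d. b i (x $ i)) has_derivative (\<lambda>h. deriv (b i) (x $ i) * h $ i)) (at x)" for i
  proof -
    have B: "(b i has_derivative (\<lambda>h. deriv (b i) (x $ i) * h)) (at (x $ i))"
      using assms field_differentiable_derivI has_field_derivative_def by blast
    have "((\<lambda>x::real^'d. x $ i) has_derivative (\<lambda>h. h $ i)) (at x)"
      by (rule bounded_linear_imp_has_derivative[OF bounded_linear_vec_nth])
    from has_derivative_compose[OF this B] show ?thesis .
  qed
  have D: "(tensor b has_derivative
    (\<lambda>h. complex_of_real (\<Sum>i\<in>UNIV. (deriv (b i) (x $ i) * h $ i) * (\<Prod>k\<in>UNIV - {i}. b k (x $ k))))) (at x)"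
    unfolding tensor_def
    by (intro bounded_linear.has_derivative[OF bounded_linear_of_real] has_derivative_prod 1)
  then show "tensor b differentiable (at x)" by (auto simp: differentiable_def)
  have "partial_deriv j (tensor b) x
    = complex_of_real (\<Sum>i\<in>UNIV. (deriv (b i) (x $ i) * (axis j 1 :: real^'d) $ i) * (\<Prod>k\<in>UNIV - {i}. b k (x $ k)))"
    by (rule partial_deriv_eq[OF D])
  also have "(\<Sum>i\<in>UNIV. (deriv (b i) (x $ i) * (axis j 1 :: real^'d) $ i) * (\<Prod>k\<in>UNIV - {i}. b k (x $ k)))
      = (\<Sum>i\<in>UNIV. if i = j then deriv (b j) (x $ j) * (\<Prod>k\<in>UNIV - {j}. b k (x $ k)) else 0)"
    by (intro sum.cong) (auto simp: axis_def)
  also have "\<dots> = (\<Prod>k\<in>UNIV. (b(j := deriv (b j))) k (x $ k))"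
    by (subst prod.remove[of UNIV j]) auto
  finally show "partial_deriv j (tensor b) x = tensor (b(j := deriv (b j))) x"
    by (simp only: tensor_def[of "b(j := deriv (b j))"])
qed

lemma C_k_tensor:
  fixes b :: "'d::finite \<Rightarrow> real \<Rightarrow> real"
  assumes "\<And>i k. k_differentiable k (b i)" shows "C_k k (tensor b)"
  using assms
proof (induction k arbitrary: b)
  case 0
  then have "\<And>i x. b i field_differentiable (at x)" using k_differentiable.simps(2) by blast
  then show ?case
    using tensor_has_derivative(1) by (auto intro!: differentiable_imp_continuous_on differentiable_at_imp_differentiable_on)
next
  case (Suc k)
  then have *: "\<And>i x. b i field_differentiable (at x)" using k_differentiable.simps(2) by blast
  have "k_differentiable k' ((b(j := deriv (b j))) i)" for i j k'
    using Suc.prems[of "Suc k'" j] Suc.prems[of k' i] by auto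
  then have "C_k k (tensor (b(j := deriv (b j))))" for j by (intro Suc.IH) blast
  moreover have "partial_deriv j (tensor b) = tensor (b(j := deriv (b j)))" for j
    using tensor_has_derivative(2)[of b, OF *] by blast
  ultimately show ?case
    using tensor_has_derivative(1)[of b, OF *] by (auto intro!: differentiable_at_imp_differentiable_on)
qed

lemma partial_deriv_tensor_commute:
  fixes b :: "'d::finite \<Rightarrow> real \<Rightarrow> real"
  assumes D: "\<And>i k. k_differentiable k (b i)" and "i \<noteq> j"
  shows "partial_deriv i (partial_deriv j (tensor b)) = partial_deriv j (partial_deriv i (tensor b))"
proof -
  have *: "\<And>i x. b i field_differentiable (at x)" using D k_differentiable.simps(2) by blast
  have "k_differentiable k' ((b(j := deriv (b j))) i)" for i j k'
    using D[of "Suc k'" j] D[of k' i] by auto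
  then have **: "\<And>i j x. (b(j := deriv (b j))) i field_differentiable (at x)" using k_differentiable.simps(2) by blast
  have 1: "partial_deriv j (tensor b) = tensor (b(j := deriv (b j)))" for j
    using tensor_has_derivative(2)[of b, OF *] by blast
  have 2: "partial_deriv i (tensor (b(j := deriv (b j)))) = tensor ((b(j := deriv (b j)))(i := deriv (b i)))"
    if "i \<noteq> j" for i j
    using tensor_has_derivative(2)[of "b(j := deriv (b j))" i, OF **] that by (auto simp: fun_upd_def)
  show ?thesis
    using assms(2) by (simp only: 1 2 2[OF assms(2)[symmetric]] fun_upd_twist[OF assms(2)] not_False_eq_True)
qed

subsection \<open>Line integrals and affine changes of variables\<close>

definition line_int :: "'d \<Rightarrow> real \<Rightarrow> real \<Rightarrow> (real^'d::finite \<Rightarrow> complex) \<Rightarrow> real^'d \<Rightarrow> complex"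
  where "line_int i s t \<phi> y = integral {s..t} (\<lambda>u. \<phi> (y + u *\<^sub>R axis i 1))"

lemma line_continuous:
  assumes "smooth \<phi>"
  shows "continuous_on A (\<lambda>u. \<phi> (y + u *\<^sub>R axis i 1))"
  by (rule continuous_on_compose2[OF smooth_continuous[OF assms, of UNIV]]) (auto intro!: continuous_intros)

lemma line_int_has_derivative:
  fixes \<phi> :: "real^'d::finite \<Rightarrow> complex"
  assumes "smooth \<phi>"
  shows "line_int i s t \<phi> differentiable (at x)"
    "partial_deriv j (line_int i s t \<phi>) x = line_int i s t (partial_deriv j \<phi>) x"
proof -
  define B :: "real^'d \<Rightarrow> real \<Rightarrow> ((real^'d) \<Rightarrow>\<^sub>L complex)" where
    "B y u = (\<Sum>k\<in>UNIV. blinfun_scaleR_left (partial_deriv k \<phi> (y + u *\<^sub>R axis i 1)) o\<^sub>L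
        blinfun_inner_right (axis k 1))" for y u
  have Bapp: "blinfun_apply (B y u) h = (\<Sum>k\<in>UNIV. (h $ k) *\<^sub>R partial_deriv k \<phi> (y + u *\<^sub>R axis i 1))" for y u h
    by (simp add: B_def blinfun.sum_left inner_axis inner_commute)
  have cont: "continuous_on (UNIV \<times> cbox s t) (\<lambda>(y, u). B y u)"
  proof -
    have c: "continuous_on (UNIV \<times> cbox s t) (\<lambda>p. partial_deriv k \<phi> (fst p + snd p *\<^sub>R axis i 1))" for k
      by (rule continuous_on_compose2[OF smooth_continuous[OF smooth_partial_deriv[OF assms], of UNIV]])
        (auto intro!: continuous_intros)
    have "continuous_on (UNIV \<times> cbox s t) (\<lambda>p. B (fst p) (snd p))"
      unfolding B_def
      by (intro continuous_on_sum bounded_bilinear.continuous_on[OF bounded_bilinear_blinfun_compose]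
          continuous_on_const linear_continuous_on_compose[OF c]
          bounded_linear.linear[OF bounded_linear_blinfun_scaleR_left])
    then show ?thesis by (simp add: case_prod_beta)
  qed
  have "((\<lambda>y. integral (cbox s t) (\<lambda>u. \<phi> (y + u *\<^sub>R axis i 1))) has_derivative
     blinfun_apply (integral (cbox s t) (B x))) (at x within UNIV)"
  proof (rule leibniz_rule[OF _ _ cont])
    fix y :: "real^'d" and u
    have "(\<phi> has_derivative blinfun_apply (B y u)) (at (y + u *\<^sub>R axis i 1))"
      using has_derivative_partials[OF smooth_differentiable[OF assms], of "y + u *\<^sub>R axis i 1"]
      by (simp add: Bapp[abs_def])
    moreover have "((\<lambda>y. y + u *\<^sub>R axis i 1) has_derivative (\<lambda>h. h)) (at y)"
      by (auto intro!: derivative_eq_intros)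
    ultimately show "((\<lambda>y. \<phi> (y + u *\<^sub>R axis i 1)) has_derivative blinfun_apply (B y u)) (at y within UNIV)"
      using has_derivative_compose by fastforce
  qed (auto intro!: integrable_continuous_real line_continuous[OF assms])
  then have D: "(line_int i s t \<phi> has_derivative blinfun_apply (integral (cbox s t) (B x))) (at x)"
    by (simp add: line_int_def[abs_def])
  then show "line_int i s t \<phi> differentiable (at x)" by (auto simp: differentiable_def)
  have "B x integrable_on cbox s t"
  proof (rule integrable_continuous)
    have "continuous_on (cbox s t) (\<lambda>u. (x, u))" by (intro continuous_intros)
    from continuous_on_compose2[OF cont this] show "continuous_on (cbox s t) (B x)" by auto
  qed
  then have "blinfun_apply (integral (cbox s t) (B x)) h = integral (cbox s t) (\<lambda>u. blinfun_apply (B x u) h)" for h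
    using blinfun_apply_integral by metis
  then have "blinfun_apply (integral (cbox s t) (B x)) (axis j 1)
    = integral (cbox s t) (\<lambda>u. partial_deriv j \<phi> (x + u *\<^sub>R axis i 1))"
    by (simp add: Bapp axis_def if_distrib[where f="\<lambda>r. r *\<^sub>R _"] cong: if_cong)
  then show "partial_deriv j (line_int i s t \<phi>) x = line_int i s t (partial_deriv j \<phi>) x"
    unfolding partial_deriv_eq[OF D] by (simp add: line_int_def)
qed

text \<open>Differentiation under the integral sign commutes partial derivatives with integration along a segment, so smoothness
follows by induction on the order.\<close>
lemma smooth_line_int:
  assumes "smooth \<phi>" shows "smooth (line_int i s t \<phi>)"
proof -
  have "C_k k (line_int i s t \<phi>)" for k
    using assms
  proof (induction k arbitrary: \<phi>)
    case 0
    then show ?case using line_int_has_derivative(1)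
      by (auto intro!: differentiable_imp_continuous_on differentiable_at_imp_differentiable_on)
  next
    case (Suc k)
    have "partial_deriv j (line_int i s t \<phi>) = line_int i s t (partial_deriv j \<phi>)" for j
      using line_int_has_derivative(2)[OF Suc.prems] by blast
    then show ?case using Suc line_int_has_derivative(1)
      by (auto intro!: differentiable_at_imp_differentiable_on smooth_partial_deriv)
  qed
  then show ?thesis by (simp add: smooth_def)
qed

lemma line_int_partial_deriv:
  assumes "smooth \<phi>" "s \<le> t"
  shows "line_int i s t (partial_deriv i \<phi>) y = \<phi> (y + t *\<^sub>R axis i 1) - \<phi> (y + s *\<^sub>R axis i 1)"
  unfolding line_int_def
  by (intro integral_unique fundamental_theorem_of_calculus assms smooth_has_vector_derivative)

lemma smooth_affine:
  fixes \<phi> :: "real^'d::finite \<Rightarrow> complex"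
  assumes "smooth \<phi>"
  shows "smooth (\<lambda>y. \<phi> (a + c *\<^sub>R y))"
    and "partial_deriv i (\<lambda>y. \<phi> (a + c *\<^sub>R y)) x = of_real c * partial_deriv i \<phi> (a + c *\<^sub>R x)"
proof -
  have D: "((\<lambda>y. \<phi> (a + c *\<^sub>R y)) has_derivative (\<lambda>h. frechet_derivative \<phi> (at (a + c *\<^sub>R x)) (c *\<^sub>R h))) (at x)"
    if "smooth \<phi>" for \<phi> :: "real^'d \<Rightarrow> complex" and x
  proof -
    have 1: "((\<lambda>y. a + c *\<^sub>R y) has_derivative (\<lambda>h. c *\<^sub>R h)) (at x)" by (auto intro!: derivative_eq_intros)
    have 2: "(\<phi> has_derivative frechet_derivative \<phi> (at (a + c *\<^sub>R x))) (at (a + c *\<^sub>R x))"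
      using that smooth_differentiable frechet_derivative_works by blast
    from has_derivative_compose[OF 1 2] show ?thesis .
  qed
  have P: "partial_deriv i (\<lambda>y. \<phi> (a + c *\<^sub>R y)) x = of_real c * partial_deriv i \<phi> (a + c *\<^sub>R x)"
    if "smooth \<phi>" for \<phi> :: "real^'d \<Rightarrow> complex" and x i
  proof -
    have "linear (frechet_derivative \<phi> (at (a + c *\<^sub>R x)))"
      using that by (simp add: linear_frechet_derivative smooth_differentiable)
    then show ?thesis
      unfolding partial_deriv_eq[OF D[OF that]]
      by (simp add: partial_deriv_def linear_cmul scaleR_conv_of_real[where 'a=complex, symmetric])
  qed
  then show "partial_deriv i (\<lambda>y. \<phi> (a + c *\<^sub>R y)) x = of_real c * partial_deriv i \<phi> (a + c *\<^sub>R x)"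
    using assms by blast
  have "C_k k (\<lambda>y. \<phi> (a + c *\<^sub>R y))" for k
    using assms
  proof (induction k arbitrary: \<phi>)
    case 0
    show ?case using D[OF 0]
      by (auto intro!: has_derivative_continuous continuous_at_imp_continuous_on)
  next
    case (Suc k)
    have "partial_deriv j (\<lambda>y. \<phi> (a + c *\<^sub>R y)) = (\<lambda>y. of_real c * partial_deriv j \<phi> (a + c *\<^sub>R y))" for j
      using P[OF Suc.prems] by blast
    moreover have "(\<lambda>y. \<phi> (a + c *\<^sub>R y)) differentiable_on UNIV"
      using D[OF Suc.prems] by (intro differentiable_at_imp_differentiable_on) (auto simp: differentiable_def)
    ultimately show ?case using Suc by (auto intro!: smooth_partial_deriv C_k_mult C_k_const)
  qed
  then show "smooth (\<lambda>y. \<phi> (a + c *\<^sub>R y))" by (simp add: smooth_def)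
qed

section \<open>Averaging along lines and its adjoint\<close>

text \<open>Cauchy--Schwarz against the constant function, from \<open>g \<le> l/2 + g\<^sup>2/(2 l)\<close> with the optimal \<open>l\<close>.\<close>
lemma nn_integral_square_le:
  assumes [measurable]: "g \<in> borel_measurable M" and g: "\<And>x. g x \<ge> 0"
    and m: "emeasure M (space M) = ennreal m" "m > 0"
  shows "(\<integral>\<^sup>+x. ennreal (g x) \<partial>M)\<^sup>2 \<le> ennreal m * (\<integral>\<^sup>+x. ennreal ((g x)\<^sup>2) \<partial>M)"
proof -
  consider "(\<integral>\<^sup>+x. ennreal ((g x)\<^sup>2) \<partial>M) = top" | "(\<integral>\<^sup>+x. ennreal ((g x)\<^sup>2) \<partial>M) = 0"
    | G where "G > 0" "(\<integral>\<^sup>+x. ennreal ((g x)\<^sup>2) \<partial>M) = ennreal G"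
    by (metis ennreal_cases ennreal_0 order_le_less)
  then show ?thesis
  proof cases
    case 1
    then show ?thesis using m by (simp add: ennreal_mult_top)
  next
    case 2
    then have "AE x in M. ennreal ((g x)\<^sup>2) = 0" by (subst (asm) nn_integral_0_iff_AE) auto
    then have "AE x in M. ennreal (g x) = 0"
      by eventually_elim (simp add: ennreal_eq_0_iff power2_eq_square mult_le_0_iff g)
    then have "(\<integral>\<^sup>+x. ennreal (g x) \<partial>M) = 0" by (subst nn_integral_0_iff_AE) auto
    then show ?thesis by simp
  next
    case 3
    \<comment> \<open>the minimizer of \<open>l m / 2 + G / (2 l)\<close>\<close>
    define l where "l = sqrt (G / m)"
    have l: "l > 0" using 3 m by (simp add: l_def)
    have "(\<integral>\<^sup>+x. ennreal (g x) \<partial>M) \<le> (\<integral>\<^sup>+x. ennreal (l/2) + ennreal (1/(2*l)) * ennreal ((g x)\<^sup>2) \<partial>M)"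
    proof (rule nn_integral_mono)
      fix x
      have "0 \<le> (g x - l)\<^sup>2" by simp
      then have "g x \<le> l/2 + (1/(2*l)) * (g x)\<^sup>2"
        using l by (simp add: field_simps power2_eq_square)
      then have "ennreal (g x) \<le> ennreal (l/2 + (1/(2*l)) * (g x)\<^sup>2)" by (rule ennreal_leI)
      then show "ennreal (g x) \<le> ennreal (l/2) + ennreal (1/(2*l)) * ennreal ((g x)\<^sup>2)"
        using l by (simp add: ennreal_mult[symmetric])
    qed
    also have "\<dots> = ennreal (l/2) * ennreal m + ennreal (1/(2*l)) * ennreal G"
      using 3 m by (simp add: nn_integral_add nn_integral_cmult)
    also have "\<dots> = ennreal (l/2 * m + 1/(2*l) * G)"
      using l m 3 by (simp add: ennreal_mult[symmetric])
    finally have "(\<integral>\<^sup>+x. ennreal (g x) \<partial>M)\<^sup>2 \<le> (ennreal (l/2 * m + 1/(2*l) * G))\<^sup>2"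
      by (rule power_mono) simp
    also have "\<dots> = ennreal ((l/2 * m + 1/(2*l) * G)\<^sup>2)"
      using l m 3 by (subst ennreal_power) auto
    also have "l/2 * m + 1/(2*l) * G = l * m"
    proof -
      have "l\<^sup>2 = G / m" using 3 m by (simp add: l_def)
      then have "G = l\<^sup>2 * m" using m by simp
      then show ?thesis using l by (simp add: power2_eq_square)
    qed
    also have "(l * m)\<^sup>2 = m * G"
      using 3 m by (simp add: l_def power_mult_distrib) (simp add: power2_eq_square)
    finally show ?thesis using 3 m by (simp add: ennreal_mult[symmetric])
  qed
qed

lemma mult_le_sum_squares: "a * b \<le> a\<^sup>2 + (b::real)\<^sup>2"
proof -
  have "0 \<le> (a - b/2)\<^sup>2 + 3/4 * b\<^sup>2" by simp
  then show ?thesis by (simp add: power2_eq_square algebra_simps)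
qed

lemma norm_diff_square_le:
  fixes a b :: "'a::real_normed_vector"
  shows "ennreal ((norm (a - b))\<^sup>2) \<le> ennreal 2 * (ennreal ((norm a)\<^sup>2) + ennreal ((norm b)\<^sup>2))"
proof -
  have "(norm (a - b))\<^sup>2 \<le> (norm a + norm b)\<^sup>2"
    by (intro power_mono norm_triangle_ineq4) simp
  also have "\<dots> \<le> 2 * ((norm a)\<^sup>2 + (norm b)\<^sup>2)"
    using sum_squares_bound[of "norm a" "norm b"] by (simp add: power2_sum)
  finally have "ennreal ((norm (a - b))\<^sup>2) \<le> ennreal (2 * ((norm a)\<^sup>2 + (norm b)\<^sup>2))"
    by (rule ennreal_leI)
  then show ?thesis by (simp add: ennreal_mult)
qed

text \<open>Averaging along the line through \<open>x\<close> in direction \<open>i\<close> with a kernel. The window \<open>[-5, 5]\<close> is long enough for a segment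
that starts in the cube \<open>[-2, 2]\<^sup>d\<close> to leave it at both ends. Writing the integral over displacements, and not over the
coordinate itself, allows translation invariance to replace a splitting of the space into coordinates.\<close>
definition line_op :: "'d \<Rightarrow> (real^'d::finite \<Rightarrow> real \<Rightarrow> real) \<Rightarrow> (real^'d \<Rightarrow> complex) \<Rightarrow> real^'d \<Rightarrow> complex"
  where "line_op i \<kappa> f x = (LINT u|lborel. indicator {-5..5} u *\<^sub>R (of_real (\<kappa> x u) * f (x + u *\<^sub>R axis i 1)))"

definition square_integrable :: "(real^'d::finite \<Rightarrow> complex) \<Rightarrow> bool"
  where "square_integrable f \<longleftrightarrow> f \<in> borel_measurable borel \<and> (\<integral>\<^sup>+x. ennreal ((norm (f x))\<^sup>2) \<partial>lborel) < \<infinity>"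

definition bounded_kernel :: "real \<Rightarrow> (real^'d::finite \<Rightarrow> real \<Rightarrow> real) \<Rightarrow> bool"
  where "bounded_kernel c \<kappa> \<longleftrightarrow> c \<ge> 0 \<and> (\<lambda>p. \<kappa> (fst p) (snd p)) \<in> borel_measurable borel \<and> (\<forall>x u. \<bar>\<kappa> x u\<bar> \<le> c)"

lemma nn_integral_translate:
  fixes f :: "real^'d::finite \<Rightarrow> ennreal"
  assumes [measurable]: "f \<in> borel_measurable borel"
  shows "(\<integral>\<^sup>+x. f (x + a) \<partial>lborel) = (\<integral>\<^sup>+x. f x \<partial>lborel)"
proof -
  have "(\<integral>\<^sup>+x. f x \<partial>lborel) = (\<integral>\<^sup>+x. f x \<partial>distr lborel borel ((+) a))" by (simp add: lborel_distr_plus)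
  also have "\<dots> = (\<integral>\<^sup>+x. f (a + x) \<partial>lborel)" by (subst nn_integral_distr) auto
  finally show ?thesis by (simp add: add.commute)
qed

lemma integral_translate:
  fixes f :: "real^'d::finite \<Rightarrow> complex"
  assumes [measurable]: "f \<in> borel_measurable borel"
  shows "(LINT x|lborel. f (x + a)) = (LINT x|lborel. f x)"
proof -
  have "(LINT x|lborel. f x) = (LINT x|distr lborel borel ((+) a). f x)" by (simp add: lborel_distr_plus)
  also have "\<dots> = (LINT x|lborel. f (a + x))" by (subst integral_distr) auto
  finally show ?thesis by (simp add: add.commute)
qed

lemma bounded_kernel_measurable:
  assumes "bounded_kernel c \<kappa>"
    and f: "f \<in> N \<rightarrow>\<^sub>M borel" and g: "g \<in> N \<rightarrow>\<^sub>M borel"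
  shows "(\<lambda>p. \<kappa> (f p) (g p)) \<in> borel_measurable N"
proof -
  have "(\<lambda>p. (f p, g p)) \<in> N \<rightarrow>\<^sub>M borel \<Otimes>\<^sub>M borel" using f g by measurable
  then have "(\<lambda>p. (f p, g p)) \<in> N \<rightarrow>\<^sub>M borel" by (simp add: borel_prod)
  from measurable_compose[OF this, of "\<lambda>p. \<kappa> (fst p) (snd p)" borel] assms(1) show ?thesis
    by (simp add: bounded_kernel_def)
qed

lemma line_op_measurable:
  assumes f [measurable]: "f \<in> borel_measurable borel" and k: "bounded_kernel c \<kappa>"
  shows "line_op i \<kappa> f \<in> borel_measurable borel"
proof -
  note [measurable] = bounded_kernel_measurable[OF k]
  have "(\<lambda>x. LINT u|lborel. indicator {-5..5} u *\<^sub>R (of_real (\<kappa> x u) * f (x + u *\<^sub>R axis i 1))) \<in> borel_measurable lborel"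
    by (rule lborel.borel_measurable_lebesgue_integral) (simp add: case_prod_beta, measurable)
  then show ?thesis by (simp add: line_op_def[abs_def])
qed

text \<open>Cauchy--Schwarz in the displacement, and translation invariance for every fixed displacement.\<close>
lemma line_op_bound:
  assumes f [measurable]: "f \<in> borel_measurable borel" and k: "bounded_kernel c \<kappa>"
  shows "(\<integral>\<^sup>+x. ennreal ((norm (line_op i \<kappa> f x))\<^sup>2) \<partial>lborel)
    \<le> ennreal (100 * c\<^sup>2) * (\<integral>\<^sup>+x. ennreal ((norm (f x))\<^sup>2) \<partial>lborel)"
proof -
  note [measurable] = bounded_kernel_measurable[OF k]
  have c: "c \<ge> 0" "\<And>x u. \<bar>\<kappa> x u\<bar> \<le> c" using k by (auto simp: bounded_kernel_def)
  let ?I = "restrict_space lborel {-5..5::real}"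
  have 1: "ennreal ((norm (line_op i \<kappa> f x))\<^sup>2)
    \<le> ennreal (10 * c\<^sup>2) * (\<integral>\<^sup>+u. indicator {-5..5} u * ennreal ((norm (f (x + u *\<^sub>R axis i 1)))\<^sup>2) \<partial>lborel)" for x
  proof -
    have a: "ennreal (norm (line_op i \<kappa> f x))
        \<le> (\<integral>\<^sup>+u. ennreal (norm (indicator {-5..5} u *\<^sub>R (of_real (\<kappa> x u) * f (x + u *\<^sub>R axis i 1)))) \<partial>lborel)"
      unfolding line_op_def
      by (cases "integrable lborel (\<lambda>u. indicator {-5..5} u *\<^sub>R (of_real (\<kappa> x u) * f (x + u *\<^sub>R axis i 1)))")
        (simp_all only: integral_norm_bound_ennreal not_integrable_integral_eq norm_zero ennreal_0 zero_le not_False_eq_True)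
    also have "\<dots> \<le> (\<integral>\<^sup>+u. ennreal c * (ennreal (norm (f (x + u *\<^sub>R axis i 1))) * indicator {-5..5} u) \<partial>lborel)"
      using c by (intro nn_integral_mono)
        (auto simp: norm_mult ennreal_mult[symmetric] split: split_indicator intro!: ennreal_leI mult_right_mono)
    also have "\<dots> = ennreal c * (\<integral>\<^sup>+u. ennreal (norm (f (x + u *\<^sub>R axis i 1))) \<partial>?I)"
      by (subst nn_integral_cmult) (auto simp: nn_integral_restrict_space)
    finally have "(ennreal (norm (line_op i \<kappa> f x)))\<^sup>2
      \<le> (ennreal c * (\<integral>\<^sup>+u. ennreal (norm (f (x + u *\<^sub>R axis i 1))) \<partial>?I))\<^sup>2" by (rule power_mono) simp
    also have "\<dots> = ennreal (c\<^sup>2) * (\<integral>\<^sup>+u. ennreal (norm (f (x + u *\<^sub>R axis i 1))) \<partial>?I)\<^sup>2"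
      using c by (simp add: power_mult_distrib ennreal_power)
    also have "\<dots> \<le> ennreal (c\<^sup>2) * (ennreal 10 * (\<integral>\<^sup>+u. ennreal ((norm (f (x + u *\<^sub>R axis i 1)))\<^sup>2) \<partial>?I))"
      by (intro mult_left_mono nn_integral_square_le measurable_restrict_space1)
        (auto simp: emeasure_restrict_space)
    also have "\<dots> = ennreal (10 * c\<^sup>2) * (\<integral>\<^sup>+u. indicator {-5..5} u * ennreal ((norm (f (x + u *\<^sub>R axis i 1)))\<^sup>2) \<partial>lborel)"
      by (subst nn_integral_restrict_space) (auto simp: ennreal_mult mult_ac)
    finally show ?thesis by (simp add: ennreal_power)
  qed
  have "(\<integral>\<^sup>+x. ennreal ((norm (line_op i \<kappa> f x))\<^sup>2) \<partial>lborel) \<le>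
    (\<integral>\<^sup>+x. ennreal (10 * c\<^sup>2) * (\<integral>\<^sup>+u. indicator {-5..5} u * ennreal ((norm (f (x + u *\<^sub>R axis i 1)))\<^sup>2) \<partial>lborel) \<partial>lborel)"
    by (intro nn_integral_mono 1)
  also have "\<dots> = ennreal (10 * c\<^sup>2) * (\<integral>\<^sup>+x. (\<integral>\<^sup>+u. indicator {-5..5} u * ennreal ((norm (f (x + u *\<^sub>R axis i 1)))\<^sup>2) \<partial>lborel) \<partial>lborel)"
    by (rule nn_integral_cmult) measurable
  also have "(\<integral>\<^sup>+x. (\<integral>\<^sup>+u. indicator {-5..5} u * ennreal ((norm (f (x + u *\<^sub>R axis i 1)))\<^sup>2) \<partial>lborel) \<partial>lborel)
     = (\<integral>\<^sup>+u. (\<integral>\<^sup>+x. indicator {-5..5} u * ennreal ((norm (f (x + u *\<^sub>R axis i 1)))\<^sup>2) \<partial>lborel) \<partial>lborel)"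
    by (rule lborel_pair.Fubini') (simp add: case_prod_beta, measurable)
  also have "\<dots> = (\<integral>\<^sup>+u. indicator {-5..5::real} u * (\<integral>\<^sup>+x. ennreal ((norm (f x))\<^sup>2) \<partial>lborel) \<partial>lborel)"
    by (intro nn_integral_cong) (simp add: nn_integral_cmult nn_integral_translate[where f="\<lambda>x. ennreal ((norm (f x))\<^sup>2)"])
  also have "\<dots> = ennreal 10 * (\<integral>\<^sup>+x. ennreal ((norm (f x))\<^sup>2) \<partial>lborel)"
    by (simp add: nn_integral_multc)
  also have "ennreal (10 * c\<^sup>2) * (ennreal 10 * (\<integral>\<^sup>+x. ennreal ((norm (f x))\<^sup>2) \<partial>lborel))
      = (ennreal (10 * c\<^sup>2) * ennreal 10) * (\<integral>\<^sup>+x. ennreal ((norm (f x))\<^sup>2) \<partial>lborel)"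
    by (rule mult.assoc[symmetric])
  also have "ennreal (10 * c\<^sup>2) * ennreal 10 = ennreal (100 * c\<^sup>2)"
    by (subst ennreal_mult[symmetric]) auto
  finally show ?thesis .
qed

lemma square_integrable_line_op: "square_integrable f \<Longrightarrow> bounded_kernel c \<kappa> \<Longrightarrow> square_integrable (line_op i \<kappa> f)"
  unfolding square_integrable_def using line_op_bound[of f c \<kappa> i] line_op_measurable[of f c \<kappa> i]
  by (auto intro: le_less_trans simp: ennreal_mult_less_top)

lemma square_integrable_prod_integrable:
  assumes "square_integrable f" "square_integrable g" shows "integrable lborel (\<lambda>x. f x * g x)"
proof (rule integrableI_bounded)
  have [measurable]: "f \<in> borel_measurable borel" "g \<in> borel_measurable borel"
    using assms by (auto simp: square_integrable_def)
  show "(\<lambda>x. f x * g x) \<in> borel_measurable lborel" by simp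
  have "(\<integral>\<^sup>+x. ennreal (norm (f x * g x)) \<partial>lborel)
    \<le> (\<integral>\<^sup>+x. ennreal ((norm (f x))\<^sup>2) + ennreal ((norm (g x))\<^sup>2) \<partial>lborel)"
  proof (rule nn_integral_mono)
    fix x
    have "norm (f x * g x) \<le> (norm (f x))\<^sup>2 + (norm (g x))\<^sup>2"
      by (simp add: norm_mult mult_le_sum_squares)
    then show "ennreal (norm (f x * g x)) \<le> ennreal ((norm (f x))\<^sup>2) + ennreal ((norm (g x))\<^sup>2)"
      by (simp add: ennreal_plus[symmetric] del: ennreal_plus) 
  qed
  also have "\<dots> < \<infinity>" using assms by (simp add: nn_integral_add square_integrable_def)
  finally show "(\<integral>\<^sup>+x. ennreal (norm (f x * g x)) \<partial>lborel) < \<infinity>" .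
qed

text \<open>Fubini's theorem and, for every fixed displacement \<open>u\<close>, the translation \<open>x \<mapsto> x - u e\<^sub>i\<close>.\<close>
lemma line_op_adjoint:
  assumes f: "square_integrable f" and b: "square_integrable b" and k: "bounded_kernel c \<kappa>"
  shows "(LINT x|lborel. line_op i \<kappa> f x * b x) =
    (LINT y|lborel. f y * (LINT u|lborel. indicator {-5..5} u *\<^sub>R
       (of_real (\<kappa> (y - u *\<^sub>R axis i 1) u) * b (y - u *\<^sub>R axis i 1))))"
proof -
  note [measurable] = bounded_kernel_measurable[OF k]
  have c: "c \<ge> 0" "\<And>x u. \<bar>\<kappa> x u\<bar> \<le> c" using k by (auto simp: bounded_kernel_def)
  have [measurable]: "f \<in> borel_measurable borel" "b \<in> borel_measurable borel"
    using assms by (auto simp: square_integrable_def)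
  define F where "F x u = indicator {-5..5} u *\<^sub>R (of_real (\<kappa> x u) * f (x + u *\<^sub>R axis i 1)) * b x" for x u
  define G where "G y u = indicator {-5..5} u *\<^sub>R (of_real (\<kappa> (y - u *\<^sub>R axis i 1) u) * b (y - u *\<^sub>R axis i 1)) * f y" for y u
  have Fm [measurable]: "(\<lambda>p. F (fst p) (snd p)) \<in> borel_measurable (lborel \<Otimes>\<^sub>M lborel)"
    unfolding F_def by measurable
  have Gm [measurable]: "(\<lambda>p. G (fst p) (snd p)) \<in> borel_measurable (lborel \<Otimes>\<^sub>M lborel)"
    unfolding G_def by measurable
  have FG: "F (x - u *\<^sub>R axis i 1) u = G x u" for x u by (simp add: F_def G_def)
  have Fm' [measurable]: "(\<lambda>x. F x u) \<in> borel_measurable borel" for u unfolding F_def by measurable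
  let ?N = "(\<integral>\<^sup>+x. ennreal ((norm (f x))\<^sup>2) \<partial>lborel) + (\<integral>\<^sup>+x. ennreal ((norm (b x))\<^sup>2) \<partial>lborel)"
  have nnF: "(\<integral>\<^sup>+x. ennreal (norm (F x u)) \<partial>lborel) \<le> indicator {-5..5} u * (ennreal c * ?N)" for u
  proof -
    have "(\<integral>\<^sup>+x. ennreal (norm (F x u)) \<partial>lborel)
      \<le> (\<integral>\<^sup>+x. indicator {-5..5} u * (ennreal c * (ennreal ((norm (f (x + u *\<^sub>R axis i 1)))\<^sup>2) + ennreal ((norm (b x))\<^sup>2))) \<partial>lborel)"
    proof (rule nn_integral_mono)
      fix x
      let ?a = "norm (f (x + u *\<^sub>R axis i 1))" and ?b = "norm (b x)"
      have "?a * ?b \<le> ?a\<^sup>2 + ?b\<^sup>2" by (rule mult_le_sum_squares)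
      then have "\<bar>\<kappa> x u\<bar> * (?a * ?b) \<le> c * (?a\<^sup>2 + ?b\<^sup>2)"
        using c by (intro mult_mono) auto
      then have "ennreal (norm (F x u)) \<le> ennreal (indicator {-5..5} u * (c * (?a\<^sup>2 + ?b\<^sup>2)))"
        by (intro ennreal_leI) (auto simp: F_def norm_mult mult.assoc split: split_indicator)
      then show "ennreal (norm (F x u)) \<le> indicator {-5..5} u * (ennreal c * (ennreal (?a\<^sup>2) + ennreal (?b\<^sup>2)))"
        using c by (auto simp: ennreal_mult split: split_indicator)
    qed
    also have "\<dots> = indicator {-5..5} u * (ennreal c * ?N)"
      by (simp add: nn_integral_cmult nn_integral_add nn_integral_translate[where f="\<lambda>x. ennreal ((norm (f x))\<^sup>2)"])
    finally show ?thesis .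
  qed
  have N: "ennreal 10 * (ennreal c * ?N) < \<infinity>"
    using f b by (auto simp: square_integrable_def ennreal_mult_less_top)
  have tot: "(\<integral>\<^sup>+u. (\<integral>\<^sup>+x. ennreal (norm (F x u)) \<partial>lborel) \<partial>lborel) < \<infinity>"
  proof -
    have "(\<integral>\<^sup>+u. (\<integral>\<^sup>+x. ennreal (norm (F x u)) \<partial>lborel) \<partial>lborel)
      \<le> (\<integral>\<^sup>+u. indicator {-5..5::real} u * (ennreal c * ?N) \<partial>lborel)"
      by (intro nn_integral_mono nnF)
    also have "\<dots> = ennreal 10 * (ennreal c * ?N)" by (simp add: nn_integral_multc)
    finally show ?thesis using N by (rule le_less_trans)
  qed
  have totG: "(\<integral>\<^sup>+u. (\<integral>\<^sup>+x. ennreal (norm (G x u)) \<partial>lborel) \<partial>lborel) < \<infinity>"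
  proof -
    have "(\<integral>\<^sup>+x. ennreal (norm (G x u)) \<partial>lborel) = (\<integral>\<^sup>+x. ennreal (norm (F x u)) \<partial>lborel)" for u
      using nn_integral_translate[where f="\<lambda>x. ennreal (norm (F x u))" and a="- u *\<^sub>R axis i 1"]
      by (simp add: FG)
    with tot show ?thesis by simp
  qed
  have Fint: "integrable (lborel \<Otimes>\<^sub>M lborel) (\<lambda>(x, u). F x u)"
  proof (rule integrableI_bounded)
    have "(\<integral>\<^sup>+p. ennreal (norm (case p of (x, u) \<Rightarrow> F x u)) \<partial>(lborel \<Otimes>\<^sub>M lborel))
       = (\<integral>\<^sup>+u. (\<integral>\<^sup>+x. ennreal (norm (F x u)) \<partial>lborel) \<partial>lborel)"
      by (subst lborel_pair.nn_integral_snd[symmetric]) (auto simp: case_prod_beta)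
    with tot show "(\<integral>\<^sup>+p. ennreal (norm (case p of (x, u) \<Rightarrow> F x u)) \<partial>(lborel \<Otimes>\<^sub>M lborel)) < \<infinity>" by simp
  qed (simp add: case_prod_beta)
  have Gint: "integrable (lborel \<Otimes>\<^sub>M lborel) (\<lambda>(x, u). G x u)"
  proof (rule integrableI_bounded)
    have "(\<integral>\<^sup>+p. ennreal (norm (case p of (x, u) \<Rightarrow> G x u)) \<partial>(lborel \<Otimes>\<^sub>M lborel))
       = (\<integral>\<^sup>+u. (\<integral>\<^sup>+x. ennreal (norm (G x u)) \<partial>lborel) \<partial>lborel)"
      by (subst lborel_pair.nn_integral_snd[symmetric]) (auto simp: case_prod_beta)
    with totG show "(\<integral>\<^sup>+p. ennreal (norm (case p of (x, u) \<Rightarrow> G x u)) \<partial>(lborel \<Otimes>\<^sub>M lborel)) < \<infinity>" by simp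
  qed (simp add: case_prod_beta)
  have "(LINT x|lborel. line_op i \<kappa> f x * b x) = (LINT x|lborel. (LINT u|lborel. F x u))"
    unfolding line_op_def F_def by (simp only: integral_mult_left_zero)
  also have "\<dots> = (LINT u|lborel. (LINT x|lborel. F x u))"
    using lborel_pair.Fubini_integral[OF Fint] by simp
  also have "\<dots> = (LINT u|lborel. (LINT x|lborel. G x u))"
  proof (rule Bochner_Integration.integral_cong[OF refl])
    fix u
    show "(LINT x|lborel. F x u) = (LINT x|lborel. G x u)"
      using integral_translate[where f="\<lambda>x. F x u" and a="- u *\<^sub>R axis i 1"] by (simp add: FG)
  qed
  also have "\<dots> = (LINT x|lborel. (LINT u|lborel. G x u))"
    using lborel_pair.Fubini_integral[OF Gint] by simp
  also have "\<dots> = (LINT y|lborel. f y * (LINT u|lborel. indicator {-5..5} u *\<^sub>R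
       (of_real (\<kappa> (y - u *\<^sub>R axis i 1) u) * b (y - u *\<^sub>R axis i 1))))"
    unfolding G_def integral_mult_left_zero by (rule Bochner_Integration.integral_cong) (rule refl, rule mult.commute)
  finally show ?thesis .
qed

section \<open>The antiderivative operator and the cutoff on the cube\<close>

definition cube :: "(real^'d::finite) set" where "cube = {y. \<forall>k. \<bar>y $ k\<bar> \<le> 2}"

text \<open>Test functions for the construction on the cube.\<close>
definition cube_supported :: "(real^'d::finite \<Rightarrow> complex) \<Rightarrow> bool"
  where "cube_supported b \<longleftrightarrow> smooth b \<and> (\<forall>y. y \<notin> cube \<longrightarrow> b y = 0)"

lemma cube_eq_cbox: "cube = cbox (\<chi> k. -2) ((\<chi> k. 2) :: real^'d::finite)"
  by (auto simp: cube_def mem_box_cart abs_le_iff minus_le_iff)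

lemma closed_cube: "closed cube" and compact_cube: "compact cube"
  by (simp_all add: cube_eq_cbox compact_cbox closed_cbox)

lemma cube_borel [measurable]: "cube \<in> sets borel"
  using closed_cube by (rule borel_closed)

lemma cube_supportedD: "cube_supported b \<Longrightarrow> \<bar>y $ k\<bar> > 2 \<Longrightarrow> b y = 0"
  by (auto simp: cube_supported_def cube_def not_le)

lemma cube_supported_smooth: "cube_supported b \<Longrightarrow> smooth b" by (simp add: cube_supported_def)

lemma cube_supported_partial: "cube_supported b \<Longrightarrow> cube_supported (partial_deriv i b)"
  unfolding cube_supported_def
  by (auto intro!: smooth_partial_deriv partial_deriv_local[of "- cube"] simp: closed_cube open_Compl)

lemma cube_supported_mult: "smooth \<phi> \<Longrightarrow> cube_supported b \<Longrightarrow> cube_supported (\<lambda>y. \<phi> y * b y)"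
  by (auto simp: cube_supported_def intro: smooth_mult)

lemma cube_supported_mult2: "cube_supported b \<Longrightarrow> smooth \<phi> \<Longrightarrow> cube_supported (\<lambda>y. b y * \<phi> y)"
  by (auto simp: cube_supported_def intro: smooth_mult)

lemma cube_supported_add: "cube_supported a \<Longrightarrow> cube_supported b \<Longrightarrow> cube_supported (\<lambda>y. a y + b y)"
  by (auto simp: cube_supported_def intro: smooth_add)

lemma cube_supported_minus: "cube_supported a \<Longrightarrow> cube_supported b \<Longrightarrow> cube_supported (\<lambda>y. a y - b y)"
  by (auto simp: cube_supported_def intro: smooth_minus)

lemma square_integrable_cube_supported:
  fixes b :: "real^'a::finite \<Rightarrow> complex"
  assumes "cube_supported b" shows "square_integrable b"
  unfolding square_integrable_def
proof
  have c: "continuous_on UNIV b" using assms by (auto simp: cube_supported_def intro: smooth_continuous)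
  then show "b \<in> borel_measurable borel" by (rule borel_measurable_continuous_onI)
  have "compact (b ` cube)" by (rule compact_continuous_image[OF continuous_on_subset[OF c] compact_cube]) simp
  then obtain B where B: "\<And>y. y \<in> cube \<Longrightarrow> norm (b y) \<le> B" and "B > 0"
    using compact_imp_bounded bounded_pos by (metis (no_types, lifting) imageI)
  have "(\<integral>\<^sup>+x. ennreal ((norm (b x))\<^sup>2) \<partial>lborel) \<le> (\<integral>\<^sup>+x. ennreal (B\<^sup>2) * indicator (cube :: (real^'a) set) x \<partial>lborel)"
  proof (rule nn_integral_mono)
    fix x
    show "ennreal ((norm (b x))\<^sup>2) \<le> ennreal (B\<^sup>2) * indicator cube x"
    proof (cases "x \<in> cube")
      case True
      then show ?thesis using B by (auto intro!: ennreal_leI power_mono)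
    next
      case False
      then have "b x = 0" using assms by (auto simp: cube_supported_def)
      then show ?thesis by simp
    qed
  qed
  also have "\<dots> = ennreal (B\<^sup>2) * emeasure lborel (cube :: (real^'a) set)" by (simp add: nn_integral_cmult_indicator)
  also have "\<dots> < \<infinity>"
    using emeasure_lborel_cbox_finite[of "(\<chi> k. -2) :: real^'a" "\<chi> k. 2"] by (simp add: cube_eq_cbox ennreal_mult_less_top)
  finally show "(\<integral>\<^sup>+x. ennreal ((norm (b x))\<^sup>2) \<partial>lborel) < \<infinity>" .
qed

lemma line_int_eq_lborel:
  assumes "smooth b"
  shows "integrable lborel (\<lambda>u. indicator {s..t} u *\<^sub>R b (y + u *\<^sub>R axis i 1))"
    and "(LINT u|lborel. indicator {s..t} u *\<^sub>R b (y + u *\<^sub>R axis i 1)) = line_int i s t b y"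
proof -
  have *: "set_integrable lborel {s..t} (\<lambda>u. b (y + u *\<^sub>R axis i 1))"
    by (rule borel_integrable_atLeastAtMost'[OF line_continuous[OF assms]])
  then show "integrable lborel (\<lambda>u. indicator {s..t} u *\<^sub>R b (y + u *\<^sub>R axis i 1))"
    by (simp add: set_integrable_def)
  show "(LINT u|lborel. indicator {s..t} u *\<^sub>R b (y + u *\<^sub>R axis i 1)) = line_int i s t b y"
    using set_borel_integral_eq_integral(2)[OF *] by (simp add: set_lebesgue_integral_def line_int_def)
qed

lemma line_int_diff:
  assumes "smooth a" "smooth b"
  shows "line_int i s t (\<lambda>y. a y - b y) y = line_int i s t a y - line_int i s t b y"
  unfolding line_int_def
  by (intro integral_diff integrable_continuous_real line_continuous assms)

lemma line_int_zero: "(\<And>u. s \<le> u \<Longrightarrow> u \<le> t \<Longrightarrow> b (y + u *\<^sub>R axis i 1) = 0) \<Longrightarrow> line_int i s t b y = 0"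
  unfolding line_int_def by (subst integral_cong[where g="\<lambda>_. 0"]) auto

lemma line_int_combine:
  assumes "smooth b" "r \<le> s" "s \<le> t"
  shows "line_int i r s b y + line_int i s t b y = line_int i r t b y"
  unfolding line_int_def using assms
  by (intro Henstock_Kurzweil_Integration.integral_combine integrable_continuous_real line_continuous) auto

text \<open>The derivative of \<open>P\<close> is supported in the unit interval and has integral \<open>1\<close>. The function \<open>P\<close> provides the cutoff and
its derivative the weight for averaging over the starting points of the antiderivatives.\<close>
locale smooth_step =
  fixes P :: "real \<Rightarrow> real"
  assumes P_smooth: "k_differentiable k P"
    and P_0: "x \<le> 0 \<Longrightarrow> P x = 0"
    and P_1: "x \<ge> 1 \<Longrightarrow> P x = 1"
begin

lemma dP_smooth: "k_differentiable k (deriv P)" using P_smooth[of "Suc k"] by simp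

lemma P_cont: "continuous_on A P" and dP_cont: "continuous_on A (deriv P)"
  using P_smooth[of "Suc 0"] dP_smooth[of "Suc 0"]
  by (auto intro!: continuous_at_imp_continuous_on field_differentiable_imp_continuous_at)

lemma dP_0: "x < 0 \<or> x > 1 \<Longrightarrow> deriv P x = 0"
proof (elim disjE)
  assume "x < 0"
  have "(P has_field_derivative 0) (at x)"
    by (rule has_field_derivative_transform_within_open[where S="{..<0}" and f="\<lambda>_. 0"])
      (use \<open>x < 0\<close> P_0 in auto)
  then show ?thesis by (rule DERIV_imp_deriv)
next
  assume "x > 1"
  have "(P has_field_derivative 0) (at x)"
    by (rule has_field_derivative_transform_within_open[where S="{1<..}" and f="\<lambda>_. 1"])
      (use \<open>x > 1\<close> P_1 in auto)
  then show ?thesis by (rule DERIV_imp_deriv)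
qed

lemma P_bound: obtains c where "c \<ge> 1" "\<And>x. \<bar>P x\<bar> \<le> c" "\<And>x. \<bar>deriv P x\<bar> \<le> c"
proof -
  have "bounded (P ` {0..1})" "bounded (deriv P ` {0..1})"
    by (auto intro!: compact_imp_bounded compact_continuous_image P_cont dP_cont)
  then obtain a b where ab: "\<And>x. 0 \<le> x \<Longrightarrow> x \<le> 1 \<Longrightarrow> \<bar>P x\<bar> \<le> a" "\<And>x. 0 \<le> x \<Longrightarrow> x \<le> 1 \<Longrightarrow> \<bar>deriv P x\<bar> \<le> b"
    unfolding bounded_iff by (metis atLeastAtMost_iff imageI real_norm_def)
  show thesis
  proof (rule that)
    show "max 1 (max a b) \<ge> 1" by simp
    show "\<bar>P x\<bar> \<le> max 1 (max a b)" for x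
      using ab(1)[of x] P_0[of x] P_1[of x] by (cases "x \<le> 0"; cases "x \<ge> 1") auto
    show "\<bar>deriv P x\<bar> \<le> max 1 (max a b)" for x
      using ab(2)[of x] dP_0[of x] by (cases "x < 0"; cases "x > 1") auto
  qed
qed

definition step_at :: "'d::finite \<Rightarrow> real^'d \<Rightarrow> complex" where "step_at i y = of_real (P (y $ i))"

lemma step_at_smooth: "smooth (step_at i)"
  and step_at_partial: "partial_deriv k (step_at i) y = (if k = i then of_real (deriv P (y $ i)) else 0)"
proof -
  define b where "b = (\<lambda>j. if j = i then P else (\<lambda>_. 1))"
  have b: "k_differentiable k (b j)" for k j by (simp add: b_def P_smooth k_differentiable_const)
  then have b': "b j field_differentiable (at x)" for j x using k_differentiable.simps(2) by blast
  have prod: "(\<Prod>j\<in>UNIV. if j = i then g j else 1) = g i" for g :: "'a \<Rightarrow> real" by simp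
  have eq: "step_at i = tensor b"
  proof
    fix y
    have "(\<Prod>j\<in>UNIV. b j (y $ j)) = (\<Prod>j\<in>UNIV. if j = i then P (y $ j) else 1)"
      by (intro prod.cong) (auto simp: b_def)
    then show "step_at i y = tensor b y" by (simp add: step_at_def tensor_def prod)
  qed
  show "smooth (step_at i)" unfolding eq smooth_def using b by (auto intro: C_k_tensor)
  show "partial_deriv k (step_at i) y = (if k = i then of_real (deriv P (y $ i)) else 0)"
  proof (cases "k = i")
    case True
    have "(\<Prod>j\<in>UNIV. (b(i := deriv (b i))) j (y $ j)) = (\<Prod>j\<in>UNIV. if j = i then deriv P (y $ j) else 1)"
      by (intro prod.cong) (auto simp: b_def)
    then show ?thesis
      using True by (simp only: eq tensor_has_derivative(2)[of b, OF b']) (simp add: tensor_def prod)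
  next
    case False
    have "(b(k := deriv (b k))) k (y $ k) = 0" using False by (simp add: b_def)
    then have "(\<Prod>j\<in>UNIV. (b(k := deriv (b k))) j (y $ j)) = 0"
      by (intro prod_zero) auto
    then show ?thesis using False by (simp only: eq tensor_has_derivative(2)[of b, OF b']) (simp add: tensor_def)
  qed
qed

text \<open>Averaging the antiderivative \<open>\<integral>\<^sub>c\<^sup>s g\<close> over starting points \<open>c\<close> with density \<open>deriv P\<close> gives the kernel \<open>P(\<sigma>) - [\<sigma> \<ge> s]\<close>
in the position \<open>\<sigma>\<close>. It vanishes for \<open>\<sigma>\<close> outside the hull of \<open>s\<close> and the unit interval. With \<open>density_kernel\<close> the operator is the average itself,
constant along the axis.\<close>
definition step_kernel :: "'d::finite \<Rightarrow> real^'d \<Rightarrow> real \<Rightarrow> real"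
  where "step_kernel i x u = P (x $ i + u) - (if u \<ge> 0 then 1 else 0)"

definition density_kernel :: "'d::finite \<Rightarrow> real^'d \<Rightarrow> real \<Rightarrow> real"
  where "density_kernel i x u = deriv P (x $ i + u)"

lemma bounded_kernels: obtains c where "c \<ge> 1"
  "\<And>i :: 'd::finite. bounded_kernel c (step_kernel i)" "\<And>i :: 'd. bounded_kernel c (density_kernel i)"
proof -
  obtain c where c: "c \<ge> 1" "\<And>x. \<bar>P x\<bar> \<le> c" "\<And>x. \<bar>deriv P x\<bar> \<le> c" using P_bound by blast
  have [measurable]: "P \<in> borel_measurable borel" "deriv P \<in> borel_measurable borel"
    using P_cont dP_cont by (auto intro: borel_measurable_continuous_onI)
  have [measurable]: "(\<lambda>p::(real^'d) \<times> real. fst p $ i + snd p) \<in> borel_measurable borel" for i :: 'd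
    by (intro borel_measurable_continuous_onI continuous_intros)
  have [measurable]: "(\<lambda>p::(real^'d) \<times> real. snd p) \<in> borel_measurable borel"
    by (intro borel_measurable_continuous_onI continuous_intros)
  show thesis
  proof (rule that[of "c + 1"])
    show "bounded_kernel (c + 1) (step_kernel i)" for i :: 'd
      unfolding bounded_kernel_def
    proof (intro conjI allI)
      show "(\<lambda>p. step_kernel i (fst p) (snd p)) \<in> borel_measurable borel" unfolding step_kernel_def by measurable
      show "\<bar>step_kernel i x u\<bar> \<le> c + 1" for x u
        using c(2)[of "x $ i + u"] by (auto simp: step_kernel_def)
    qed (use c in simp)
    show "bounded_kernel (c + 1) (density_kernel i)" for i :: 'd
      unfolding bounded_kernel_def
    proof (intro conjI allI)
      show "(\<lambda>p. density_kernel i (fst p) (snd p)) \<in> borel_measurable borel" unfolding density_kernel_def by measurable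
      show "\<bar>density_kernel i x u\<bar> \<le> c + 1" for x u
        using c(3)[of "x $ i + u"] by (auto simp: density_kernel_def)
    qed (use c in simp)
  qed (use c in simp)
qed

text \<open>The transpose of the antiderivative operator, acting on test functions.\<close>
definition step_adjoint :: "'d::finite \<Rightarrow> (real^'d \<Rightarrow> complex) \<Rightarrow> real^'d \<Rightarrow> complex"
  where "step_adjoint i b y = step_at i y * line_int i (-5) 5 b y - line_int i (-5) 0 b y"

lemma reflect: "(LINT u|lborel. f u) = (LINT u|lborel. f (- u))" for f :: "real \<Rightarrow> complex"
  using lborel_integral_real_affine[of "-1" f 0] by simp

lemma line_op_step_adjoint:
  assumes f: "square_integrable f" and b: "cube_supported b"
  shows "(LINT x|lborel. line_op i (step_kernel i) f x * b x) = (LINT y|lborel. f y * step_adjoint i b y)"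
proof -
  obtain c where k: "bounded_kernel c (step_kernel i)" using bounded_kernels by metis
  have s: "smooth b" using b by (simp add: cube_supported_def)
  have "(LINT u|lborel. indicator {-5..5} u *\<^sub>R
       (of_real (step_kernel i (y - u *\<^sub>R axis i 1) u) * b (y - u *\<^sub>R axis i 1))) = step_adjoint i b y" for y
  proof -
    have "(LINT u|lborel. indicator {-5..5} u *\<^sub>R
       (of_real (step_kernel i (y - u *\<^sub>R axis i 1) u) * b (y - u *\<^sub>R axis i 1)))
      = (LINT u|lborel. indicator {-5..5} (-u) *\<^sub>R
       (of_real (step_kernel i (y - (-u) *\<^sub>R axis i 1) (-u)) * b (y - (-u) *\<^sub>R axis i 1)))"
      by (rule reflect)
    also have "\<dots> = (LINT u|lborel. step_at i y * (indicator {-5..5} u *\<^sub>R b (y + u *\<^sub>R axis i 1))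
        - indicator {-5..0} u *\<^sub>R b (y + u *\<^sub>R axis i 1))"
      by (intro Bochner_Integration.integral_cong refl)
        (auto simp: step_kernel_def step_at_def axis_def algebra_simps split: split_indicator)
    also have "\<dots> = step_adjoint i b y"
      by (subst Bochner_Integration.integral_diff)
        (use line_int_eq_lborel(1)[OF s] in \<open>auto intro!: integrable_mult_right
          simp del: mult_scaleR_right simp: step_adjoint_def line_int_eq_lborel(2)[OF s]\<close>)
    finally show ?thesis .
  qed
  then show ?thesis
    using line_op_adjoint[OF f square_integrable_cube_supported[OF b] k] by simp
qed

lemma line_op_density_adjoint:
  assumes f: "square_integrable f" and b: "cube_supported b"
  shows "(LINT x|lborel. line_op i (density_kernel i) f x * b x)
    = (LINT y|lborel. f y * (of_real (deriv P (y $ i)) * line_int i (-5) 5 b y))"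
proof -
  obtain c where k: "bounded_kernel c (density_kernel i)" using bounded_kernels by metis
  have s: "smooth b" using b by (simp add: cube_supported_def)
  have "(LINT u|lborel. indicator {-5..5} u *\<^sub>R
       (of_real (density_kernel i (y - u *\<^sub>R axis i 1) u) * b (y - u *\<^sub>R axis i 1)))
      = of_real (deriv P (y $ i)) * line_int i (-5) 5 b y" for y
  proof -
    have "(LINT u|lborel. indicator {-5..5} u *\<^sub>R
       (of_real (density_kernel i (y - u *\<^sub>R axis i 1) u) * b (y - u *\<^sub>R axis i 1)))
      = (LINT u|lborel. indicator {-5..5} (-u) *\<^sub>R
       (of_real (density_kernel i (y - (-u) *\<^sub>R axis i 1) (-u)) * b (y - (-u) *\<^sub>R axis i 1)))"
      by (rule reflect)
    also have "\<dots> = (LINT u|lborel. of_real (deriv P (y $ i)) * (indicator {-5..5} u *\<^sub>R b (y + u *\<^sub>R axis i 1)))"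
      by (intro Bochner_Integration.integral_cong refl)
        (auto simp: density_kernel_def axis_def algebra_simps split: split_indicator)
    also have "\<dots> = of_real (deriv P (y $ i)) * line_int i (-5) 5 b y"
      unfolding integral_mult_right_zero line_int_eq_lborel(2)[OF s] ..
    finally show ?thesis .
  qed
  then show ?thesis
    using line_op_adjoint[OF f square_integrable_cube_supported[OF b] k] by simp
qed

lemma line_int_support:
  assumes "cube_supported b" "k \<noteq> i" "\<bar>y $ k\<bar> > 2"
  shows "line_int i s t b y = 0"
  by (rule line_int_zero, rule cube_supportedD[OF assms(1), where k=k]) (use assms in \<open>auto simp: axis_def\<close>)

text \<open>Beyond the cube the two line integrals cancel on the right, where \<open>P = 1\<close>, and both terms vanish on the left,
where \<open>P = 0\<close>.\<close>
lemma step_adjoint_cube_supported: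
  assumes b: "cube_supported b" shows "cube_supported (step_adjoint i b)"
  unfolding cube_supported_def
proof (intro conjI allI impI)
  have s: "smooth b" using b by (simp add: cube_supported_def)
  show "smooth (step_adjoint i b)"
    unfolding step_adjoint_def[abs_def] by (intro smooth_minus smooth_mult step_at_smooth smooth_line_int s)
  fix y :: "real^'a" assume "y \<notin> cube"
  then obtain k where k: "\<bar>y $ k\<bar> > 2" by (auto simp: cube_def not_le)
  consider "k \<noteq> i" | "k = i" "y $ i > 2" | "k = i" "y $ i < -2" using k by (cases "k = i"; cases "y $ i > 2") auto
  then show "step_adjoint i b y = 0"
  proof cases
    case 1
    then show ?thesis using line_int_support[OF b _ k] by (simp add: step_adjoint_def)
  next
    case 2
    have "line_int i 0 5 b y = 0"
      by (rule line_int_zero, rule cube_supportedD[OF b, where k=i]) (use 2 in \<open>auto simp: axis_def\<close>)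
    moreover have "step_at i y = 1" using 2 by (simp add: step_at_def P_1)
    ultimately show ?thesis using line_int_combine[OF s, of "-5" 0 5 i y] by (simp add: step_adjoint_def)
  next
    case 3
    have "line_int i (-5) 0 b y = 0"
      by (rule line_int_zero, rule cube_supportedD[OF b, where k=i]) (use 3 in \<open>auto simp: axis_def\<close>)
    moreover have "step_at i y = 0" using 3 by (simp add: step_at_def P_0)
    ultimately show ?thesis by (simp add: step_adjoint_def)
  qed
qed

lemma step_adjoint_diff: "smooth a \<Longrightarrow> smooth b \<Longrightarrow> step_adjoint i (\<lambda>y. a y - b y) y = step_adjoint i a y - step_adjoint i b y"
  by (simp add: step_adjoint_def line_int_diff algebra_simps)

text \<open>The operator commutes with partial derivatives, except that along its own axis the factor \<open>P\<close> is differentiated too.\<close>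
lemma step_adjoint_partial:
  assumes "smooth b"
  shows "partial_deriv k (step_adjoint i b) y
    = step_adjoint i (partial_deriv k b) y + (if k = i then of_real (deriv P (y $ i)) * line_int i (-5) 5 b y else 0)"
proof -
  have eq: "step_adjoint i b = (\<lambda>y. step_at i y * line_int i (-5) 5 b y - line_int i (-5) 0 b y)"
    by (auto simp: step_adjoint_def)
  have "partial_deriv k (step_adjoint i b) y =
    partial_deriv k (\<lambda>y. step_at i y * line_int i (-5) 5 b y) y - partial_deriv k (line_int i (-5) 0 b) y"
    unfolding eq
    by (intro partial_deriv_minus smooth_mult step_at_smooth smooth_line_int assms)
  also have "partial_deriv k (\<lambda>y. step_at i y * line_int i (-5) 5 b y) y
    = step_at i y * partial_deriv k (line_int i (-5) 5 b) y + partial_deriv k (step_at i) y * line_int i (-5) 5 b y"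
    by (intro partial_deriv_mult smooth_differentiable step_at_smooth smooth_line_int assms)
  finally show ?thesis
    by (simp add: line_int_has_derivative(2)[OF assms] step_at_partial step_adjoint_def[of i "partial_deriv k b" y] algebra_simps)
qed

lemma ends_vanish:
  assumes b: "cube_supported b" and "y \<in> cube"
  shows "b (y + 5 *\<^sub>R axis i 1) = 0" "b (y + (-5) *\<^sub>R axis i 1) = 0"
proof -
  have "\<bar>y $ i\<bar> \<le> 2" using assms by (auto simp: cube_def)
  then show "b (y + 5 *\<^sub>R axis i 1) = 0" "b (y + (-5) *\<^sub>R axis i 1) = 0"
    by (auto intro!: cube_supportedD[OF b, where k=i] simp: axis_def)
qed

lemma line_int_partial_zero:
  assumes b: "cube_supported b" and "y \<in> cube"
  shows "line_int i (-5) 5 (partial_deriv i b) y = 0"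
  using assms ends_vanish[OF assms]
  by (subst line_int_partial_deriv) (auto simp: cube_supported_def)

text \<open>The transposed form of the fact that the antiderivative is inverse to the derivative.\<close>
lemma step_adjoint_of_partial:
  assumes b: "cube_supported b"
  shows "step_adjoint i (partial_deriv i b) y = - b y"
proof (cases "y \<in> cube")
  case True
  have "line_int i (-5) 0 (partial_deriv i b) y = b y"
    using ends_vanish[OF b True] b by (subst line_int_partial_deriv) (auto simp: cube_supported_def)
  then show ?thesis using line_int_partial_zero[OF b True] by (simp add: step_adjoint_def)
next
  case False
  then show ?thesis
    using step_adjoint_cube_supported[OF cube_supported_partial[OF b]] b by (auto simp: cube_supported_def)
qed

text \<open>Equal to \<open>1\<close> on \<open>[-1, 1]\<close> and to \<open>0\<close> off \<open>[-2, 2]\<close>.\<close>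
definition bump :: "real \<Rightarrow> real" where "bump t = P (t + 2) - P (t - 1)"

definition cutoff :: "real^'d::finite \<Rightarrow> complex" where "cutoff = tensor (\<lambda>_. bump)"

lemma bump_smooth: "k_differentiable k bump"
proof -
  have "bump = (\<lambda>t. P (2 + 1 * t) + (-1) * P ((-1) + 1 * t))" by (auto simp: bump_def add.commute)
  moreover have "k_differentiable k (\<lambda>t. P (2 + 1 * t) + (-1) * P ((-1) + 1 * t))"
    by (intro k_differentiable_add k_differentiable_mult k_differentiable_const k_differentiable_affine P_smooth)
  ultimately show ?thesis by simp
qed

lemma cutoff_smooth: "smooth cutoff"
  unfolding cutoff_def smooth_def by (auto intro: C_k_tensor bump_smooth)

lemma cutoff_supported: "cube_supported cutoff"
  unfolding cube_supported_def
proof (intro conjI allI impI cutoff_smooth)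
  fix y :: "real^'d" assume "y \<notin> cube"
  then obtain k where k: "\<bar>y $ k\<bar> > 2" by (auto simp: cube_def not_le)
  then have "bump (y $ k) = 0" by (cases "y $ k > 0") (auto simp: bump_def P_0 P_1)
  then have "(\<Prod>i\<in>UNIV. bump (y $ i)) = 0" by (intro prod_zero) auto
  then show "cutoff y = 0" by (simp add: cutoff_def tensor_def)
qed

lemma cutoff_1: "(\<And>k. \<bar>y $ k\<bar> \<le> 1) \<Longrightarrow> cutoff y = 1"
proof -
  assume y: "\<And>k. \<bar>y $ k\<bar> \<le> 1"
  have "bump (y $ k) = 1" for k using y[of k] by (auto simp: bump_def P_0 P_1)
  then show ?thesis by (simp add: cutoff_def tensor_def)
qed

lemma cutoff_commute:
  "i \<noteq> j \<Longrightarrow> partial_deriv i (partial_deriv j cutoff) = partial_deriv j (partial_deriv i cutoff)"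
  unfolding cutoff_def by (intro partial_deriv_tensor_commute bump_smooth)

end

section \<open>Cutting off divergence-free fields on the cube\<close>

text \<open>The square of the \<open>L\<^sup>2(A)\<close> norm, which is additive in \<open>A\<close>.\<close>
definition energy :: "(real^'d::finite) set \<Rightarrow> (real^'d \<Rightarrow> 'a::real_normed_vector) \<Rightarrow> ennreal"
  where "energy A f = (\<integral>\<^sup>+x\<in>A. ennreal ((norm (f x))\<^sup>2) \<partial>lebesgue)"

lemma Lp_norm_2: "Lp_norm 2 A f = ennreal_powr (energy A f) (1/2)"
proof -
  have "enn2real 2 = 2" by (metis enn2real_numeral)
  then show ?thesis by (simp add: Lp_norm_def energy_def powr_numeral)
qed

lemma L2_fields_iff: "f \<in> L2_fields \<longleftrightarrow> f \<in> borel_measurable lebesgue \<and> energy UNIV f < top"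
  by (auto simp: L2_fields_def Lp_norm_2 ennreal_powr_def less_top)

lemma vec_nth_measurable [measurable]:
  "f \<in> borel_measurable M \<Longrightarrow> (\<lambda>x. (f x :: 'a::euclidean_space^'d::finite) $ j) \<in> borel_measurable M"
  by (rule measurable_compose[where g="\<lambda>v. v $ j"]) (auto intro!: borel_measurable_continuous_onI continuous_intros)

lemma measurable_vec_components:
  fixes f :: "'m \<Rightarrow> complex^'d::finite"
  assumes "\<And>j. (\<lambda>x. f x $ j) \<in> borel_measurable M"
  shows "f \<in> borel_measurable M"
proof (subst borel_measurable_euclidean_space, rule)
  fix b :: "complex^'d" assume "b \<in> Basis"
  then obtain j u where "b = axis j u" by (auto simp: Basis_vec_def)
  then show "(\<lambda>x. f x \<bullet> b) \<in> borel_measurable M"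
    using assms[of j] by (simp add: inner_axis)
qed

lemma norm_vec_le_sum: "norm (v :: complex^'d::finite) \<le> (\<Sum>j\<in>UNIV. norm (v $ j))"
  unfolding norm_vec_def by (rule L2_set_le_sum) simp

lemma test_function_smooth: "\<phi> \<in> test_functions \<Longrightarrow> smooth \<phi>"
  by (simp add: test_functions_def smooth_def)

lemma cube_supported_test: "cube_supported b \<Longrightarrow> b \<in> test_functions"
proof -
  assume b: "cube_supported b"
  then have "{x. b x \<noteq> 0} \<subseteq> cube" by (auto simp: cube_supported_def)
  then have "closure {x. b x \<noteq> 0} \<subseteq> cube" using closed_cube by (rule closure_minimal)
  then have "compact (closure {x. b x \<noteq> 0})"
    using compact_cube by (metis closed_closure compact_Int_closed inf.absorb_iff2)
  then show ?thesis using b by (simp add: test_functions_def cube_supported_def smooth_def)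
qed

lemma cube_supported_bounded:
  assumes "cube_supported b" obtains B where "\<And>y. norm (b y) \<le> B"
proof -
  have c: "continuous_on cube b" using assms by (auto simp: cube_supported_def intro: smooth_continuous)
  have "compact (b ` cube)" by (rule compact_continuous_image[OF c compact_cube])
  then obtain B where B: "\<And>y. y \<in> cube \<Longrightarrow> norm (b y) \<le> B" and "B > 0"
    using compact_imp_bounded bounded_pos by (metis (no_types, lifting) imageI)
  have "norm (b y) \<le> B" for y
    using B[of y] \<open>B > 0\<close> assms by (cases "y \<in> cube") (auto simp: cube_supported_def)
  then show thesis by (rule that)
qed

context smooth_step
begin

context
  fixes i0 i1 :: "'d::finite" and f :: "real^'d \<Rightarrow> complex^'d"
begin

definition cube_part :: "'d \<Rightarrow> real^'d \<Rightarrow> complex"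
  where "cube_part j x = indicator cube x *\<^sub>R (f x $ j)"

text \<open>The entries \<open>A\<^sub>0\<^sub>k\<close> of the antisymmetric potential, for \<open>k\<close> different from the distinguished axis \<open>i0\<close>. The
antiderivatives along \<open>i0\<close> reproduce all components of \<open>f\<close> but leave, in the component \<open>i0\<close>, the average of \<open>f\<close> along that axis.
The correction in the entry \<open>i1\<close> supplies this average by an antiderivative along \<open>i1\<close>; the average is constant along \<open>i0\<close>, so the
correction leaves the component \<open>i1\<close> unchanged.\<close>
definition potential :: "'d \<Rightarrow> real^'d \<Rightarrow> complex"
  where "potential k x = line_op i0 (step_kernel i0) (cube_part k) x
    - (if k = i1 then line_op i1 (step_kernel i1) (line_op i0 (density_kernel i0) (cube_part i0)) x else 0)"

text \<open>The field \<open>\<chi> f\<^sub>j + \<Sum>\<^sub>i \<partial>\<^sub>i\<chi> A\<^sub>i\<^sub>j\<close>, that is, the divergence of \<open>\<chi> A\<close>.\<close>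
definition cut_field :: "real^'d \<Rightarrow> complex^'d"
  where "cut_field x = (\<chi> j. cutoff x * f x $ j +
    (if j = i0 then - (\<Sum>k\<in>UNIV - {i0}. partial_deriv k cutoff x * potential k x)
     else partial_deriv i0 cutoff x * potential j x))"

text \<open>What the entry \<open>A\<^sub>0\<^sub>k\<close> is tested against in \<open>\<integral> cut_field \<sqdot> \<nabla>\<phi>\<close>.\<close>
definition commutator :: "(real^'d \<Rightarrow> complex) \<Rightarrow> 'd \<Rightarrow> real^'d \<Rightarrow> complex"
  where "commutator \<phi> k y = partial_deriv i0 cutoff y * partial_deriv k \<phi> y
    - partial_deriv k cutoff y * partial_deriv i0 \<phi> y"

text \<open>The test function \<open>\<psi>\<close> for which \<open>\<integral> cut_field \<sqdot> \<nabla>\<phi> = \<integral> f \<sqdot> \<nabla>\<psi>\<close>.\<close>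
definition pulled_test :: "(real^'d \<Rightarrow> complex) \<Rightarrow> real^'d \<Rightarrow> complex"
  where "pulled_test \<phi> y = cutoff y * \<phi> y + step_adjoint i0 (\<lambda>y. \<phi> y * partial_deriv i0 cutoff y) y"

lemma cut_grad_supported: "smooth \<phi> \<Longrightarrow> cube_supported (\<lambda>y. \<phi> y * partial_deriv k cutoff y)"
  by (intro cube_supported_mult cube_supported_partial cutoff_supported)

text \<open>The second derivatives of the cutoff cancel by symmetry.\<close>
lemma commutator_eq:
  assumes "smooth \<phi>" "k \<noteq> i0"
  shows "commutator \<phi> k = (\<lambda>y. partial_deriv k (\<lambda>y. \<phi> y * partial_deriv i0 cutoff y) y
    - partial_deriv i0 (\<lambda>y. \<phi> y * partial_deriv k cutoff y) y)"
  using cutoff_commute[OF assms(2), THEN fun_cong]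
  by (auto simp: commutator_def fun_eq_iff partial_deriv_mult smooth_differentiable assms
      smooth_partial_deriv cutoff_smooth)

lemma commutator_supported:
  assumes "smooth \<phi>" "k \<noteq> i0" shows "cube_supported (commutator \<phi> k)"
  unfolding commutator_eq[OF assms]
  by (intro cube_supported_minus cube_supported_partial cut_grad_supported assms)

lemma step_adjoint_commutator:
  assumes \<phi>: "smooth \<phi>" and "k \<noteq> i0"
  shows "step_adjoint i0 (commutator \<phi> k) y
    = step_adjoint i0 (partial_deriv k (\<lambda>y. \<phi> y * partial_deriv i0 cutoff y)) y + \<phi> y * partial_deriv k cutoff y"
  unfolding commutator_eq[OF assms]
  by (subst step_adjoint_diff) (auto intro!: smooth_partial_deriv cube_supported_smooth[OF cut_grad_supported] \<phi>
      simp: step_adjoint_of_partial[OF cut_grad_supported[OF \<phi>]])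

lemma pulled_test_supported:
  assumes "smooth \<phi>" shows "cube_supported (pulled_test \<phi>)"
  unfolding pulled_test_def[abs_def]
  by (intro cube_supported_add cube_supported_mult2 cutoff_supported assms step_adjoint_cube_supported cut_grad_supported)

lemma pulled_test_partial:
  assumes \<phi>: "smooth \<phi>"
  shows "partial_deriv k (pulled_test \<phi>) y = cutoff y * partial_deriv k \<phi> y + partial_deriv k cutoff y * \<phi> y
    + partial_deriv k (step_adjoint i0 (\<lambda>y. \<phi> y * partial_deriv i0 cutoff y)) y"
  unfolding pulled_test_def[abs_def]
  by (simp add: partial_deriv_add partial_deriv_mult smooth_differentiable smooth_mult \<phi> cutoff_smooth
      cube_supported_smooth step_adjoint_cube_supported cut_grad_supported)

text \<open>The contribution of an antiderivative along \<open>i0\<close> to the weak equation.\<close>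
lemma pulled_test_partial_other:
  assumes \<phi>: "smooth \<phi>" and "k \<noteq> i0"
  shows "step_adjoint i0 (commutator \<phi> k) y = partial_deriv k (pulled_test \<phi>) y - cutoff y * partial_deriv k \<phi> y"
  using assms step_adjoint_partial[OF cube_supported_smooth[OF cut_grad_supported[OF \<phi>]], of k i0 i0 y]
  by (simp add: step_adjoint_commutator pulled_test_partial)

text \<open>The contribution of the correction term. Integrating \<open>step_adjoint i1\<close> of the commutator over a full line in direction
\<open>i0\<close> removes one of its two terms, a derivative in that direction, and leaves exactly what the component \<open>i0\<close>
lacks.\<close>
lemma pulled_test_partial_axis:
  assumes \<phi>: "smooth \<phi>" and "i1 \<noteq> i0" and y: "y \<in> cube"
  shows "- (of_real (deriv P (y $ i0)) * line_int i0 (-5) 5 (step_adjoint i1 (commutator \<phi> i1)) y)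
    = partial_deriv i0 (pulled_test \<phi>) y - cutoff y * partial_deriv i0 \<phi> y"
proof -
  let ?g = "\<lambda>k y. \<phi> y * partial_deriv k cutoff y"
  have gs: "cube_supported (?g k)" for k by (rule cut_grad_supported[OF \<phi>])
  have g: "smooth (?g k)" for k by (rule cube_supported_smooth[OF gs])
  have d: "smooth (step_adjoint i1 (?g i1))" by (intro cube_supported_smooth step_adjoint_cube_supported gs)
  have "step_adjoint i1 (commutator \<phi> i1) = (\<lambda>y. (0 - ?g i0 y) - partial_deriv i0 (step_adjoint i1 (?g i1)) y)"
    unfolding commutator_eq[OF \<phi> assms(2)]
    using assms(2) by (auto simp: fun_eq_iff step_adjoint_diff smooth_partial_deriv g step_adjoint_of_partial[OF gs] step_adjoint_partial[OF g])
  then have "line_int i0 (-5) 5 (step_adjoint i1 (commutator \<phi> i1)) y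
    = line_int i0 (-5) 5 (\<lambda>y. 0) y - line_int i0 (-5) 5 (?g i0) y - line_int i0 (-5) 5 (partial_deriv i0 (step_adjoint i1 (?g i1))) y"
    by (simp only: line_int_diff smooth_minus smooth_const g smooth_partial_deriv[OF d])
  also have "line_int i0 (-5) 5 (partial_deriv i0 (step_adjoint i1 (?g i1))) y = 0"
    by (rule line_int_partial_zero[OF step_adjoint_cube_supported[OF gs] y])
  also have "line_int i0 (-5) 5 (\<lambda>y. 0) y = 0" by (rule line_int_zero) simp
  finally show ?thesis
    by (simp add: pulled_test_partial[OF \<phi>] step_adjoint_partial[OF g] step_adjoint_of_partial[OF gs])
qed

context
  assumes f_meas [measurable]: "f \<in> borel_measurable borel" and f_int: "energy cube f < top"
begin

lemma cube_part_measurable [measurable]: "cube_part j \<in> borel_measurable borel"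
  unfolding cube_part_def[abs_def] by measurable

lemma cube_part_bound: "(\<integral>\<^sup>+x. ennreal ((norm (cube_part j x))\<^sup>2) \<partial>lborel) \<le> energy cube f"
  unfolding energy_def nn_integral_completion
  by (intro nn_integral_mono)
    (auto simp: cube_part_def Finite_Cartesian_Product.norm_nth_le intro!: ennreal_leI power_mono split: split_indicator)

lemma square_integrable_cube_part: "square_integrable (cube_part j)"
  unfolding square_integrable_def using cube_part_bound[of j] f_int by (auto intro: le_less_trans)

lemma square_integrable_diff: assumes "square_integrable a" "square_integrable b" shows "square_integrable (\<lambda>x. a x - b x)"
  unfolding square_integrable_def
proof
  have [measurable]: "a \<in> borel_measurable borel" "b \<in> borel_measurable borel"
    using assms by (auto simp: square_integrable_def)
  show "(\<lambda>x. a x - b x) \<in> borel_measurable borel" by measurable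
  have "(\<integral>\<^sup>+x. ennreal ((norm (a x - b x))\<^sup>2) \<partial>lborel)
    \<le> (\<integral>\<^sup>+x. ennreal 2 * (ennreal ((norm (a x))\<^sup>2) + ennreal ((norm (b x))\<^sup>2)) \<partial>lborel)"
    by (intro nn_integral_mono norm_diff_square_le)
  also have "\<dots> < \<infinity>"
    using assms by (simp add: nn_integral_cmult nn_integral_add square_integrable_def ennreal_mult_less_top)
  finally show "(\<integral>\<^sup>+x. ennreal ((norm (a x - b x))\<^sup>2) \<partial>lborel) < \<infinity>" .
qed

lemma square_integrable_line_ops:
  "square_integrable (line_op i0 (step_kernel i0) (cube_part k))" "square_integrable (line_op i0 (density_kernel i0) (cube_part i0))"
  "square_integrable (line_op i1 (step_kernel i1) (line_op i0 (density_kernel i0) (cube_part i0)))"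
proof -
  obtain c where c: "\<And>i :: 'd. bounded_kernel c (step_kernel i)" "\<And>i :: 'd. bounded_kernel c (density_kernel i)" using bounded_kernels by metis
  then show "square_integrable (line_op i0 (step_kernel i0) (cube_part k))" "square_integrable (line_op i0 (density_kernel i0) (cube_part i0))"
    "square_integrable (line_op i1 (step_kernel i1) (line_op i0 (density_kernel i0) (cube_part i0)))"
    by (auto intro!: square_integrable_line_op square_integrable_cube_part)
qed

lemma square_integrable_potential: "square_integrable (potential k)"
proof (cases "k = i1")
  case True
  then show ?thesis unfolding potential_def[abs_def] using square_integrable_diff[OF square_integrable_line_ops(1,3)] by simp
next
  case False
  then show ?thesis unfolding potential_def[abs_def] using square_integrable_line_ops(1) by simp
qed

lemma potential_measurable [measurable]: "potential k \<in> borel_measurable borel"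
  using square_integrable_potential by (simp add: square_integrable_def)

text \<open>All operators are moved from the field to the test function.\<close>
lemma integral_potential:
  assumes \<phi>: "smooth \<phi>" and "k \<noteq> i0" "i1 \<noteq> i0"
  shows "(LINT x|lborel. potential k x * commutator \<phi> k x) =
    (LINT y|lborel. cube_part k y * (partial_deriv k (pulled_test \<phi>) y - cutoff y * partial_deriv k \<phi> y))
    + (if k = i1 then LINT y|lborel. cube_part i0 y * (partial_deriv i0 (pulled_test \<phi>) y - cutoff y * partial_deriv i0 \<phi> y) else 0)"
proof -
  let ?N = "commutator \<phi> k"
  have N: "cube_supported ?N" by (intro commutator_supported assms)
  have 1: "(LINT x|lborel. line_op i0 (step_kernel i0) (cube_part k) x * ?N x)
    = (LINT y|lborel. cube_part k y * (partial_deriv k (pulled_test \<phi>) y - cutoff y * partial_deriv k \<phi> y))"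
    using line_op_step_adjoint[OF square_integrable_cube_part N] by (simp add: pulled_test_partial_other[OF \<phi> assms(2)])
  show ?thesis
  proof (cases "k = i1")
    case False
    then show ?thesis using 1 by (simp add: potential_def)
  next
    case True
    have "(LINT x|lborel. line_op i1 (step_kernel i1) (line_op i0 (density_kernel i0) (cube_part i0)) x * ?N x)
      = (LINT y|lborel. cube_part i0 y * (of_real (deriv P (y $ i0)) * line_int i0 (-5) 5 (step_adjoint i1 ?N) y))"
      using line_op_step_adjoint[OF square_integrable_line_ops(2) N] line_op_density_adjoint[OF square_integrable_cube_part step_adjoint_cube_supported[OF N]]
      by simp
    also have "\<dots> = (LINT y|lborel. - (cube_part i0 y * (partial_deriv i0 (pulled_test \<phi>) y - cutoff y * partial_deriv i0 \<phi> y)))"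
    proof (rule Bochner_Integration.integral_cong[OF refl])
      fix y
      show "cube_part i0 y * (of_real (deriv P (y $ i0)) * line_int i0 (-5) 5 (step_adjoint i1 ?N) y)
        = - (cube_part i0 y * (partial_deriv i0 (pulled_test \<phi>) y - cutoff y * partial_deriv i0 \<phi> y))"
        using pulled_test_partial_axis[OF \<phi> assms(3), of y] True
        by (cases "y \<in> cube") (auto simp: cube_part_def algebra_simps eq_neg_iff_add_eq_0)
    qed
    also have "\<dots> = - (LINT y|lborel. cube_part i0 y * (partial_deriv i0 (pulled_test \<phi>) y - cutoff y * partial_deriv i0 \<phi> y))"
      by simp
    finally have 2: "(LINT x|lborel. line_op i1 (step_kernel i1) (line_op i0 (density_kernel i0) (cube_part i0)) x * ?N x) = \<dots>" .
    have "(LINT x|lborel. potential k x * ?N x)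
      = (LINT x|lborel. line_op i0 (step_kernel i0) (cube_part k) x * ?N x - line_op i1 (step_kernel i1) (line_op i0 (density_kernel i0) (cube_part i0)) x * ?N x)"
      using True by (simp add: potential_def left_diff_distrib)
    also have "\<dots> = (LINT x|lborel. line_op i0 (step_kernel i0) (cube_part k) x * ?N x)
       - (LINT x|lborel. line_op i1 (step_kernel i1) (line_op i0 (density_kernel i0) (cube_part i0)) x * ?N x)"
      by (intro Bochner_Integration.integral_diff square_integrable_prod_integrable square_integrable_line_ops square_integrable_cube_supported N)
    finally show ?thesis using 1 2 True by simp
  qed
qed

lemma cut_field_weak:
  assumes \<phi>: "smooth \<phi>" and "i1 \<noteq> i0"
  shows "(LINT x|lborel. (\<Sum>j\<in>UNIV. cut_field x $ j * partial_deriv j \<phi> x))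
    = (LINT x|lborel. (\<Sum>j\<in>UNIV. f x $ j * partial_deriv j (pulled_test \<phi>) x))"
proof -
  let ?Y = "\<lambda>j y. partial_deriv j (pulled_test \<phi>) y - cutoff y * partial_deriv j \<phi> y"
  let ?X = "\<lambda>j y. cutoff y * partial_deriv j \<phi> y"
  have X: "cube_supported (?X j)" for j
    by (intro cube_supported_mult2 cutoff_supported smooth_partial_deriv \<phi>)
  have Y: "cube_supported (?Y j)" for j
    by (intro cube_supported_minus cube_supported_partial pulled_test_supported X \<phi>)
  have D: "cube_supported (partial_deriv j (pulled_test \<phi>))" for j
    by (intro cube_supported_partial pulled_test_supported \<phi>)
  have iX: "integrable lborel (\<lambda>x. cube_part j x * ?X j x)" for j
    by (intro square_integrable_prod_integrable square_integrable_cube_part square_integrable_cube_supported X)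
  have iY: "integrable lborel (\<lambda>x. cube_part j x * ?Y j x)" for j
    by (intro square_integrable_prod_integrable square_integrable_cube_part square_integrable_cube_supported Y)
  have iD: "integrable lborel (\<lambda>x. cube_part j x * partial_deriv j (pulled_test \<phi>) x)" for j
    by (intro square_integrable_prod_integrable square_integrable_cube_part square_integrable_cube_supported D)
  have iA: "integrable lborel (\<lambda>x. potential k x * commutator \<phi> k x)" if "k \<noteq> i0" for k
    by (intro square_integrable_prod_integrable square_integrable_potential square_integrable_cube_supported commutator_supported \<phi> that)
  have "(\<Sum>j\<in>UNIV. cut_field x $ j * partial_deriv j \<phi> x)
    = (\<Sum>j\<in>UNIV. cube_part j x * ?X j x) + (\<Sum>k\<in>UNIV - {i0}. potential k x * commutator \<phi> k x)" for x
  proof -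
    have c: "cutoff x * f x $ j = cube_part j x * cutoff x" for j
      using cutoff_supported by (cases "x \<in> cube") (auto simp: cube_part_def cube_supported_def)
    have "(\<Sum>j\<in>UNIV. cut_field x $ j * partial_deriv j \<phi> x)
      = (\<Sum>j\<in>UNIV. cube_part j x * ?X j x) + (\<Sum>j\<in>UNIV. (if j = i0 then - (\<Sum>k\<in>UNIV - {i0}. partial_deriv k cutoff x * potential k x)
       else partial_deriv i0 cutoff x * potential j x) * partial_deriv j \<phi> x)"
      by (simp add: cut_field_def c distrib_right sum.distrib mult.assoc)
    also have "(\<Sum>j\<in>UNIV. (if j = i0 then - (\<Sum>k\<in>UNIV - {i0}. partial_deriv k cutoff x * potential k x)
       else partial_deriv i0 cutoff x * potential j x) * partial_deriv j \<phi> x)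
       = - (\<Sum>k\<in>UNIV - {i0}. partial_deriv k cutoff x * potential k x) * partial_deriv i0 \<phi> x
        + (\<Sum>j\<in>UNIV - {i0}. partial_deriv i0 cutoff x * potential j x * partial_deriv j \<phi> x)"
      by (subst sum.remove[of UNIV i0]) auto
    also have "\<dots> = (\<Sum>k\<in>UNIV - {i0}. potential k x * commutator \<phi> k x)"
      by (simp add: commutator_def sum_distrib_right sum_distrib_left sum_negf sum_subtractf algebra_simps)
    finally show ?thesis .
  qed
  then have "(LINT x|lborel. (\<Sum>j\<in>UNIV. cut_field x $ j * partial_deriv j \<phi> x))
    = (LINT x|lborel. (\<Sum>j\<in>UNIV. cube_part j x * ?X j x) + (\<Sum>k\<in>UNIV - {i0}. potential k x * commutator \<phi> k x))"
    by simp
  also have "\<dots> = (\<Sum>j\<in>UNIV. LINT x|lborel. cube_part j x * ?X j x)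
      + (\<Sum>k\<in>UNIV - {i0}. LINT x|lborel. potential k x * commutator \<phi> k x)"
    using iX iA by (subst Bochner_Integration.integral_add) (auto intro!: Bochner_Integration.integrable_sum)
  also have "(\<Sum>k\<in>UNIV - {i0}. LINT x|lborel. potential k x * commutator \<phi> k x)
     = (\<Sum>k\<in>UNIV - {i0}. LINT x|lborel. cube_part k x * ?Y k x)
      + (\<Sum>k\<in>UNIV - {i0}. if k = i1 then LINT x|lborel. cube_part i0 x * ?Y i0 x else 0)"
    by (simp add: integral_potential[OF \<phi> _ assms(2)] sum.distrib)
  also have "(\<Sum>k\<in>UNIV - {i0}. if k = i1 then LINT x|lborel. cube_part i0 x * ?Y i0 x else 0)
     = (LINT x|lborel. cube_part i0 x * ?Y i0 x)"
    using assms(2) by simp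
  also have "(\<Sum>k\<in>UNIV - {i0}. LINT x|lborel. cube_part k x * ?Y k x) + (LINT x|lborel. cube_part i0 x * ?Y i0 x)
     = (\<Sum>k\<in>UNIV. LINT x|lborel. cube_part k x * ?Y k x)"
    by (subst sum.remove[of UNIV i0]) auto
  also have "(\<Sum>j\<in>UNIV. LINT x|lborel. cube_part j x * ?X j x) + (\<Sum>k\<in>UNIV. LINT x|lborel. cube_part k x * ?Y k x)
     = (\<Sum>j\<in>UNIV. (LINT x|lborel. cube_part j x * ?X j x + cube_part j x * ?Y j x))"
    by (simp only: Bochner_Integration.integral_add[OF iX iY] sum.distrib)
  also have "\<dots> = (\<Sum>j\<in>UNIV. (LINT x|lborel. cube_part j x * partial_deriv j (pulled_test \<phi>) x))"
    by (simp add: algebra_simps)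
  also have "\<dots> = (LINT x|lborel. (\<Sum>j\<in>UNIV. cube_part j x * partial_deriv j (pulled_test \<phi>) x))"
    using iD by (subst Bochner_Integration.integral_sum) auto
  also have "\<dots> = (LINT x|lborel. (\<Sum>j\<in>UNIV. f x $ j * partial_deriv j (pulled_test \<phi>) x))"
  proof (intro Bochner_Integration.integral_cong[OF refl] sum.cong refl)
    fix x j
    show "cube_part j x * partial_deriv j (pulled_test \<phi>) x = f x $ j * partial_deriv j (pulled_test \<phi>) x"
      using D[of j] by (cases "x \<in> cube") (auto simp: cube_part_def cube_supported_def)
  qed
  finally show ?thesis .
qed

lemma cut_field_measurable [measurable]: "cut_field \<in> borel_measurable borel"
proof (rule measurable_vec_components)
  have [measurable]: "cutoff \<in> borel_measurable borel" "partial_deriv k cutoff \<in> borel_measurable borel" for k :: 'd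
    using square_integrable_cube_supported[OF cutoff_supported] square_integrable_cube_supported[OF cube_supported_partial[OF cutoff_supported]]
    by (auto simp: square_integrable_def)
  show "(\<lambda>x. cut_field x $ j) \<in> borel_measurable borel" for j
    unfolding cut_field_def by (cases "j = i0") simp_all
qed

lemma potential_bound:
  assumes c: "c \<ge> 1" "\<And>i :: 'd. bounded_kernel c (step_kernel i)" "\<And>i :: 'd. bounded_kernel c (density_kernel i)"
  shows "(\<integral>\<^sup>+x. ennreal ((norm (potential k x))\<^sup>2) \<partial>lborel) \<le> ennreal (4 * (100 * c\<^sup>2)\<^sup>2) * energy cube f"
proof -
  let ?q = "100 * c\<^sup>2" and ?n = "\<lambda>g. \<integral>\<^sup>+x. ennreal ((norm (g x :: complex))\<^sup>2) \<partial>(lborel :: (real^'d) measure)"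
  let ?a = "line_op i0 (step_kernel i0) (cube_part k)" and ?b = "line_op i0 (density_kernel i0) (cube_part i0)"
  let ?d = "line_op i1 (step_kernel i1) ?b"
  have [measurable]: "?a \<in> borel_measurable borel" "?b \<in> borel_measurable borel" "?d \<in> borel_measurable borel"
    using square_integrable_line_ops by (auto simp: square_integrable_def)
  have "c\<^sup>2 \<ge> 1" using c by simp
  then have q: "?q \<ge> 1" by simp
  then have qq: "?q \<le> ?q\<^sup>2" by (rule self_le_power) simp
  have a: "?n ?a \<le> ennreal (?q\<^sup>2) * energy cube f"
  proof -
    have "?n ?a \<le> ennreal ?q * ?n (cube_part k)" by (rule line_op_bound[OF _ c(2)]) simp
    also have "\<dots> \<le> ennreal (?q\<^sup>2) * energy cube f"
      using qq by (intro mult_mono ennreal_leI cube_part_bound) auto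
    finally show ?thesis .
  qed
  have d: "?n ?d \<le> ennreal (?q\<^sup>2) * energy cube f"
  proof -
    have "?n ?d \<le> ennreal ?q * ?n ?b" by (rule line_op_bound[OF _ c(2)]) simp
    also have "\<dots> \<le> ennreal ?q * (ennreal ?q * ?n (cube_part i0))"
      by (intro mult_left_mono line_op_bound[OF _ c(3)]) auto
    also have "\<dots> \<le> ennreal ?q * (ennreal ?q * energy cube f)"
      by (intro mult_left_mono cube_part_bound) auto
    also have "\<dots> = (ennreal ?q * ennreal ?q) * energy cube f" by (rule mult.assoc[symmetric])
    also have "ennreal ?q * ennreal ?q = ennreal (?q\<^sup>2)"
      unfolding power2_eq_square[of ?q] by (rule ennreal_mult[symmetric]) auto
    finally show ?thesis .
  qed
  have "?n (potential k) \<le> (\<integral>\<^sup>+x. ennreal 2 * (ennreal ((norm (?a x))\<^sup>2) + ennreal ((norm (?d x))\<^sup>2)) \<partial>lborel)"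
  proof (rule nn_integral_mono)
    fix x
    have "norm (potential k x) \<le> norm (?a x) + norm (?d x)"
      using norm_triangle_ineq4[of "?a x" "?d x"] by (cases "k = i1") (simp_all add: potential_def)
    then have "(norm (potential k x))\<^sup>2 \<le> (norm (?a x) + norm (?d x))\<^sup>2"
      by (intro power_mono) auto
    also have "\<dots> \<le> 2 * ((norm (?a x))\<^sup>2 + (norm (?d x))\<^sup>2)"
      using sum_squares_bound[of "norm (?a x)" "norm (?d x)"] by (simp add: power2_sum)
    finally have "ennreal ((norm (potential k x))\<^sup>2) \<le> ennreal (2 * ((norm (?a x))\<^sup>2 + (norm (?d x))\<^sup>2))"
      by (rule ennreal_leI)
    then show "ennreal ((norm (potential k x))\<^sup>2) \<le> ennreal 2 * (ennreal ((norm (?a x))\<^sup>2) + ennreal ((norm (?d x))\<^sup>2))"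
      by (simp add: ennreal_mult)
  qed
  also have "\<dots> = ennreal 2 * (?n ?a + ?n ?d)" by (simp add: nn_integral_cmult nn_integral_add)
  also have "\<dots> \<le> ennreal 2 * (ennreal (?q\<^sup>2) * energy cube f + ennreal (?q\<^sup>2) * energy cube f)"
    by (intro mult_left_mono add_mono a d) simp
  also have "\<dots> = (ennreal 2 * (ennreal (?q\<^sup>2) + ennreal (?q\<^sup>2))) * energy cube f"
    by (simp add: distrib_right mult.assoc)
  also have "ennreal 2 * (ennreal (?q\<^sup>2) + ennreal (?q\<^sup>2)) = ennreal (4 * ?q\<^sup>2)"
  proof -
    have "ennreal 2 * (ennreal (?q\<^sup>2) + ennreal (?q\<^sup>2)) = ennreal 2 * ennreal (?q\<^sup>2 + ?q\<^sup>2)"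
      by (simp only: ennreal_plus zero_le_power2)
    also have "\<dots> = ennreal (2 * (?q\<^sup>2 + ?q\<^sup>2))" by (rule ennreal_mult[symmetric]) auto
    finally show ?thesis by simp
  qed
  finally show ?thesis .
qed

lemma cut_field_bound:
  assumes c: "c \<ge> 1" "\<And>i :: 'd. bounded_kernel c (step_kernel i)" "\<And>i :: 'd. bounded_kernel c (density_kernel i)"
    and m: "m \<ge> 0" "\<And>y :: real^'d. norm (cutoff y) \<le> m" "\<And>k (y :: real^'d). norm (partial_deriv k cutoff y) \<le> m"
  shows "energy UNIV cut_field
    \<le> ennreal (8 * m\<^sup>2 * (real CARD('d))\<^sup>2 * (1 + 4 * (100 * c\<^sup>2)\<^sup>2)) * energy cube f"
proof -
  let ?q = "4 * (100 * c\<^sup>2)\<^sup>2" and ?n = "real CARD('d)"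
  have pt: "(norm (cut_field x))\<^sup>2 \<le> 8 * m\<^sup>2 * ?n * (\<Sum>j\<in>UNIV. (norm (cube_part j x))\<^sup>2 + (norm (potential j x))\<^sup>2)" for x
  proof -
    have c': "norm (cutoff x * f x $ j) \<le> m * norm (cube_part j x)" for j
      using cutoff_supported m by (cases "x \<in> cube")
        (auto simp: cube_part_def cube_supported_def norm_mult intro!: mult_right_mono)
    let ?S = "\<Sum>k\<in>UNIV. m * norm (potential k x)"
    have s: "norm (\<Sum>k\<in>UNIV - {i0}. partial_deriv k cutoff x * potential k x) \<le> ?S"
    proof -
      have "norm (\<Sum>k\<in>UNIV - {i0}. partial_deriv k cutoff x * potential k x)
        \<le> (\<Sum>k\<in>UNIV - {i0}. m * norm (potential k x))"
        by (intro sum_norm_le) (auto simp: norm_mult intro!: mult_right_mono m)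
      also have "\<dots> \<le> ?S" by (intro sum_mono2) (auto simp: m)
      finally show ?thesis .
    qed
    have nn: "norm (cut_field x $ j) \<le> m * norm (cube_part j x) + (m * norm (potential j x) + (if j = i0 then ?S else 0))" for j
    proof (cases "j = i0")
      case True
      then have "norm (cut_field x $ j) \<le> norm (cutoff x * f x $ j) + norm (\<Sum>k\<in>UNIV - {i0}. partial_deriv k cutoff x * potential k x)"
        using norm_triangle_ineq4[of "cutoff x * f x $ j" "\<Sum>k\<in>UNIV - {i0}. partial_deriv k cutoff x * potential k x"]
        by (simp add: cut_field_def)
      also have "\<dots> \<le> m * norm (cube_part j x) + ?S" by (intro add_mono c' s)
      also have "\<dots> \<le> m * norm (cube_part j x) + (m * norm (potential j x) + (if j = i0 then ?S else 0))"
        using True m by simp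
      finally show ?thesis .
    next
      case False
      then have "norm (cut_field x $ j) \<le> norm (cutoff x * f x $ j) + norm (partial_deriv i0 cutoff x * potential j x)"
        using norm_triangle_ineq[of "cutoff x * f x $ j" "partial_deriv i0 cutoff x * potential j x"]
        by (simp add: cut_field_def)
      also have "\<dots> \<le> m * norm (cube_part j x) + m * norm (potential j x)"
        by (intro add_mono c') (auto simp: norm_mult intro!: mult_right_mono m)
      finally show ?thesis using False by simp
    qed
    have "norm (cut_field x) \<le> (\<Sum>j\<in>UNIV. norm (cut_field x $ j))" by (rule norm_vec_le_sum)
    also have "\<dots> \<le> (\<Sum>j\<in>UNIV. m * norm (cube_part j x) + (m * norm (potential j x) + (if j = i0 then ?S else 0)))"
      by (intro sum_mono nn)
    also have "\<dots> = (\<Sum>j\<in>UNIV. m * norm (cube_part j x)) + 2 * ?S" by (simp add: sum.distrib)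
    also have "\<dots> \<le> 2 * (\<Sum>j\<in>UNIV. m * norm (cube_part j x)) + 2 * ?S"
      using m by (simp add: sum_nonneg)
    also have "\<dots> = 2 * m * (\<Sum>j\<in>UNIV. norm (cube_part j x) + norm (potential j x))"
      by (simp add: sum.distrib sum_distrib_left distrib_left mult.assoc)
    finally have "(norm (cut_field x))\<^sup>2 \<le> (2 * m * (\<Sum>j\<in>UNIV. norm (cube_part j x) + norm (potential j x)))\<^sup>2"
      by (rule power_mono) simp
    also have "\<dots> = 4 * m\<^sup>2 * (\<Sum>j\<in>UNIV. norm (cube_part j x) + norm (potential j x))\<^sup>2"
      by (simp add: power_mult_distrib)
    also have "\<dots> \<le> 4 * m\<^sup>2 * ((\<Sum>j\<in>UNIV. (norm (cube_part j x) + norm (potential j x))\<^sup>2) * CARD('d))"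
      by (intro mult_left_mono sum_squared_le_sum_of_squares) auto
    also have "\<dots> \<le> 4 * m\<^sup>2 * ((\<Sum>j\<in>UNIV. 2 * ((norm (cube_part j x))\<^sup>2 + (norm (potential j x))\<^sup>2)) * CARD('d))"
    proof (intro mult_left_mono mult_right_mono sum_mono)
      show "(norm (cube_part j x) + norm (potential j x))\<^sup>2 \<le> 2 * ((norm (cube_part j x))\<^sup>2 + (norm (potential j x))\<^sup>2)" for j
        using sum_squares_bound[of "norm (cube_part j x)" "norm (potential j x)"] by (simp add: power2_sum)
    qed auto
    also have "\<dots> = 8 * m\<^sup>2 * ?n * (\<Sum>j\<in>UNIV. (norm (cube_part j x))\<^sup>2 + (norm (potential j x))\<^sup>2)"
      unfolding sum_distrib_left[symmetric] by simp
    finally show ?thesis .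
  qed
  have "energy UNIV cut_field = (\<integral>\<^sup>+x. ennreal ((norm (cut_field x))\<^sup>2) \<partial>lborel)"
    by (simp add: energy_def nn_integral_completion)
  also have "\<dots> \<le> (\<integral>\<^sup>+x. ennreal (8 * m\<^sup>2 * ?n) * (\<Sum>j\<in>UNIV. ennreal ((norm (cube_part j x))\<^sup>2) + ennreal ((norm (potential j x))\<^sup>2)) \<partial>lborel)"
  proof (rule nn_integral_mono)
    fix x
    have "ennreal ((norm (cut_field x))\<^sup>2) \<le> ennreal (8 * m\<^sup>2 * ?n * (\<Sum>j\<in>UNIV. (norm (cube_part j x))\<^sup>2 + (norm (potential j x))\<^sup>2))"
      by (rule ennreal_leI[OF pt])
    also have "\<dots> = ennreal (8 * m\<^sup>2 * ?n) * ennreal (\<Sum>j\<in>UNIV. (norm (cube_part j x))\<^sup>2 + (norm (potential j x))\<^sup>2)"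
      by (rule ennreal_mult) (auto intro: sum_nonneg)
    also have "ennreal (\<Sum>j\<in>UNIV. (norm (cube_part j x))\<^sup>2 + (norm (potential j x))\<^sup>2)
       = (\<Sum>j\<in>UNIV. ennreal ((norm (cube_part j x))\<^sup>2) + ennreal ((norm (potential j x))\<^sup>2))"
      by (simp add: sum_ennreal[symmetric])
    finally show "ennreal ((norm (cut_field x))\<^sup>2) \<le>
      ennreal (8 * m\<^sup>2 * ?n) * (\<Sum>j\<in>UNIV. ennreal ((norm (cube_part j x))\<^sup>2) + ennreal ((norm (potential j x))\<^sup>2))" .
  qed
  also have "\<dots> = ennreal (8 * m\<^sup>2 * ?n) * (\<Sum>j\<in>UNIV. (\<integral>\<^sup>+x. ennreal ((norm (cube_part j x))\<^sup>2) \<partial>lborel)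
      + (\<integral>\<^sup>+x. ennreal ((norm (potential j x))\<^sup>2) \<partial>lborel))"
    by (simp add: nn_integral_cmult nn_integral_sum nn_integral_add)
  also have "\<dots> \<le> ennreal (8 * m\<^sup>2 * ?n) * (\<Sum>j\<in>(UNIV :: 'd set). energy cube f + ennreal ?q * energy cube f)"
    by (intro mult_left_mono sum_mono add_mono cube_part_bound potential_bound c) auto
  also have "(\<Sum>j\<in>(UNIV :: 'd set). energy cube f + ennreal ?q * energy cube f)
      = ennreal (?n * (1 + ?q)) * energy cube f"
    by (simp add: ennreal_mult ennreal_of_nat_eq_real_of_nat distrib_right mult.assoc)
  also have "ennreal (8 * m\<^sup>2 * ?n) * (ennreal (?n * (1 + ?q)) * energy cube f)
    = (ennreal (8 * m\<^sup>2 * ?n) * ennreal (?n * (1 + ?q))) * energy cube f" by (rule mult.assoc[symmetric])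
  also have "ennreal (8 * m\<^sup>2 * ?n) * ennreal (?n * (1 + ?q)) = ennreal (8 * m\<^sup>2 * ?n\<^sup>2 * (1 + ?q))"
    by (subst ennreal_mult[symmetric], simp, simp, simp add: power2_eq_square mult_ac)
  finally show ?thesis .
qed

end
end
end

section \<open>Truncation at arbitrary balls\<close>

lemma energy_AE_cong: "AE x in lebesgue. f x = g x \<Longrightarrow> energy A f = energy A g"
  unfolding energy_def by (intro nn_integral_cong_AE) auto

lemma energy_mono: "A \<subseteq> B \<Longrightarrow> energy A f \<le> energy B f"
  unfolding energy_def by (intro nn_integral_mono) (auto split: split_indicator)

text \<open>Fubini's theorem needs Borel measurable fields; changing a field on a null set is harmless.\<close>
lemma ex_borel_version:
  fixes f :: "real^'d::finite \<Rightarrow> 'a::euclidean_space"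
  assumes "f \<in> borel_measurable lebesgue"
  obtains g where "g \<in> borel_measurable borel" "AE x in lebesgue. f x = g x"
proof -
  have "\<exists>g\<in>borel_measurable lborel. (AE x in lborel. f x \<bullet> b = g x)" for b
    using assms by (intro completion_ex_borel_measurable_real) simp
  then obtain g where [measurable]: "\<And>b. g b \<in> borel_measurable borel"
    and g: "\<And>b. AE x in lborel. f x \<bullet> b = g b x" by (auto simp: measurable_lborel1) metis
  have "AE x in lebesgue. \<forall>b\<in>Basis. f x \<bullet> b = g b x"
    using g by (subst AE_finite_all) (auto intro: AE_completion)
  then have "AE x in lebesgue. f x = (\<Sum>b\<in>Basis. g b x *\<^sub>R b)"
    by eventually_elim (metis (no_types, lifting) euclidean_representation sum.cong)
  moreover have "(\<lambda>x. \<Sum>b\<in>Basis. g b x *\<^sub>R b) \<in> borel_measurable borel" by measurable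
  ultimately show thesis using that by blast
qed

lemma smooth_borel: "smooth \<phi> \<Longrightarrow> \<phi> \<in> borel_measurable borel"
  by (intro borel_measurable_continuous_onI smooth_continuous)

lemma borel_lebesgue: "f \<in> borel_measurable borel \<Longrightarrow> f \<in> borel_measurable (lebesgue :: (real^'d::finite) measure)"
  by (simp add: measurable_completion)

lemma L2_sigma_AE_cong:
  assumes f: "f \<in> L2_sigma" and g: "g \<in> borel_measurable lebesgue" and ae: "AE x in lebesgue. f x = g x"
  shows "g \<in> L2_sigma"
proof -
  have "energy UNIV g = energy UNIV f" using energy_AE_cong[OF ae] by simp
  then have "g \<in> L2_fields" using f g by (simp add: L2_sigma_def L2_fields_iff)
  moreover have "(LINT x|lebesgue. (\<Sum>i\<in>UNIV. g x $ i * partial_deriv i \<phi> x)) = 0" if "\<phi> \<in> test_functions" for \<phi>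
  proof -
    have [measurable]: "partial_deriv i \<phi> \<in> borel_measurable lebesgue" for i
      using that by (intro borel_lebesgue smooth_borel smooth_partial_deriv test_function_smooth)
    have [measurable]: "f \<in> borel_measurable lebesgue" "g \<in> borel_measurable lebesgue"
      using f g by (auto simp: L2_sigma_def L2_fields_iff)
    have "(LINT x|lebesgue. (\<Sum>i\<in>UNIV. g x $ i * partial_deriv i \<phi> x))
       = (LINT x|lebesgue. (\<Sum>i\<in>UNIV. f x $ i * partial_deriv i \<phi> x))"
      using ae by (intro integral_cong_AE) auto
    then show ?thesis using f that by (simp add: L2_sigma_def)
  qed
  ultimately show ?thesis by (simp add: L2_sigma_def)
qed

lemma (in smooth_step) ex_bounds:
  obtains m where "m \<ge> 0" "\<And>y :: real^'d::finite. norm (cutoff y) \<le> m"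
    "\<And>k (y :: real^'d). norm (partial_deriv k cutoff y) \<le> m"
proof -
  obtain B0 where B0: "\<And>y :: real^'d. norm (cutoff y) \<le> B0"
    using cube_supported_bounded[OF cutoff_supported] by metis
  have "\<exists>B. \<forall>y :: real^'d. norm (partial_deriv k cutoff y) \<le> B" for k
    using cube_supported_bounded[OF cube_supported_partial[OF cutoff_supported]] by metis
  then obtain B where B: "\<And>k (y :: real^'d). norm (partial_deriv k cutoff y) \<le> B k" by metis
  have nn: "B0 \<ge> 0" "B k \<ge> 0" for k using B0[of 0] B[of k 0] norm_ge_zero order_trans by blast+
  show thesis
  proof (rule that)
    show "0 \<le> B0 + (\<Sum>k\<in>UNIV. B k)" using nn by (simp add: sum_nonneg)
    show "norm (cutoff y) \<le> B0 + (\<Sum>k\<in>UNIV. B k)" for y :: "real^'d"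
      using B0[of y] sum_nonneg[of UNIV B] nn by (simp add: add_increasing2)
    show "norm (partial_deriv k cutoff y) \<le> B0 + (\<Sum>k\<in>UNIV. B k)" for k and y :: "real^'d"
      using B[of k y] member_le_sum[of k UNIV B] nn by (intro add_increasing order_trans[OF B]) auto
  qed
qed

lemma norm_cube_le:
  fixes y :: "real^'d::finite"
  assumes "y \<in> cube" shows "norm y < 3 * real CARD('d)"
proof -
  have "norm y \<le> (\<Sum>i\<in>UNIV. \<bar>y $ i\<bar>)" by (rule norm_le_l1_cart)
  also have "\<dots> \<le> (\<Sum>i\<in>(UNIV :: 'd set). 2)" using assms by (intro sum_mono) (auto simp: cube_def)
  also have "\<dots> < 3 * real CARD('d)" by simp
  finally show ?thesis .
qed

text \<open>Here the dimension enters: the potential needs a second axis.\<close>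
lemma L2_sigma_truncate_unit:
  assumes "CARD('d::finite) \<ge> 2"
  obtains C where "C > 0" "\<And>f :: real^'d \<Rightarrow> complex^'d. f \<in> L2_sigma \<Longrightarrow> \<exists>h\<in>L2_sigma.
     (AE y in lebesgue. (norm y < 1 \<longrightarrow> h y = f y) \<and> (y \<notin> cube \<longrightarrow> h y = 0)) \<and>
     energy UNIV h \<le> ennreal C * energy cube f"
proof -
  obtain P where P: "\<And>k. k_differentiable k P" "\<And>x. x \<le> 0 \<Longrightarrow> P x = 0" "\<And>x. x \<ge> 1 \<Longrightarrow> P x = 1"
    using smooth_step_exists by blast
  interpret smooth_step P by standard (use P in auto)
  obtain i0 i1 :: 'd where i: "i1 \<noteq> i0"
  proof -
    have "\<not> (\<exists>a :: 'd. \<forall>b. b = a)"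
    proof
      assume "\<exists>a :: 'd. \<forall>b. b = a"
      then obtain a :: 'd where "UNIV = {a}" by auto
      then have "CARD('d) = card {a}" by (rule arg_cong)
      then show False using assms by simp
    qed
    then show thesis using that by blast
  qed
  obtain c where c: "c \<ge> 1" "\<And>i :: 'd. bounded_kernel c (step_kernel i)" "\<And>i :: 'd. bounded_kernel c (density_kernel i)"
    using bounded_kernels by metis
  obtain m where m: "m \<ge> 0" "\<And>y :: real^'d. norm (cutoff y) \<le> m" "\<And>k (y :: real^'d). norm (partial_deriv k cutoff y) \<le> m"
    using ex_bounds by blast
  define C where "C = 8 * m\<^sup>2 * (real CARD('d))\<^sup>2 * (1 + 4 * (100 * c\<^sup>2)\<^sup>2) + 1"
  have "C > 0" unfolding C_def by (intro add_nonneg_pos mult_nonneg_nonneg) auto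
  moreover have "\<exists>h\<in>L2_sigma.
     (AE y in lebesgue. (norm y < 1 \<longrightarrow> h y = f y) \<and> (y \<notin> cube \<longrightarrow> h y = 0)) \<and>
     energy UNIV h \<le> ennreal C * energy cube f" if f: "f \<in> L2_sigma" for f :: "real^'d \<Rightarrow> complex^'d"
  proof -
    obtain g where g [measurable]: "g \<in> borel_measurable borel" and ae: "AE x in lebesgue. f x = g x"
      using f ex_borel_version by (auto simp: L2_sigma_def L2_fields_iff)
    have gs: "g \<in> L2_sigma" by (rule L2_sigma_AE_cong[OF f borel_lebesgue[OF g] ae])
    have e: "energy cube g < top"
      using energy_mono[of cube UNIV g] gs by (auto simp: L2_sigma_def L2_fields_iff intro: le_less_trans)
    define h where "h = cut_field i0 i1 g"
    have hm [measurable]: "h \<in> borel_measurable borel" unfolding h_def by (rule cut_field_measurable[OF g e])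
    have "energy UNIV h \<le> ennreal (8 * m\<^sup>2 * (real CARD('d))\<^sup>2 * (1 + 4 * (100 * c\<^sup>2)\<^sup>2)) * energy cube g"
      unfolding h_def by (rule cut_field_bound[OF g e c m])
    also have "\<dots> \<le> ennreal C * energy cube g"
      by (intro mult_right_mono ennreal_leI) (auto simp: C_def)
    finally have he: "energy UNIV h \<le> ennreal C * energy cube g" .
    then have hf: "energy UNIV h < top" using e by (auto intro: le_less_trans simp: ennreal_mult_less_top)
    have "(LINT x|lebesgue. (\<Sum>i\<in>UNIV. h x $ i * partial_deriv i \<phi> x)) = 0" if \<phi>: "\<phi> \<in> test_functions" for \<phi>
    proof -
      have s: "smooth \<phi>" using \<phi> by (rule test_function_smooth)
      let ?\<psi> = "pulled_test i0 \<phi>"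
      have \<psi>: "cube_supported ?\<psi>" by (rule pulled_test_supported[OF s])
      have [measurable]: "partial_deriv i \<phi> \<in> borel_measurable borel" "partial_deriv i ?\<psi> \<in> borel_measurable borel" for i
        using s cube_supported_smooth[OF \<psi>] by (auto intro!: smooth_borel smooth_partial_deriv)
      have "(LINT x|lebesgue. (\<Sum>i\<in>UNIV. h x $ i * partial_deriv i \<phi> x))
        = (LINT x|lborel. (\<Sum>i\<in>UNIV. h x $ i * partial_deriv i \<phi> x))"
        by (rule integral_completion) measurable
      also have "\<dots> = (LINT x|lborel. (\<Sum>i\<in>UNIV. g x $ i * partial_deriv i ?\<psi> x))"
        unfolding h_def by (rule cut_field_weak[OF g e s i])
      also have "\<dots> = (LINT x|lebesgue. (\<Sum>i\<in>UNIV. g x $ i * partial_deriv i ?\<psi> x))"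
        by (rule integral_completion[symmetric]) measurable
      also have "\<dots> = 0" using gs cube_supported_test[OF \<psi>] by (simp add: L2_sigma_def)
      finally show ?thesis .
    qed
    then have hs: "h \<in> L2_sigma" using hf hm by (simp add: L2_sigma_def L2_fields_iff borel_lebesgue)
    have "norm y < 1 \<Longrightarrow> h y = g y" for y
    proof -
      assume y: "norm y < 1"
      have 1: "cutoff z = 1" if "z \<in> ball 0 1" for z :: "real^'d"
        using that component_le_norm_cart[of z] by (intro cutoff_1) (auto intro: order_trans less_imp_le)
      have 0: "partial_deriv k cutoff y = 0" for k
        by (rule partial_deriv_local_const[of "ball 0 1"]) (use y 1 in auto)
      show ?thesis using 1[of y] y by (simp add: h_def cut_field_def 0 vec_eq_iff)
    qed
    moreover have "h y = 0" if "y \<notin> cube" for y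
    proof -
      have "cutoff y = 0" "partial_deriv k cutoff y = 0" for k
        using that cutoff_supported cube_supported_partial[OF cutoff_supported, of k]
        unfolding cube_supported_def by blast+
      then show ?thesis by (simp add: h_def cut_field_def vec_eq_iff)
    qed
    ultimately have "AE y in lebesgue. (norm y < 1 \<longrightarrow> h y = f y) \<and> (y \<notin> cube \<longrightarrow> h y = 0)"
      using ae by auto
    moreover have "energy cube f = energy cube g" by (rule energy_AE_cong[OF ae])
    ultimately show ?thesis using hs he by auto
  qed
  ultimately show thesis by (rule that)
qed

subsection \<open>Scaling\<close>

lemma
  fixes a :: "real^'d::finite" and c :: real
  assumes c: "c > 0"
  shows lebesgue_scale: "lebesgue = density (distr lebesgue lebesgue (\<lambda>y. a + c *\<^sub>R y)) (\<lambda>_. ennreal (c ^ CARD('d)))"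
    and lebesgue_scale_measurable: "(\<lambda>y. a + c *\<^sub>R y) \<in> lebesgue \<rightarrow>\<^sub>M lebesgue"
proof -
  have T: "(\<lambda>x. a + (\<Sum>j\<in>Basis. (c * (x \<bullet> j)) *\<^sub>R j)) = (\<lambda>y. a + c *\<^sub>R y)"
    by (simp add: scaleR_scaleR[symmetric] scaleR_sum_right[symmetric] euclidean_representation del: scaleR_scaleR)
  show "lebesgue = density (distr lebesgue lebesgue (\<lambda>y. a + c *\<^sub>R y)) (\<lambda>_. ennreal (c ^ CARD('d)))"
    using lebesgue_affine_euclidean[of "\<lambda>_. c" a] c by (simp add: T)
  show "(\<lambda>y. a + c *\<^sub>R y) \<in> lebesgue \<rightarrow>\<^sub>M lebesgue"
    using lebesgue_affine_measurable[of "\<lambda>_. c" a] c by (simp add: T)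
qed

lemma nn_integral_scale:
  fixes a :: "real^'d::finite"
  assumes c: "c > 0" and f: "f \<in> borel_measurable lebesgue"
  shows "(\<integral>\<^sup>+x. f x \<partial>lebesgue) = ennreal (c ^ CARD('d)) * (\<integral>\<^sup>+y. f (a + c *\<^sub>R y) \<partial>lebesgue)"
proof -
  note [measurable] = lebesgue_scale_measurable[OF c, of a] f
  have "(\<integral>\<^sup>+x. f x \<partial>lebesgue) = (\<integral>\<^sup>+x. f x \<partial>density (distr lebesgue lebesgue (\<lambda>y. a + c *\<^sub>R y)) (\<lambda>_. ennreal (c ^ CARD('d))))"
    using lebesgue_scale[OF c, of a] by simp
  also have "\<dots> = ennreal (c ^ CARD('d)) * (\<integral>\<^sup>+y. f (a + c *\<^sub>R y) \<partial>lebesgue)"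
    by (simp add: nn_integral_density nn_integral_distr nn_integral_cmult)
  finally show ?thesis .
qed

lemma integral_scale:
  fixes a :: "real^'d::finite" and f :: "real^'d \<Rightarrow> complex"
  assumes c: "c > 0" and f: "f \<in> borel_measurable lebesgue"
  shows "(LINT x|lebesgue. f x) = (c ^ CARD('d)) *\<^sub>R (LINT y|lebesgue. f (a + c *\<^sub>R y))"
proof -
  note [measurable] = lebesgue_scale_measurable[OF c, of a] f
  have "(LINT x|lebesgue. f x) = (LINT x|density (distr lebesgue lebesgue (\<lambda>y. a + c *\<^sub>R y)) (\<lambda>_. ennreal (c ^ CARD('d))). f x)"
    using lebesgue_scale[OF c, of a] by simp
  also have "\<dots> = (LINT x|distr lebesgue lebesgue (\<lambda>y. a + c *\<^sub>R y). (c ^ CARD('d)) *\<^sub>R f x)"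
    using c by (subst integral_density) auto
  also have "\<dots> = (c ^ CARD('d)) *\<^sub>R (LINT y|lebesgue. f (a + c *\<^sub>R y))"
    by (subst integral_distr) auto
  finally show ?thesis .
qed

lemma AE_scale:
  fixes a :: "real^'d::finite"
  assumes c: "c > 0" and "AE x in lebesgue. Q x"
  shows "AE y in lebesgue. Q (a + c *\<^sub>R y)"
proof -
  have "AE x in density (distr lebesgue lebesgue (\<lambda>y. a + c *\<^sub>R y)) (\<lambda>_. ennreal (c ^ CARD('d))). Q x"
    by (simp only: lebesgue_scale[OF c, of a, symmetric] assms(2))
  then have "AE x in distr lebesgue lebesgue (\<lambda>y. a + c *\<^sub>R y). Q x"
    using c by (subst (asm) AE_density) auto
  then show ?thesis by (rule AE_distrD[OF lebesgue_scale_measurable[OF c]])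
qed

lemma energy_scale:
  fixes a :: "real^'d::finite"
  assumes c: "c > 0" and [measurable]: "f \<in> borel_measurable lebesgue" "A \<in> sets lebesgue"
  shows "energy A f = ennreal (c ^ CARD('d)) * energy {y. a + c *\<^sub>R y \<in> A} (\<lambda>y. f (a + c *\<^sub>R y))"
proof -
  have "energy A f = ennreal (c ^ CARD('d)) *
     (\<integral>\<^sup>+y. ennreal ((norm (f (a + c *\<^sub>R y)))\<^sup>2) * indicator A (a + c *\<^sub>R y) \<partial>lebesgue)"
    unfolding energy_def by (rule nn_integral_scale[OF c]) measurable
  then show ?thesis by (simp add: energy_def indicator_def)
qed

lemma L2_sigma_scale:
  fixes a :: "real^'d::finite" and f :: "real^'d \<Rightarrow> complex^'d"
  assumes c: "c > 0" and f: "f \<in> L2_sigma"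
  shows "(\<lambda>y. f (a + c *\<^sub>R y)) \<in> L2_sigma"
proof -
  let ?f = "\<lambda>y. f (a + c *\<^sub>R y)"
  note [measurable] = lebesgue_scale_measurable[OF c, of a]
  have fm [measurable]: "f \<in> borel_measurable lebesgue" and e: "energy UNIV f < top"
    using f by (auto simp: L2_sigma_def L2_fields_iff)
  have m: "?f \<in> borel_measurable lebesgue" by measurable
  have "energy UNIV f = ennreal (c ^ CARD('d)) * energy UNIV ?f"
    using energy_scale[OF c fm, of UNIV a] by simp
  then have "energy UNIV ?f < top"
    using e zero_less_power[OF c, of "CARD('d)"]
    by (auto simp: ennreal_mult_less_top ennreal_eq_0_iff simp del: zero_less_power)
  moreover have "(LINT x|lebesgue. (\<Sum>i\<in>UNIV. ?f x $ i * partial_deriv i \<phi> x)) = 0" if \<phi>: "\<phi> \<in> test_functions" for \<phi>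
  proof -
    define \<psi> where "\<psi> x = \<phi> ((- (1/c) *\<^sub>R a) + (1/c) *\<^sub>R x)" for x
    have s: "smooth \<phi>" using \<phi> by (rule test_function_smooth)
    have \<psi>s: "smooth \<psi>" unfolding \<psi>_def[abs_def] by (rule smooth_affine[OF s])
    have inv: "(- (1/c) *\<^sub>R a) + (1/c) *\<^sub>R (a + c *\<^sub>R y) = y" for y using c by (simp add: algebra_simps)
    have d: "partial_deriv i \<psi> (a + c *\<^sub>R y) = of_real (1/c) * partial_deriv i \<phi> y" for i y
      unfolding \<psi>_def[abs_def] smooth_affine(2)[OF s] inv ..
    have "{x. \<psi> x \<noteq> 0} \<subseteq> (\<lambda>y. a + c *\<^sub>R y) ` closure {x. \<phi> x \<noteq> 0}"
    proof
      fix x assume "x \<in> {x. \<psi> x \<noteq> 0}"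
      then have "(- (1/c) *\<^sub>R a) + (1/c) *\<^sub>R x \<in> closure {x. \<phi> x \<noteq> 0}"
        using closure_subset[of "{x. \<phi> x \<noteq> 0}"] unfolding \<psi>_def by blast
      moreover have "x = a + c *\<^sub>R ((- (1/c) *\<^sub>R a) + (1/c) *\<^sub>R x)" using c by (simp add: algebra_simps)
      ultimately show "x \<in> (\<lambda>y. a + c *\<^sub>R y) ` closure {x. \<phi> x \<noteq> 0}" by blast
    qed
    moreover have "compact ((\<lambda>y. a + c *\<^sub>R y) ` closure {x. \<phi> x \<noteq> 0})"
      using \<phi> by (intro compact_continuous_image) (auto intro!: continuous_intros simp: test_functions_def)
    ultimately have "compact (closure {x. \<psi> x \<noteq> 0})"
      by (meson bounded_subset compact_closure compact_imp_bounded)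
    then have "\<psi> \<in> test_functions" using \<psi>s by (simp add: test_functions_def smooth_def)
    then have "0 = (LINT x|lebesgue. (\<Sum>i\<in>UNIV. f x $ i * partial_deriv i \<psi> x))"
      using f by (simp add: L2_sigma_def)
    also have "\<dots> = (c ^ CARD('d)) *\<^sub>R (LINT y|lebesgue. (\<Sum>i\<in>UNIV. f (a + c *\<^sub>R y) $ i * partial_deriv i \<psi> (a + c *\<^sub>R y)))"
    proof (rule integral_scale[OF c])
      have [measurable]: "partial_deriv i \<psi> \<in> borel_measurable lebesgue" for i
        using \<psi>s by (intro borel_lebesgue smooth_borel smooth_partial_deriv)
      show "(\<lambda>x. \<Sum>i\<in>UNIV. f x $ i * partial_deriv i \<psi> x) \<in> borel_measurable lebesgue" by measurable
    qed
    also have "(\<lambda>y. \<Sum>i\<in>UNIV. f (a + c *\<^sub>R y) $ i * partial_deriv i \<psi> (a + c *\<^sub>R y))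
       = (\<lambda>y. of_real (1/c) * (\<Sum>i\<in>UNIV. ?f y $ i * partial_deriv i \<phi> y))"
      by (simp add: d sum_distrib_left mult_ac)
    finally show ?thesis using c by (simp add: integral_mult_right_zero)
  qed
  ultimately show ?thesis using m by (simp add: L2_sigma_def L2_fields_iff)
qed

text \<open>Truncation with constants that are uniform over all balls: \<open>h\<close> keeps \<open>f\<close> on a smaller concentric ball, vanishes outside the given one, and
is controlled by \<open>f\<close> on the ball alone. Statements are almost everywhere because fields are representatives.\<close>
definition truncatable :: "(real^'d::finite \<Rightarrow> 'a::real_normed_vector) set \<Rightarrow> bool"
  where "truncatable V \<longleftrightarrow> (\<exists>c C. 0 < c \<and> c \<le> 1 \<and> 0 < C \<and> (\<forall>x R. R > 0 \<longrightarrow> (\<forall>f\<in>V. \<exists>h\<in>V.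
     (AE y in lebesgue. (y \<in> ball x (c * R) \<longrightarrow> h y = f y) \<and> (y \<notin> ball x R \<longrightarrow> h y = 0)) \<and>
     energy UNIV h \<le> ennreal C * energy (ball x R) f)))"

text \<open>The cutoff is \<open>1\<close> on the unit ball and the cube lies in the ball of radius \<open>3 d\<close>, which gives the ratio \<open>1/(3 d)\<close> after scaling.\<close>
lemma truncatable_L2_sigma:
  assumes "CARD('d::finite) \<ge> 2"
  shows "truncatable (L2_sigma :: (real^'d \<Rightarrow> complex^'d) set)"
proof -
  obtain C where C: "C > 0" "\<And>f :: real^'d \<Rightarrow> complex^'d. f \<in> L2_sigma \<Longrightarrow> \<exists>h\<in>L2_sigma.
     (AE y in lebesgue. (norm y < 1 \<longrightarrow> h y = f y) \<and> (y \<notin> cube \<longrightarrow> h y = 0)) \<and>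
     energy UNIV h \<le> ennreal C * energy cube f"
    by (rule L2_sigma_truncate_unit[OF assms]) (rule that, assumption+)
  define d where "d = 3 * real CARD('d)"
  have d: "d \<ge> 1" using assms by (simp add: d_def)
  have "\<exists>h\<in>L2_sigma.
     (AE y in lebesgue. (y \<in> ball x (1/d * R) \<longrightarrow> h y = f y) \<and> (y \<notin> ball x R \<longrightarrow> h y = 0)) \<and>
     energy UNIV h \<le> ennreal C * energy (ball x R) f"
    if R: "R > 0" and f: "f \<in> L2_sigma" for x R and f :: "real^'d \<Rightarrow> complex^'d"
  proof -
    define s where "s = R / d"
    have s: "s > 0" using R d by (simp add: s_def)
    let ?f = "\<lambda>y. f (x + s *\<^sub>R y)"
    obtain g where g: "g \<in> L2_sigma" and ae: "AE y in lebesgue. (norm y < 1 \<longrightarrow> g y = ?f y) \<and> (y \<notin> cube \<longrightarrow> g y = 0)"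
      and e: "energy UNIV g \<le> ennreal C * energy cube ?f"
      using C(2)[OF L2_sigma_scale[OF s f]] by blast
    define a where "a = - (1/s) *\<^sub>R x"
    let ?h = "\<lambda>y. g (a + (1/s) *\<^sub>R y)"
    have inv: "x + s *\<^sub>R (a + (1/s) *\<^sub>R y) = y" "a + (1/s) *\<^sub>R (x + s *\<^sub>R y) = y" for y
      using s by (simp_all add: a_def algebra_simps)
    have dist: "dist x y = s * norm (a + (1/s) *\<^sub>R y)" for y
    proof -
      have "y - x = s *\<^sub>R (a + (1/s) *\<^sub>R y)" using inv(1)[of y] by (metis add_diff_cancel_left')
      then have "norm (y - x) = s * norm (a + (1/s) *\<^sub>R y)" using s by (metis abs_of_pos norm_scaleR)
      then show ?thesis by (simp add: dist_norm norm_minus_commute)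
    qed
    have hs: "?h \<in> L2_sigma" using s by (intro L2_sigma_scale g) simp
    have "AE y in lebesgue. (norm (a + (1/s) *\<^sub>R y) < 1 \<longrightarrow> ?h y = ?f (a + (1/s) *\<^sub>R y))
        \<and> (a + (1/s) *\<^sub>R y \<notin> cube \<longrightarrow> ?h y = 0)"
      using AE_scale[OF _ ae, of "1/s" a] s by simp
    then have ae': "AE y in lebesgue. (y \<in> ball x (1/d * R) \<longrightarrow> ?h y = f y) \<and> (y \<notin> ball x R \<longrightarrow> ?h y = 0)"
    proof eventually_elim
      case (elim y)
      have "norm (a + (1/s) *\<^sub>R y) < 1" if "y \<in> ball x (1/d * R)"
      proof -
        have "s * norm (a + (1/s) *\<^sub>R y) < s" using that dist[of y] by (simp add: s_def)
        then show ?thesis using s by simp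
      qed
      moreover have "a + (1/s) *\<^sub>R y \<notin> cube" if "y \<notin> ball x R"
      proof
        assume "a + (1/s) *\<^sub>R y \<in> cube"
        then have "norm (a + (1/s) *\<^sub>R y) < d" using norm_cube_le by (auto simp: d_def)
        then have "dist x y < s * d" using s dist[of y] by simp
        moreover have "s * d = R" using d by (simp add: s_def)
        ultimately show False using that by simp
      qed
      ultimately show ?case using elim inv(1) by auto
    qed
    have gm: "g \<in> borel_measurable lebesgue" "?h \<in> borel_measurable lebesgue" "f \<in> borel_measurable lebesgue"
      using g hs f by (auto simp: L2_sigma_def L2_fields_iff)
    have "energy UNIV ?h = ennreal (s ^ CARD('d)) * energy UNIV g"
      using energy_scale[OF s gm(2), of UNIV x] by (simp add: inv)
    also have "\<dots> \<le> ennreal (s ^ CARD('d)) * (ennreal C * energy cube ?f)"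
      by (intro mult_left_mono e) simp
    also have "\<dots> = ennreal C * (ennreal (s ^ CARD('d)) * energy cube ?f)" by (simp add: mult_ac)
    also have "ennreal (s ^ CARD('d)) * energy cube ?f \<le> ennreal (s ^ CARD('d)) * energy {y. x + s *\<^sub>R y \<in> ball x R} ?f"
    proof (intro mult_left_mono energy_mono subsetI)
      fix y :: "real^'d" assume "y \<in> cube"
      then have "norm y < d" using norm_cube_le by (auto simp: d_def)
      then have "s * norm y < s * d" using s by simp
      moreover have "s * d = R" using d by (simp add: s_def)
      ultimately show "y \<in> {y. x + s *\<^sub>R y \<in> ball x R}" using s by (simp add: dist_norm)
    qed simp
    also have "\<dots> = energy (ball x R) f"
      by (rule energy_scale[OF s gm(3), symmetric]) simp
    finally have "energy UNIV ?h \<le> ennreal C * energy (ball x R) f"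
      by (simp add: mult_left_mono)
    from conjI[OF ae' this] hs show ?thesis by (rule bexI)
  qed
  then show ?thesis
    unfolding truncatable_def using C(1) d by (intro exI[of _ "1/d"] exI[of _ C]) auto
qed

lemma truncatable_L2_fields: "truncatable (L2_fields :: (real^'d::finite \<Rightarrow> 'a::euclidean_space) set)"
  unfolding truncatable_def
proof (intro exI[of _ 1] conjI allI impI ballI)
  fix x :: "real^'d" and R :: real and f :: "real^'d \<Rightarrow> 'a"
  assume f: "f \<in> L2_fields"
  then have [measurable]: "f \<in> borel_measurable lebesgue" by (simp add: L2_fields_iff)
  let ?h = "\<lambda>y. indicator (ball x R) y *\<^sub>R f y"
  have "energy UNIV ?h = energy (ball x R) f"
    unfolding energy_def by (intro nn_integral_cong) (simp split: split_indicator)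
  moreover have "\<dots> \<le> energy UNIV f" by (rule energy_mono) simp
  moreover have "?h \<in> borel_measurable lebesgue"
    by (intro borel_measurable_scaleR borel_measurable_indicator \<open>f \<in> borel_measurable lebesgue\<close>) simp
  ultimately have "?h \<in> L2_fields" using f by (auto simp: L2_fields_iff intro: le_less_trans)
  with \<open>energy UNIV ?h = energy (ball x R) f\<close>
  show "\<exists>h\<in>L2_fields. (AE y in lebesgue. (y \<in> ball x (1 * R) \<longrightarrow> h y = f y) \<and> (y \<notin> ball x R \<longrightarrow> h y = 0)) \<and>
     energy UNIV h \<le> ennreal 1 * energy (ball x R) f"
    by (intro bexI[of _ ?h]) auto
qed auto

section \<open>Lebesgue norms on balls\<close>

lemma ennreal_powr_ennreal: "s \<ge> 0 \<Longrightarrow> ennreal_powr (ennreal s) a = ennreal (s powr a)"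
  by (simp add: ennreal_powr_def)

lemma ennreal_powr_le_iff:
  assumes "a > 0" "K > 0"
  shows "ennreal_powr X a \<le> ennreal K \<longleftrightarrow> X \<le> ennreal (K powr (1/a))"
proof (cases X)
  case (real s)
  have "s powr a \<le> K \<longleftrightarrow> s \<le> K powr (1/a)"
  proof
    assume "s powr a \<le> K"
    then have "(s powr a) powr (1/a) \<le> K powr (1/a)" using assms by (intro powr_mono2) auto
    then show "s \<le> K powr (1/a)" using assms real by (simp add: powr_powr)
  next
    assume "s \<le> K powr (1/a)"
    then have "s powr a \<le> (K powr (1/a)) powr a" using assms real by (intro powr_mono2) auto
    then show "s powr a \<le> K" using assms by (simp add: powr_powr)
  qed
  then show ?thesis using real assms by (simp add: ennreal_powr_ennreal ennreal_le_iff)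
next
  case top
  then show ?thesis by (simp add: ennreal_powr_def top_unique)
qed

lemma Lp_norm_le_iff:
  fixes g :: "'m::euclidean_space \<Rightarrow> 'a::euclidean_space"
  assumes p: "p \<ge> 2" and K: "K > 0" and [measurable]: "A \<in> sets lebesgue" "g \<in> borel_measurable lebesgue"
  shows "Lp_norm p A g \<le> ennreal K \<longleftrightarrow>
    Lp_bounded (lebesgue_on A) (enn2real (1/p)) K (\<lambda>x. norm (g x))"
proof (cases p)
  case (real q)
  have q: "q \<ge> 2" using p real by (metis ennreal_le_iff ennreal_numeral)
  have a: "enn2real (1 / ennreal q) = 1/q"
    using q by (simp add: divide_ennreal[of 1, simplified])
  show ?thesis
    using real q K
    by (simp add: Lp_norm_def a Lp_bounded_def ennreal_powr_le_iff nn_integral_restrict_space)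
next
  case top
  have a: "enn2real (1/p) = 0" using top by simp
  have m: "(\<lambda>x. ennreal (norm (g x))) \<in> borel_measurable (lebesgue_on A)"
    by (intro measurable_restrict_space1) measurable
  have "esssup (lebesgue_on A) (\<lambda>x. ennreal (norm (g x))) \<le> ennreal K
    \<longleftrightarrow> (AE x in lebesgue_on A. ennreal (norm (g x)) \<le> ennreal K)"
    using esssup_I[OF m] esssup_AE[where M="lebesgue_on A" and f="\<lambda>x. ennreal (norm (g x))"]
    by (auto elim!: eventually_mono intro: order_trans)
  then show ?thesis using top K by (simp add: Lp_norm_def a Lp_bounded_def)
qed

lemma le_ennreal_eps:
  assumes "\<And>e. e > 0 \<Longrightarrow> X \<le> ennreal (c * (t + e))" "c > 0" "t \<ge> 0"
  shows "X \<le> ennreal (c * t)"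
proof (rule ennreal_le_epsilon)
  fix e :: real assume "e > 0"
  then have "X \<le> ennreal (c * (t + e/c))" using assms by simp
  also have "c * (t + e/c) = c * t + e" using assms by (simp add: distrib_left)
  also have "ennreal (c * t + e) = ennreal (c * t) + ennreal e" using assms \<open>e > 0\<close> by simp
  finally show "X \<le> ennreal (c * t) + ennreal e" .
qed

text \<open>The slack \<open>e\<close> keeps the real bound positive when \<open>s = 0\<close>.\<close>
lemma Lp_norm_le_sqrt_iff:
  fixes g :: "'m::euclidean_space \<Rightarrow> 'a::euclidean_space"
  assumes p: "p \<ge> 2" and K: "K > 0" and s: "s \<ge> 0"
    and m: "A \<in> sets lebesgue" "g \<in> borel_measurable lebesgue"
  shows "Lp_norm p A g \<le> ennreal K * ennreal_powr (ennreal s) (1/2) \<longleftrightarrow>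
    (\<forall>e>0. Lp_bounded (lebesgue_on A) (enn2real (1/p)) (K * (sqrt s + e)) (\<lambda>x. norm (g x)))"
proof -
  have "ennreal K * ennreal_powr (ennreal s) (1/2) = ennreal (K * sqrt s)"
    using K s by (simp add: ennreal_powr_ennreal powr_half_sqrt ennreal_mult)
  moreover have "Lp_norm p A g \<le> ennreal (K * sqrt s) \<longleftrightarrow> (\<forall>e>0. Lp_norm p A g \<le> ennreal (K * (sqrt s + e)))"
  proof
    assume "Lp_norm p A g \<le> ennreal (K * sqrt s)"
    then show "\<forall>e>0. Lp_norm p A g \<le> ennreal (K * (sqrt s + e))"
      using K by (auto elim!: order_trans intro!: ennreal_leI)
  next
    assume "\<forall>e>0. Lp_norm p A g \<le> ennreal (K * (sqrt s + e))"
    then show "Lp_norm p A g \<le> ennreal (K * sqrt s)"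
      by (intro le_ennreal_eps[of _ K "sqrt s"]) (use K s in auto)
  qed
  moreover have "0 < K * (sqrt s + e)" if "e > 0" for e
    using that K s by (intro mult_pos_pos add_nonneg_pos) auto
  ultimately show ?thesis using Lp_norm_le_iff[OF p _ m] by auto
qed

lemma Lp_bounded_restrict:
  assumes "Lp_bounded M a K g" "A \<in> sets M"
  shows "Lp_bounded (restrict_space M A) a K g"
proof (cases "a = 0")
  case True
  with assms have "AE x in M. g x \<le> K" by (simp add: Lp_bounded_def)
  then have "AE x in restrict_space M A. g x \<le> K"
    using assms(2) by (subst AE_restrict_space_iff) auto
  then show ?thesis using True by (simp add: Lp_bounded_def)
next
  case False
  have "(\<integral>\<^sup>+x. ennreal (g x powr (1/a)) \<partial>restrict_space M A) \<le> (\<integral>\<^sup>+x. ennreal (g x powr (1/a)) \<partial>M)"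
    using assms(2) by (subst nn_integral_restrict_space) (auto intro!: nn_integral_mono split: split_indicator)
  then show ?thesis using assms(1) False by (auto simp: Lp_bounded_def)
qed

text \<open>On a space of finite measure the norms are ordered; this is Hoelder's inequality with the constant function \<open>1\<close>.\<close>
lemma Lp_bounded_raise:
  assumes "Lp_bounded M a K g" "0 \<le> a" "a \<le> b" "K > 0" "emeasure M (space M) = ennreal v" "v > 0"
    "\<And>x. g x \<ge> 0" "g \<in> borel_measurable M"
  shows "Lp_bounded M b (v powr (b - a) * K) g"
proof (cases "a = b")
  case True
  then show ?thesis using assms by simp
next
  case False
  have "Lp_bounded M (b - a) (v powr (b - a)) (\<lambda>x. 1)"
    using False assms by (simp add: Lp_bounded_def powr_powr)
  then have "Lp_bounded M ((b - a) + a) (v powr (b - a) * K) (\<lambda>x. 1 * g x)"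
    using assms by (intro Lp_bounded_mult) auto
  then show ?thesis by simp
qed

section \<open>Dyadic annuli\<close>

lemma annulus_borel [measurable]: "annulus x r n \<in> sets borel"
  by (cases n) auto

lemma annulus_subset_ball: "annulus x r n \<subseteq> ball x (2 ^ n * r)"
  by (cases n) auto

lemma annulus_disjoint: "r > 0 \<Longrightarrow> disjoint_family (annulus x r)"
proof (unfold disjoint_family_on_def, intro ballI impI)
  fix m n :: nat assume r: "r > 0" and "m \<noteq> n"
  have *: "annulus x r i \<inter> annulus x r j = {}" if ij: "i < j" for i j
  proof -
    obtain k where k: "j = Suc k" "i \<le> k" using ij by (cases j) auto
    have "2 ^ i * r \<le> 2 ^ k * r" using k r by (intro mult_right_mono power_increasing) auto
    then have "ball x (2 ^ i * r) \<subseteq> ball x (2 ^ k * r)" by (rule subset_ball)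
    then have "annulus x r i \<subseteq> closure (ball x (2 ^ k * r))"
      using annulus_subset_ball[of x r i] closure_subset by blast
    then show ?thesis using k by auto
  qed
  then show "annulus x r m \<inter> annulus x r n = {}"
    using \<open>m \<noteq> n\<close> by (metis inf_commute linorder_neqE_nat)
qed

text \<open>Only the spheres between consecutive annuli are missed.\<close>
lemma AE_annuli_cover:
  fixes x :: "'m::euclidean_space"
  assumes r: "r > 0"
  shows "AE y in lebesgue. \<forall>n. y \<in> ball x (2 ^ n * r) \<longrightarrow> (\<exists>j\<le>n. y \<in> annulus x r j)"
proof -
  have "AE y in lebesgue. y \<notin> sphere x (2 ^ n * r)" for n
    using negligible_sphere[of x] by (intro AE_not_in) (simp add: negligible_iff_null_sets)
  then have "AE y in lebesgue. \<forall>n. y \<notin> sphere x (2 ^ n * r)" by (subst AE_all_countable) blast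
  then show ?thesis
  proof (eventually_elim, intro allI impI)
    fix y n assume s: "\<forall>n. y \<notin> sphere x (2 ^ n * r)" and y: "y \<in> ball x (2 ^ n * r)"
    show "\<exists>j\<le>n. y \<in> annulus x r j"
      using y
    proof (induction n)
      case 0
      then show ?case by (intro exI[of _ 0]) simp
    next
      case (Suc n)
      show ?case
      proof (cases "y \<in> ball x (2 ^ n * r)")
        case True
        from Suc.IH[OF this] show ?thesis using le_SucI by blast
      next
        case False
        moreover have "dist x y \<noteq> 2 ^ n * r" using s by simp
        ultimately have "y \<notin> closure (ball x (2 ^ n * r))" using r by (simp add: closure_ball)
        then have "y \<in> annulus x r (Suc n)" using Suc.prems by simp
        then show ?thesis by blast
      qed
    qed
  qed
qed

lemma energy_annuli:
  fixes f :: "real^'d::finite \<Rightarrow> 'a::euclidean_space"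
  assumes r: "r > 0" and [measurable]: "f \<in> borel_measurable lebesgue"
  shows "(\<Sum>n. energy (annulus x r n) f) = energy UNIV f"
    and "energy (ball x (2 ^ n * r)) f \<le> (\<Sum>j\<le>n. energy (annulus x r j) f)"
proof -
  have m [measurable]: "annulus x r n \<in> sets lebesgue" for n by simp
  have "(\<Sum>n. energy (annulus x r n) f)
      = (\<integral>\<^sup>+y. (\<Sum>n. ennreal ((norm (f y))\<^sup>2) * indicator (annulus x r n) y) \<partial>lebesgue)"
    unfolding energy_def by (rule nn_integral_suminf[symmetric]) measurable
  also have "\<dots> = (\<integral>\<^sup>+y. ennreal ((norm (f y))\<^sup>2) * indicator (\<Union>n. annulus x r n) y \<partial>lebesgue)"
    using annulus_disjoint[OF r, of x] by (simp add: suminf_indicator)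
  also have "\<dots> = energy UNIV f"
    unfolding energy_def
  proof (rule nn_integral_cong_AE, use AE_annuli_cover[OF r, of x] in eventually_elim)
    fix y assume c: "\<forall>n. y \<in> ball x (2 ^ n * r) \<longrightarrow> (\<exists>j\<le>n. y \<in> annulus x r j)"
    obtain n :: nat where "dist x y / r < 2 ^ n"
      using real_arch_pow[of 2 "dist x y / r"] by auto
    then have "y \<in> ball x (2 ^ n * r)" using r by (simp add: field_simps)
    with c have "y \<in> (\<Union>n. annulus x r n)" by auto
    then show "ennreal ((norm (f y))\<^sup>2) * indicator (\<Union>n. annulus x r n) y = ennreal ((norm (f y))\<^sup>2) * indicator UNIV y"
      by simp
  qed
  finally show "(\<Sum>n. energy (annulus x r n) f) = energy UNIV f" .
  have "energy (ball x (2 ^ n * r)) f \<le> (\<integral>\<^sup>+y. (\<Sum>j\<le>n. ennreal ((norm (f y))\<^sup>2) * indicator (annulus x r j) y) \<partial>lebesgue)"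
    unfolding energy_def
  proof (rule nn_integral_mono_AE, use AE_annuli_cover[OF r, of x] in eventually_elim)
    fix y assume c: "\<forall>n. y \<in> ball x (2 ^ n * r) \<longrightarrow> (\<exists>j\<le>n. y \<in> annulus x r j)"
    show "ennreal ((norm (f y))\<^sup>2) * indicator (ball x (2 ^ n * r)) y
      \<le> (\<Sum>j\<le>n. ennreal ((norm (f y))\<^sup>2) * indicator (annulus x r j) y)"
    proof (cases "y \<in> ball x (2 ^ n * r)")
      case True
      then obtain j where j: "j \<le> n" "y \<in> annulus x r j" using c by blast
      have "ennreal ((norm (f y))\<^sup>2) * indicator (annulus x r j) y
        \<le> (\<Sum>j\<le>n. ennreal ((norm (f y))\<^sup>2) * indicator (annulus x r j) y)"
        using j by (intro member_le_sum) auto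
      then show ?thesis using j True by simp
    qed simp
  qed
  also have "\<dots> = (\<Sum>j\<le>n. energy (annulus x r j) f)"
    unfolding energy_def by (rule nn_integral_sum) measurable
  finally show "energy (ball x (2 ^ n * r)) f \<le> (\<Sum>j\<le>n. energy (annulus x r j) f)" .
qed

text \<open>The square of the weighted norm on the right-hand side of a decay estimate of order \<open>\<nu>\<close>.\<close>
definition weighted_energy :: "real \<Rightarrow> real^'d::finite \<Rightarrow> real \<Rightarrow> (real^'d \<Rightarrow> 'a::real_normed_vector) \<Rightarrow> ennreal"
  where "weighted_energy \<nu> x r f = (\<Sum>n. ennreal (2 powr (- \<nu> * real n)) * energy (annulus x r n) f)"

lemma Lp_norm_2_square: "(Lp_norm 2 A f)\<^sup>2 = energy A f"
proof (cases "energy A f")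
  case (real s)
  then show ?thesis
    by (simp add: Lp_norm_2 ennreal_powr_ennreal powr_half_sqrt ennreal_power)
qed (simp add: Lp_norm_2 ennreal_powr_def)

lemma weighted_energy_antimono: "\<nu> \<le> \<nu>' \<Longrightarrow> weighted_energy \<nu>' x r f \<le> weighted_energy \<nu> x r f"
  unfolding weighted_energy_def
  by (intro suminf_le mult_right_mono ennreal_leI powr_mono) (auto intro: mult_right_mono)

text \<open>A field that vanishes on \<open>B\<^sub>k\<close> sees only weights of index at least \<open>k\<close>.\<close>
lemma weighted_energy_far:
  fixes f :: "real^'d::finite \<Rightarrow> 'a::euclidean_space"
  assumes r: "r > 0" and f [measurable]: "f \<in> borel_measurable lebesgue" and "\<nu> \<ge> 0"
    and far: "k = 0 \<or> (AE y in lebesgue. y \<in> ball x (2 ^ k * r) \<longrightarrow> f y = 0)"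
  shows "weighted_energy \<nu> x r f \<le> ennreal (2 powr (- \<nu> * real k)) * energy UNIV f"
proof -
  have "ennreal (2 powr (- \<nu> * real n)) * energy (annulus x r n) f
    \<le> ennreal (2 powr (- \<nu> * real k)) * energy (annulus x r n) f" for n
  proof (cases "k \<le> n")
    case True
    then show ?thesis
      using assms by (intro mult_right_mono ennreal_leI powr_mono) (auto intro: mult_left_mono)
  next
    case False
    then have ae: "AE y in lebesgue. y \<in> ball x (2 ^ k * r) \<longrightarrow> f y = 0" using far by simp
    have "2 ^ n * r \<le> 2 ^ k * r" using False r by (intro mult_right_mono power_increasing) auto
    then have "annulus x r n \<subseteq> ball x (2 ^ k * r)"
      using annulus_subset_ball[of x r n] subset_ball by blast
    with ae have "AE y in lebesgue. ennreal ((norm (f y))\<^sup>2) * indicator (annulus x r n) y = 0"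
      by (auto elim!: eventually_mono split: split_indicator)
    then have "energy (annulus x r n) f = (\<integral>\<^sup>+y. 0 \<partial>(lebesgue :: (real^'d) measure))"
      unfolding energy_def by (rule nn_integral_cong_AE)
    then have "energy (annulus x r n) f = 0" by simp
    then show ?thesis by simp
  qed
  then have "weighted_energy \<nu> x r f \<le> (\<Sum>n. ennreal (2 powr (- \<nu> * real k)) * energy (annulus x r n) f)"
    unfolding weighted_energy_def by (intro suminf_le) auto
  also have "\<dots> = ennreal (2 powr (- \<nu> * real k)) * energy UNIV f"
    by (simp add: energy_annuli(1)[OF r f])
  finally show ?thesis .
qed

lemma weighted_energy_finite:
  fixes f :: "real^'d::finite \<Rightarrow> 'a::euclidean_space"
  assumes "r > 0" "f \<in> L2_fields" "\<nu> \<ge> 0"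
  shows "weighted_energy \<nu> x r f < top"
  using weighted_energy_far[of r f \<nu> 0 x] assms by (auto simp: L2_fields_iff intro: le_less_trans)

text \<open>Exchange of summations: the annulus \<open>C\<^sub>j\<close> is counted once for every ball \<open>B\<^sub>n\<close> with \<open>n \<ge> j\<close>, and the weights of these
balls form a geometric series.\<close>
lemma ball_weighted_sum:
  fixes f :: "real^'d::finite \<Rightarrow> 'a::euclidean_space"
  assumes r: "r > 0" and f: "f \<in> L2_fields" and \<nu>: "\<nu> > 0"
  shows "(\<Sum>n<L. 2 powr (- \<nu> * real n) * enn2real (energy (ball x (2 ^ n * r)) f))
    \<le> 1 / (1 - 2 powr (- \<nu>)) * enn2real (weighted_energy \<nu> x r f)"
proof -
  have fm: "f \<in> borel_measurable lebesgue" using f by (simp add: L2_fields_iff)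
  have fin: "energy A f < top" for A
    using energy_mono[of A UNIV f] f by (auto simp: L2_fields_iff intro: le_less_trans)
  define a where "a j = enn2real (energy (annulus x r j) f)" for j
  define q where "q = 2 powr (- \<nu>)"
  have q: "0 < q" "q < 1" using \<nu> by (auto simp: q_def powr_less_one)
  have qn: "2 powr (- \<nu> * real n) = q ^ n" for n by (simp add: q_def powr_powr powr_realpow[symmetric])
  have b: "enn2real (energy (ball x (2 ^ n * r)) f) \<le> (\<Sum>j\<le>n. a j)" for n
  proof -
    have "(\<Sum>j\<le>n. energy (annulus x r j) f) = ennreal (\<Sum>j\<le>n. a j)"
      using fin by (simp add: a_def sum_ennreal[symmetric])
    then show ?thesis
      using energy_annuli(2)[OF r fm, of x n] by (intro enn2real_leI) (auto simp: a_def sum_nonneg)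
  qed
  have "(\<Sum>n<L. q ^ n * enn2real (energy (ball x (2 ^ n * r)) f)) \<le> (\<Sum>n<L. q ^ n * (\<Sum>j\<le>n. a j))"
    using q by (intro sum_mono mult_left_mono b) auto
  also have "\<dots> = (\<Sum>n<L. \<Sum>j<Suc n. q ^ n * a j)" by (simp add: sum_distrib_left lessThan_Suc_atMost)
  also have "\<dots> = (\<Sum>j<L. \<Sum>n\<in>{j..<L}. q ^ n * a j)"
    by (subst sum.Sigma, simp, simp, subst sum.Sigma, simp, simp)
      (rule sum.reindex_bij_witness[of _ "\<lambda>(j, n). (n, j)" "\<lambda>(n, j). (j, n)"], auto)
  also have "\<dots> \<le> (\<Sum>j<L. 1 / (1 - q) * (q ^ j * a j))"
  proof (rule sum_mono)
    fix j
    have "(\<Sum>n\<in>{j..<L}. q ^ n) \<le> q ^ j * (1 / (1 - q))"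
    proof -
      have "(\<Sum>n\<in>{j..<L}. q ^ n) = (\<Sum>n\<in>{..<L - j}. q ^ j * q ^ n)"
        by (rule sum.reindex_bij_witness[of _ "\<lambda>n. n + j" "\<lambda>n. n - j"]) (auto simp: power_add[symmetric])
      also have "\<dots> = q ^ j * (\<Sum>n<L - j. q ^ n)" by (simp add: sum_distrib_left)
      also have "\<dots> \<le> q ^ j * (1 / (1 - q))"
        using q by (subst suminf_geometric[symmetric])
          (auto intro!: mult_left_mono sum_le_suminf summable_geometric)
      finally show ?thesis .
    qed
    then have "(\<Sum>n\<in>{j..<L}. q ^ n) * a j \<le> (q ^ j * (1 / (1 - q))) * a j"
      by (rule mult_right_mono) (simp add: a_def)
    then show "(\<Sum>n\<in>{j..<L}. q ^ n * a j) \<le> 1 / (1 - q) * (q ^ j * a j)"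
      by (simp add: sum_distrib_right)
  qed
  also have "\<dots> = 1 / (1 - q) * (\<Sum>j<L. q ^ j * a j)" by (simp add: sum_distrib_left)
  also have "\<dots> \<le> 1 / (1 - q) * enn2real (weighted_energy \<nu> x r f)"
  proof (rule mult_left_mono)
    have "ennreal (\<Sum>j<L. q ^ j * a j) = (\<Sum>j<L. ennreal (2 powr (- \<nu> * real j)) * energy (annulus x r j) f)"
      using fin q
      by (simp add: sum_ennreal[symmetric] qn[simplified] a_def ennreal_mult)
    also have "\<dots> \<le> weighted_energy \<nu> x r f" unfolding weighted_energy_def by (intro sum_le_suminf) auto
    finally have "ennreal (\<Sum>j<L. q ^ j * a j) \<le> weighted_energy \<nu> x r f" .
    moreover have "weighted_energy \<nu> x r f = ennreal (enn2real (weighted_energy \<nu> x r f))"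
      using weighted_energy_finite[OF r f, of \<nu> x] \<nu> by simp
    ultimately show "(\<Sum>j<L. q ^ j * a j) \<le> enn2real (weighted_energy \<nu> x r f)"
      by (metis enn2real_nonneg ennreal_le_iff)
  qed (use q in simp)
  finally show ?thesis by (simp only: qn q_def[symmetric])
qed

section \<open>Interpolation through dyadic pieces\<close>

lemma energy_diff_le:
  fixes f g :: "real^'d::finite \<Rightarrow> 'a::euclidean_space"
  assumes [measurable]: "f \<in> borel_measurable lebesgue" "g \<in> borel_measurable lebesgue"
  shows "energy UNIV (\<lambda>y. f y - g y) \<le> ennreal 2 * (energy UNIV f + energy UNIV g)"
proof -
  have "energy UNIV (\<lambda>y. f y - g y)
    \<le> (\<integral>\<^sup>+y. ennreal 2 * (ennreal ((norm (f y))\<^sup>2) + ennreal ((norm (g y))\<^sup>2)) \<partial>lebesgue)"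
    unfolding energy_def
    by (intro nn_integral_mono) (simp only: indicator_UNIV mult_1_right norm_diff_square_le)
  also have "\<dots> = ennreal 2 * (energy UNIV f + energy UNIV g)"
    by (simp add: nn_integral_cmult nn_integral_add energy_def)
  finally show ?thesis .
qed

lemma L2_fields_diff:
  fixes f g :: "real^'d::finite \<Rightarrow> 'a::euclidean_space"
  assumes "f \<in> L2_fields" "g \<in> L2_fields" shows "(\<lambda>y. f y - g y) \<in> L2_fields"
  using assms energy_diff_le[of f g]
  by (auto simp: L2_fields_iff ennreal_mult_less_top ennreal_add_less_top intro: le_less_trans)

text \<open>The derivative of a test function is bounded with compact support, so the divergence condition is linear in the field.\<close>
lemma L2_test_integrable:
  fixes f :: "real^'d::finite \<Rightarrow> complex^'d"
  assumes f: "f \<in> L2_fields" and \<phi>: "\<phi> \<in> test_functions"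
  shows "integrable lebesgue (\<lambda>x. f x $ i * partial_deriv i \<phi> x)"
proof (rule integrableI_bounded)
  let ?K = "closure {x. \<phi> x \<noteq> 0}" and ?\<psi> = "partial_deriv i \<phi>"
  have K: "compact ?K" using \<phi> by (simp add: test_functions_def)
  have \<psi>: "smooth ?\<psi>" using \<phi> by (intro smooth_partial_deriv test_function_smooth)
  have off: "?\<psi> x = 0" if "x \<notin> ?K" for x
    by (rule partial_deriv_local[of "- ?K"]) (use that closure_subset[of "{x. \<phi> x \<noteq> 0}"] in auto)
  have [measurable]: "f \<in> borel_measurable lebesgue" "?\<psi> \<in> borel_measurable lebesgue"
    using f \<psi> by (auto simp: L2_fields_iff intro: borel_lebesgue smooth_borel)
  have [measurable]: "?K \<in> sets lebesgue" by simp
  show "(\<lambda>x. f x $ i * ?\<psi> x) \<in> borel_measurable lebesgue" by measurable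
  have "compact (?\<psi> ` ?K)" by (rule compact_continuous_image[OF smooth_continuous[OF \<psi>] K])
  then obtain B where B: "\<And>y. y \<in> ?K \<Longrightarrow> norm (?\<psi> y) \<le> B" and "B > 0"
    using compact_imp_bounded bounded_pos by (metis (no_types, lifting) imageI)
  have "(\<integral>\<^sup>+x. ennreal (norm (f x $ i * ?\<psi> x)) \<partial>lebesgue)
    \<le> (\<integral>\<^sup>+x. ennreal ((norm (f x))\<^sup>2) + ennreal (B\<^sup>2) * indicator ?K x \<partial>lebesgue)"
  proof (rule nn_integral_mono)
    fix x
    show "ennreal (norm (f x $ i * ?\<psi> x)) \<le> ennreal ((norm (f x))\<^sup>2) + ennreal (B\<^sup>2) * indicator ?K x"
    proof (cases "x \<in> ?K")
      case True
      have "norm (f x $ i * ?\<psi> x) \<le> norm (f x) * B"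
        using B[OF True] by (simp add: norm_mult mult_mono Finite_Cartesian_Product.norm_nth_le)
      also have "\<dots> \<le> (norm (f x))\<^sup>2 + B\<^sup>2" by (rule mult_le_sum_squares)
      finally have "ennreal (norm (f x $ i * ?\<psi> x)) \<le> ennreal ((norm (f x))\<^sup>2 + B\<^sup>2)" by (rule ennreal_leI)
      then show ?thesis using True by simp
    qed (simp add: off)
  qed
  also have "\<dots> = energy UNIV f + ennreal (B\<^sup>2) * emeasure lebesgue ?K"
    by (simp add: nn_integral_add nn_integral_cmult_indicator energy_def)
  also have "\<dots> < \<infinity>"
    using f emeasure_compact_finite[OF K] by (simp add: L2_fields_iff ennreal_mult_less_top)
  finally show "(\<integral>\<^sup>+x. ennreal (norm (f x $ i * ?\<psi> x)) \<partial>lebesgue) < \<infinity>" .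
qed

lemma L2_sigma_diff:
  fixes f g :: "real^'d::finite \<Rightarrow> complex^'d"
  assumes f: "f \<in> L2_sigma" and g: "g \<in> L2_sigma" shows "(\<lambda>y. f y - g y) \<in> L2_sigma"
proof -
  have fg: "f \<in> L2_fields" "g \<in> L2_fields" using assms by (auto simp: L2_sigma_def)
  have "(LINT x|lebesgue. (\<Sum>i\<in>UNIV. (f x - g x) $ i * partial_deriv i \<phi> x)) = 0" if \<phi>: "\<phi> \<in> test_functions" for \<phi>
  proof -
    have "(LINT x|lebesgue. (\<Sum>i\<in>UNIV. (f x - g x) $ i * partial_deriv i \<phi> x))
      = (LINT x|lebesgue. (\<Sum>i\<in>UNIV. f x $ i * partial_deriv i \<phi> x) - (\<Sum>i\<in>UNIV. g x $ i * partial_deriv i \<phi> x))"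
      by (simp add: left_diff_distrib sum_subtractf)
    also have "\<dots> = (LINT x|lebesgue. (\<Sum>i\<in>UNIV. f x $ i * partial_deriv i \<phi> x))
       - (LINT x|lebesgue. (\<Sum>i\<in>UNIV. g x $ i * partial_deriv i \<phi> x))"
      by (intro Bochner_Integration.integral_diff Bochner_Integration.integrable_sum L2_test_integrable fg \<phi>)
    finally show ?thesis using f g \<phi> by (simp add: L2_sigma_def)
  qed
  then show ?thesis using L2_fields_diff[OF fg] by (simp add: L2_sigma_def)
qed

text \<open>The estimate on one ball that a decay estimate consists of, up to the slack \<open>e\<close>.\<close>
abbreviation ball_bound ::
  "real^'d::finite \<Rightarrow> real \<Rightarrow> real \<Rightarrow> real \<Rightarrow> real \<Rightarrow> (real^'d \<Rightarrow> 'a::real_normed_vector) \<Rightarrow> real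
    \<Rightarrow> (real^'d \<Rightarrow> 'b::real_normed_vector) \<Rightarrow> bool"
  where "ball_bound x r a \<nu> K f e g \<equiv>
    Lp_bounded (lebesgue_on (ball x r)) a (K * (sqrt (enn2real (weighted_energy \<nu> x r f)) + e)) (\<lambda>y. norm (g y))"

text \<open>The interpolation at one ball and for one operator \<open>S\<close>, with a constant that depends on neither. Only finitely many pieces are used:
\<open>f\<close> is the sum of \<open>h\<^sub>0\<close>, of the differences \<open>h\<^sub>n - h\<^sub>n\<^sub>-\<^sub>1\<close> for \<open>0 < n < L\<close>, and of the remainder \<open>f - h\<^sub>L\<^sub>-\<^sub>1\<close>. The remainder is treated like the
other pieces, with the norm of \<open>f\<close> on the whole space in place of \<open>b\<^sub>L\<close>; its contribution tends to \<open>0\<close> as \<open>L\<close> grows since the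
interpolated order is positive. So a finite sum suffices, for an arbitrarily small error.\<close>
lemma interpolation_core:
  fixes V :: "(real^'d::finite \<Rightarrow> 'a::euclidean_space) set"
  assumes V: "truncatable V" "V \<subseteq> L2_fields" "\<forall>f\<in>V. \<forall>g\<in>V. (\<lambda>y. f y - g y) \<in> V"
    and a: "0 \<le> a0" "0 \<le> a1" "a0 \<le> 1/2" "a1 \<le> 1/2" "a0 \<noteq> a1"
    and t: "0 < t" "t < 1" and \<nu>: "0 \<le> \<nu>1" "\<nu>1 < \<nu>0"
  obtains C where "C > 0"
    "\<And>x r K0 K1 (S :: (real^'d \<Rightarrow> 'a) \<Rightarrow> (real^'d \<Rightarrow> 'b::euclidean_space)) f e.
      r > 0 \<Longrightarrow> K0 > 0 \<Longrightarrow> K1 > 0 \<Longrightarrow> f \<in> V \<Longrightarrow> e > 0 \<Longrightarrow>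
      (\<And>u. u \<in> V \<Longrightarrow> S u \<in> borel_measurable lebesgue) \<Longrightarrow>
      (\<And>u v. u \<in> V \<Longrightarrow> v \<in> V \<Longrightarrow> AE y in lebesgue. S (\<lambda>z. u z + v z) y = S u y + S v y) \<Longrightarrow>
      (\<And>u e. u \<in> V \<Longrightarrow> e > 0 \<Longrightarrow> ball_bound x r a0 \<nu>0 K0 u e (S u)) \<Longrightarrow>
      (\<And>u e. u \<in> V \<Longrightarrow> e > 0 \<Longrightarrow> ball_bound x r a1 \<nu>1 K1 u e (S u)) \<Longrightarrow>
      ball_bound x r ((1 - t) * a0 + t * a1) (\<nu>0 * (1 - t) + \<nu>1 * t) (C * (K0 powr (1 - t) * K1 powr t)) f e (S f)"
proof -
  obtain c CV where c: "0 < c" "c \<le> 1" and CV: "0 < CV" and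
    trunc_all: "\<forall>x R. R > 0 \<longrightarrow> (\<forall>f\<in>V. \<exists>h\<in>V.
     (AE y in lebesgue. (y \<in> ball x (c * R) \<longrightarrow> h y = f y) \<and> (y \<notin> ball x R \<longrightarrow> h y = 0)) \<and>
     energy UNIV h \<le> ennreal CV * energy (ball x R) f)"
    using V(1) unfolding truncatable_def by (elim exE conjE) (rule that)
  note trunc = trunc_all[rule_format]
  define C1 where "C1 = max 1 CV"
  have C1: "C1 \<ge> 1" "CV \<le> C1" by (auto simp: C1_def)
  \<comment> \<open>\<open>h n\<close> agrees with \<open>f\<close> on \<open>B\<^sub>n\<^sub>-\<^sub>m\<close>, hence the piece with index \<open>n\<close> vanishes on \<open>B\<^sub>n\<^sub>-\<^sub>m\<^sub>-\<^sub>1\<close>\<close>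
  obtain m :: nat where "(1/2) ^ m < c" using real_arch_pow_inv[OF c(1), of "1/2"] by auto
  then have m: "1 / 2 ^ m \<le> c" by (simp add: power_one_over)
  define d where "d = (\<nu>0 - \<nu>1) / 2"
  have d: "d > 0" using \<nu> by (simp add: d_def)
  define \<nu>t where "\<nu>t = \<nu>0 * (1 - t) + \<nu>1 * t"
  have "\<nu>t > 0" unfolding \<nu>t_def using \<nu> t by (intro add_pos_nonneg mult_pos_pos) auto
  have e0: "- \<nu>t / 2 - t * d = - \<nu>0 / 2" and e1: "- \<nu>t / 2 + (1 - t) * d = - \<nu>1 / 2"
    by (simp_all add: \<nu>t_def d_def field_simps)
  obtain C0 where C0: "C0 > 0" and interp:
    "\<And>(M :: (real^'d) measure) K0 K1 L c G. K0 > 0 \<Longrightarrow> K1 > 0 \<Longrightarrow> (\<And>n. c n > 0) \<Longrightarrow>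
      (\<And>n x. G n x \<ge> 0) \<Longrightarrow> (\<And>n. G n \<in> borel_measurable M) \<Longrightarrow>
      (\<And>n. n \<le> L \<Longrightarrow> Lp_bounded M a0 (K0 * (c n * 2 powr (- t * d * real n))) (G n)) \<Longrightarrow>
      (\<And>n. n \<le> L \<Longrightarrow> Lp_bounded M a1 (K1 * (c n * 2 powr ((1 - t) * d * real n))) (G n)) \<Longrightarrow>
      Lp_bounded M ((1 - t) * a0 + t * a1) (C0 * (K0 powr (1 - t) * K1 powr t) * sqrt (\<Sum>n\<le>L. (c n)\<^sup>2))
        (\<lambda>x. \<Sum>n\<le>L. G n x)"
    by (fact Lp_bounded_interpolate_sum[OF a t d])
  \<comment> \<open>the constant in \<open>uw\<close> below: \<open>4 C1\<close> from the norms of the pieces, the power of two from the shift by \<open>m + 1\<close>\<close>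
  define D where "D = sqrt (4 * C1 * 2 powr (\<nu>0 * real (m + 1)))"
  have D: "D > 0" using C1 by (simp add: D_def)
  define g where "g = 1 / (1 - 2 powr (- \<nu>t))"
  have g: "g > 0" using \<open>\<nu>t > 0\<close> by (simp add: g_def powr_less_one)
  define Q where "Q = sqrt (2 * D\<^sup>2 * g) + sqrt (2 * D\<^sup>2 + 4)"
  have Q: "Q > 0" unfolding Q_def using D g by (intro add_pos_pos) (auto intro: add_nonneg_pos)
  have "C0 * Q > 0" using C0 Q by simp
  moreover have "ball_bound x r ((1 - t) * a0 + t * a1) \<nu>t (C0 * Q * (K0 powr (1 - t) * K1 powr t)) f \<eta> (S f)"
    if r: "r > 0" and K: "K0 > 0" "K1 > 0" and f: "f \<in> V" and \<eta>: "\<eta> > 0"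
      and Sm: "\<And>u. u \<in> V \<Longrightarrow> S u \<in> borel_measurable lebesgue"
      and Sadd: "\<And>u v. u \<in> V \<Longrightarrow> v \<in> V \<Longrightarrow> AE y in lebesgue. S (\<lambda>z. u z + v z) y = S u y + S v y"
      and H0: "\<And>u e. u \<in> V \<Longrightarrow> e > 0 \<Longrightarrow> ball_bound x r a0 \<nu>0 K0 u e (S u)"
      and H1: "\<And>u e. u \<in> V \<Longrightarrow> e > 0 \<Longrightarrow> ball_bound x r a1 \<nu>1 K1 u e (S u)"
    for x r K0 K1 f \<eta> and S :: "(real^'d \<Rightarrow> 'a) \<Rightarrow> (real^'d \<Rightarrow> 'b)"
  proof -
    let ?M = "lebesgue_on (ball x r)"
    have fm: "u \<in> borel_measurable lebesgue" "energy A u < top" "energy A u = ennreal (enn2real (energy A u))"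
      if "u \<in> V" for u A
    proof -
      show "u \<in> borel_measurable lebesgue" using that V(2) by (auto simp: L2_fields_iff)
      show *: "energy A u < top"
        using energy_mono[of A UNIV u] that V(2) L2_fields_iff[of u] by (auto intro: le_less_trans)
      then show "energy A u = ennreal (enn2real (energy A u))" by simp
    qed
    define b where "b n = enn2real (energy (ball x (2 ^ n * r)) f)" for n
    define E where "E = enn2real (energy UNIV f)"
    have bE: "b n \<le> E" for n
      unfolding b_def E_def using fm[OF f] by (intro enn2real_mono energy_mono) auto
    have "\<exists>h. h \<in> V \<and> (AE y in lebesgue. y \<in> ball x (c * (2 ^ n * r)) \<longrightarrow> h y = f y) \<and>
       energy UNIV h \<le> ennreal CV * energy (ball x (2 ^ n * r)) f" for n
    proof -
      obtain h where h: "h \<in> V" "AE y in lebesgue. (y \<in> ball x (c * (2 ^ n * r)) \<longrightarrow> h y = f y) \<and> (y \<notin> ball x (2 ^ n * r) \<longrightarrow> h y = 0)"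
        "energy UNIV h \<le> ennreal CV * energy (ball x (2 ^ n * r)) f"
        using trunc[of "2 ^ n * r" f x] r f by auto
      from h(2) have "AE y in lebesgue. y \<in> ball x (c * (2 ^ n * r)) \<longrightarrow> h y = f y"
        by eventually_elim simp
      with h(1,3) show ?thesis by (intro exI[of _ h] conjI)
    qed
    then have "\<forall>n. \<exists>h. h \<in> V \<and> (AE y in lebesgue. y \<in> ball x (c * (2 ^ n * r)) \<longrightarrow> h y = f y) \<and>
       energy UNIV h \<le> ennreal CV * energy (ball x (2 ^ n * r)) f" ..
    from choice[OF this] obtain h where h: "\<forall>n. h n \<in> V \<and>
      (AE y in lebesgue. y \<in> ball x (c * (2 ^ n * r)) \<longrightarrow> h n y = f y) \<and>
       energy UNIV (h n) \<le> ennreal CV * energy (ball x (2 ^ n * r)) f" ..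
    have hV: "h n \<in> V"
      and hf: "AE y in lebesgue. y \<in> ball x (c * (2 ^ n * r)) \<longrightarrow> h n y = f y"
      and he: "energy UNIV (h n) \<le> ennreal CV * energy (ball x (2 ^ n * r)) f" for n
      using spec[OF h, of n] by safe
    have he': "energy UNIV (h n) \<le> ennreal (C1 * b k)" if "n \<le> k" for n k
    proof -
      have "energy (ball x (2 ^ n * r)) f \<le> energy (ball x (2 ^ k * r)) f"
        using that r by (intro energy_mono subset_ball mult_right_mono power_increasing) auto
      then have "energy UNIV (h n) \<le> ennreal CV * energy (ball x (2 ^ k * r)) f"
        using he[of n] by (meson mult_left_mono order_trans zero_le)
      also have "\<dots> \<le> ennreal C1 * ennreal (b k)"
        using C1 fm(3)[OF f, of "ball x (2 ^ k * r)"] by (intro mult_mono ennreal_leI) (auto simp: b_def)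
      also have "\<dots> = ennreal (C1 * b k)" using C1 by (simp add: ennreal_mult b_def)
      finally show ?thesis .
    qed
    \<comment> \<open>so many pieces that the remainder contributes at most \<open>\<eta>\<^sup>2\<close>\<close>
    obtain L0 :: nat where "E / \<eta>\<^sup>2 < (2 powr \<nu>t) ^ L0"
      using real_arch_pow[of "2 powr \<nu>t"] \<open>\<nu>t > 0\<close> by auto
    define L where "L = Suc L0"
    have L: "2 powr (- \<nu>t * real L) * E \<le> \<eta>\<^sup>2"
    proof -
      have "E < \<eta>\<^sup>2 * (2 powr \<nu>t) ^ L0" using \<open>E / \<eta>\<^sup>2 < _\<close> \<eta> by (simp add: field_simps)
      also have "(2 powr \<nu>t) ^ L0 = 2 powr (\<nu>t * real L0)" by (simp add: powr_powr powr_realpow[symmetric])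
      also have "\<eta>\<^sup>2 * 2 powr (\<nu>t * real L0) \<le> \<eta>\<^sup>2 * 2 powr (\<nu>t * real L)"
        using \<open>\<nu>t > 0\<close> by (intro mult_left_mono powr_mono) (auto simp: L_def)
      finally have "2 powr (- \<nu>t * real L) * E \<le> 2 powr (- \<nu>t * real L) * (\<eta>\<^sup>2 * 2 powr (\<nu>t * real L))"
        by (intro mult_left_mono) auto
      also have "\<dots> = \<eta>\<^sup>2" by (simp add: powr_add[symmetric] mult.left_commute)
      finally show ?thesis .
    qed
    define u where "u n = (if n = 0 then h 0 else if n < L then (\<lambda>y. h n y - h (n - 1) y) else (\<lambda>y. f y - h (n - 1) y))" for n
    have uV: "u n \<in> V" for n unfolding u_def using V(3) hV f by auto
    define bb where "bb n = (if n < L then b n else E)" for n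
    have bb0: "bb n \<ge> 0" for n by (simp add: bb_def b_def E_def)
    have ue: "energy UNIV (u n) \<le> ennreal (4 * C1 * bb n)" if "n \<le> L" for n
    proof -
      have C1b: "C1 * b n \<ge> 0" "C1 * E \<ge> 0" using C1 by (simp_all add: b_def E_def)
      consider "n = 0" | "n > 0" "n < L" | "n > 0" "n = L" using \<open>n \<le> L\<close> by linarith
      then show ?thesis
      proof cases
        case 1
        then have "energy UNIV (u n) \<le> ennreal (C1 * b n)" using he'[of 0 0] by (simp add: u_def)
        also have "\<dots> \<le> ennreal (4 * C1 * bb n)"
          using 1 C1b by (intro ennreal_leI) (auto simp: bb_def L_def)
        finally show ?thesis .
      next
        case 2
        then have "energy UNIV (u n) \<le> ennreal 2 * (energy UNIV (h n) + energy UNIV (h (n - 1)))"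
          using energy_diff_le[OF fm(1)[OF hV[of n]] fm(1)[OF hV[of "n - 1"]]] by (simp add: u_def)
        also have "\<dots> \<le> ennreal 2 * (ennreal (C1 * b n) + ennreal (C1 * b n))"
          by (intro mult_left_mono add_mono he') auto
        also have "\<dots> = ennreal 2 * ennreal (C1 * b n + C1 * b n)" using C1b by (simp only: ennreal_plus)
        also have "\<dots> = ennreal (2 * (C1 * b n + C1 * b n))" using C1b by (intro ennreal_mult[symmetric]) auto
        finally show ?thesis using 2 by (simp add: bb_def mult.assoc)
      next
        case 3
        then have "energy UNIV (u n) \<le> ennreal 2 * (energy UNIV f + energy UNIV (h (n - 1)))"
          using energy_diff_le[OF fm(1)[OF f] fm(1)[OF hV[of "n - 1"]]] by (simp add: u_def)
        also have "\<dots> \<le> ennreal 2 * (ennreal (C1 * E) + ennreal (C1 * E))"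
        proof (intro mult_left_mono add_mono)
          have "energy UNIV f = ennreal E" using fm(3)[OF f] by (simp add: E_def)
          also have "\<dots> \<le> ennreal (C1 * E)"
            using mult_right_mono[OF C1(1), of E] by (intro ennreal_leI) (simp add: E_def)
          finally show "energy UNIV f \<le> ennreal (C1 * E)" .
          have "energy UNIV (h (n - 1)) \<le> ennreal (C1 * b n)" by (rule he') simp
          also have "\<dots> \<le> ennreal (C1 * E)" using C1 bE by (intro ennreal_leI mult_left_mono) auto
          finally show "energy UNIV (h (n - 1)) \<le> ennreal (C1 * E)" .
        qed simp
        also have "\<dots> = ennreal 2 * ennreal (C1 * E + C1 * E)" using C1b by (simp only: ennreal_plus)
        also have "\<dots> = ennreal (2 * (C1 * E + C1 * E))" using C1b by (intro ennreal_mult[symmetric]) auto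
        finally show ?thesis using 3 by (simp add: bb_def mult.assoc)
      qed
    qed
    have ufar: "n - (m + 1) = 0 \<or> (AE y in lebesgue. y \<in> ball x (2 ^ (n - (m + 1)) * r) \<longrightarrow> u n y = 0)" for n
    proof (cases "n - (m + 1) = 0")
      case False
      then have n: "n > m + 1" by simp
      have sub: "ball x (2 ^ (n - (m + 1)) * r) \<subseteq> ball x (c * (2 ^ k * r))" if "k \<ge> n - 1" for k
      proof (rule subset_ball)
        have "2 ^ (n - (m + 1)) * r = 1 / 2 ^ m * (2 ^ (n - 1) * r)"
          using n by (simp add: power_diff field_simps)
        also have "\<dots> \<le> c * (2 ^ k * r)"
          using m r that c by (intro mult_mono power_increasing) auto
        finally show "2 ^ (n - (m + 1)) * r \<le> c * (2 ^ k * r)" .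
      qed
      have "AE y in lebesgue. y \<in> ball x (2 ^ (n - (m + 1)) * r) \<longrightarrow> u n y = 0"
        using hf[of n] hf[of "n - 1"]
      proof eventually_elim
        case (elim y)
        then show ?case using sub[of n] sub[of "n - 1"] n by (auto simp: u_def)
      qed
      then show ?thesis by blast
    qed simp
    have uw: "sqrt (enn2real (weighted_energy \<nu> x r (u n))) \<le> D * (sqrt (bb n) * 2 powr (- \<nu> / 2 * real n))"
      if "n \<le> L" "0 \<le> \<nu>" "\<nu> \<le> \<nu>0" for n \<nu>
    proof -
      have "weighted_energy \<nu> x r (u n) \<le> ennreal (2 powr (- \<nu> * real (n - (m + 1)))) * energy UNIV (u n)"
        by (rule weighted_energy_far[OF r fm(1)[OF uV] that(2) ufar])
      also have "\<dots> \<le> ennreal (2 powr (- \<nu> * real (n - (m + 1)))) * ennreal (4 * C1 * bb n)"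
        by (intro mult_left_mono ue that) simp
      also have "\<dots> = ennreal (2 powr (- \<nu> * real (n - (m + 1))) * (4 * C1 * bb n))"
        using C1 bb0 by (intro ennreal_mult[symmetric]) auto
      finally have "enn2real (weighted_energy \<nu> x r (u n)) \<le> 2 powr (- \<nu> * real (n - (m + 1))) * (4 * C1 * bb n)"
        using C1 bb0[of n] by (intro enn2real_leI) auto
      also have "\<dots> \<le> (2 powr (\<nu>0 * real (m + 1)) * 2 powr (- \<nu> * real n)) * (4 * C1 * bb n)"
      proof (rule mult_right_mono)
        have "- \<nu> * real (n - (m + 1)) \<le> - \<nu> * (real n - real (m + 1))"
          using that by (intro mult_left_mono_neg) (auto simp: of_nat_diff)
        also have "\<dots> = \<nu> * real (m + 1) + - \<nu> * real n" by (simp add: algebra_simps)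
        also have "\<dots> \<le> \<nu>0 * real (m + 1) + - \<nu> * real n"
          using that by (intro add_right_mono mult_right_mono) auto
        finally show "2 powr (- \<nu> * real (n - (m + 1))) \<le> 2 powr (\<nu>0 * real (m + 1)) * 2 powr (- \<nu> * real n)"
          by (simp add: powr_add[symmetric])
        show "0 \<le> 4 * C1 * bb n" using C1 bb0[of n] by simp
      qed
      also have "\<dots> = D\<^sup>2 * (bb n * (2 powr (- \<nu> / 2 * real n))\<^sup>2)"
        using C1 by (simp add: D_def power2_eq_square powr_add[symmetric])
      finally have "sqrt (enn2real (weighted_energy \<nu> x r (u n))) \<le> sqrt (D\<^sup>2 * (bb n * (2 powr (- \<nu> / 2 * real n))\<^sup>2))"
        by (rule real_sqrt_le_mono)
      also have "\<dots> = D * (sqrt (bb n) * 2 powr (- \<nu> / 2 * real n))"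
        using D by (simp add: real_sqrt_mult)
      finally show ?thesis .
    qed
    \<comment> \<open>the second summand makes \<open>cc n\<close> positive and absorbs the slack in the endpoint estimates; its squares have sum at most \<open>2 \<eta>\<^sup>2\<close>\<close>
    define cc where "cc n = D * (sqrt (bb n) * 2 powr (- \<nu>t / 2 * real n)) + \<eta> * (1/2) ^ n" for n
    have cc: "cc n > 0" for n
      unfolding cc_def using D \<eta> bb0[of n] by (intro add_nonneg_pos mult_nonneg_nonneg mult_pos_pos) auto
    \<comment> \<open>both endpoint estimates at once: \<open>w\<close> is \<open>- t d\<close> or \<open>(1 - t) d\<close>\<close>
    have piece: "Lp_bounded ?M \<alpha> (\<kappa> * (cc n * 2 powr (w * real n))) (\<lambda>y. norm (S (u n) y))"
      if "n \<le> L" "0 \<le> \<nu>" "\<nu> \<le> \<nu>0" "\<alpha> \<ge> 0" "\<kappa> > 0" and w: "- \<nu>t / 2 + w = - \<nu> / 2"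
        and H: "\<And>e. e > 0 \<Longrightarrow> Lp_bounded ?M \<alpha> (\<kappa> * (sqrt (enn2real (weighted_energy \<nu> x r (u n))) + e)) (\<lambda>y. norm (S (u n) y))"
      for n \<nu> \<alpha> \<kappa> w
    proof -
      let ?e = "\<eta> * (1/2) ^ n * 2 powr (w * real n)"
      have e: "?e > 0" using \<eta> by simp
      have "cc n * 2 powr (w * real n)
        = D * (sqrt (bb n) * (2 powr (- \<nu>t / 2 * real n) * 2 powr (w * real n))) + ?e"
        by (simp add: cc_def distrib_right mult.assoc)
      also have "2 powr (- \<nu>t / 2 * real n) * 2 powr (w * real n) = 2 powr ((- \<nu>t / 2 + w) * real n)"
        by (simp only: powr_add[symmetric] distrib_right)
      finally have eq: "cc n * 2 powr (w * real n) = D * (sqrt (bb n) * 2 powr (- \<nu> / 2 * real n)) + ?e"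
        by (simp only: w)
      show ?thesis
      proof (rule Lp_bounded_mono[OF H[OF e]])
        show "\<kappa> * (sqrt (enn2real (weighted_energy \<nu> x r (u n))) + ?e) \<le> \<kappa> * (cc n * 2 powr (w * real n))"
          unfolding eq using that uw[of n \<nu>] by (intro mult_left_mono add_right_mono) auto
        show "0 < \<kappa> * (sqrt (enn2real (weighted_energy \<nu> x r (u n))) + ?e)"
          by (intro mult_pos_pos[OF \<open>\<kappa> > 0\<close>] add_nonneg_pos[OF _ e]) simp
      qed (use that in auto)
    qed
    have "Lp_bounded ?M ((1 - t) * a0 + t * a1) (C0 * (K0 powr (1 - t) * K1 powr t) * sqrt (\<Sum>n\<le>L. (cc n)\<^sup>2))
        (\<lambda>y. \<Sum>n\<le>L. norm (S (u n) y))"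
    proof (rule interp[OF K cc])
      show "(\<lambda>y. norm (S (u n) y)) \<in> borel_measurable ?M" for n
      proof -
        have [measurable]: "S (u n) \<in> borel_measurable lebesgue" by (rule Sm[OF uV])
        show ?thesis by (intro measurable_restrict_space1) measurable
      qed
      show "Lp_bounded ?M a0 (K0 * (cc n * 2 powr (- t * d * real n))) (\<lambda>y. norm (S (u n) y))" if "n \<le> L" for n
        using piece[of n \<nu>0 a0 K0 "- t * d"] that \<nu> a K e0 H0[OF uV] by simp
      show "Lp_bounded ?M a1 (K1 * (cc n * 2 powr ((1 - t) * d * real n))) (\<lambda>y. norm (S (u n) y))" if "n \<le> L" for n
        using piece[of n \<nu>1 a1 K1 "(1 - t) * d"] that \<nu> a K e1 H1[OF uV] by simp
    qed simp
    then show ?thesis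
    proof (rule Lp_bounded_mono)
      show "0 \<le> (1 - t) * a0 + t * a1" using a t by simp
      have sum_pos: "0 < (\<Sum>n\<le>L. (cc n)\<^sup>2)" using cc by (intro sum_pos) (auto simp: less_imp_neq[symmetric])
      then show "0 < C0 * (K0 powr (1 - t) * K1 powr t) * sqrt (\<Sum>n\<le>L. (cc n)\<^sup>2)"
        using C0 K by simp
      let ?s = "enn2real (weighted_energy \<nu>t x r f)"
      have "(\<Sum>n\<le>L. (cc n)\<^sup>2) \<le> (\<Sum>n\<le>L. 2 * D\<^sup>2 * (2 powr (- \<nu>t * real n) * bb n) + 2 * \<eta>\<^sup>2 * (1/4) ^ n)"
      proof (rule sum_mono)
        fix n
        let ?a = "D * (sqrt (bb n) * 2 powr (- \<nu>t / 2 * real n))" and ?b = "\<eta> * (1/2) ^ n"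
        have "(cc n)\<^sup>2 \<le> 2 * ?a\<^sup>2 + 2 * ?b\<^sup>2"
          unfolding cc_def using sum_squares_bound[of ?a ?b] by (simp add: power2_sum)
        also have "?a\<^sup>2 = D\<^sup>2 * (2 powr (- \<nu>t * real n) * bb n)"
          using bb0[of n] by (simp add: power_mult_distrib) (simp add: power2_eq_square powr_add[symmetric])
        also have "?b\<^sup>2 = \<eta>\<^sup>2 * ((1/2) ^ n * (1/2) ^ n)"
          unfolding power_mult_distrib by (simp only: power2_eq_square)
        also have "(1/2) ^ n * (1/2) ^ n = (1/4 :: real) ^ n"
          unfolding power_mult_distrib[symmetric] by simp
        finally show "(cc n)\<^sup>2 \<le> 2 * D\<^sup>2 * (2 powr (- \<nu>t * real n) * bb n) + 2 * \<eta>\<^sup>2 * (1/4) ^ n" by simp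
      qed
      also have "\<dots> = 2 * D\<^sup>2 * (\<Sum>n\<le>L. 2 powr (- \<nu>t * real n) * bb n) + 2 * \<eta>\<^sup>2 * (\<Sum>n\<le>L. (1/4) ^ n)"
        by (simp add: sum.distrib sum_distrib_left)
      also have "(\<Sum>n\<le>L. 2 powr (- \<nu>t * real n) * bb n)
          = (\<Sum>n<L. 2 powr (- \<nu>t * real n) * b n) + 2 powr (- \<nu>t * real L) * E"
        by (simp add: lessThan_Suc_atMost[symmetric] bb_def)
      also have "2 * D\<^sup>2 * (\<dots>) + 2 * \<eta>\<^sup>2 * (\<Sum>n\<le>L. (1/4) ^ n) \<le> 2 * D\<^sup>2 * (g * ?s + \<eta>\<^sup>2) + 2 * \<eta>\<^sup>2 * 2"
      proof (intro add_mono mult_left_mono L)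
        show "(\<Sum>n<L. 2 powr (- \<nu>t * real n) * b n) \<le> g * ?s"
          unfolding b_def g_def using ball_weighted_sum[OF r _ \<open>\<nu>t > 0\<close>] f V(2) by blast
        have "(\<Sum>n\<le>L. (1/4::real) ^ n) \<le> (\<Sum>n. (1/4) ^ n)"
          by (intro sum_le_suminf summable_geometric) auto
        also have "\<dots> \<le> 2" by (subst suminf_geometric) auto
        finally show "(\<Sum>n\<le>L. (1/4::real) ^ n) \<le> 2" .
      qed auto
      also have "\<dots> = 2 * D\<^sup>2 * g * ?s + (2 * D\<^sup>2 + 4) * \<eta>\<^sup>2" by (simp add: algebra_simps)
      finally have "sqrt (\<Sum>n\<le>L. (cc n)\<^sup>2) \<le> sqrt (2 * D\<^sup>2 * g * ?s + (2 * D\<^sup>2 + 4) * \<eta>\<^sup>2)"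
        by (rule real_sqrt_le_mono)
      also have "\<dots> \<le> sqrt (2 * D\<^sup>2 * g * ?s) + sqrt ((2 * D\<^sup>2 + 4) * \<eta>\<^sup>2)"
        using g by (intro sqrt_add_le_add_sqrt) auto
      also have "\<dots> = sqrt (2 * D\<^sup>2 * g) * sqrt ?s + sqrt (2 * D\<^sup>2 + 4) * \<eta>"
        using \<eta> by (simp add: real_sqrt_mult)
      also have "\<dots> \<le> Q * (sqrt ?s + \<eta>)"
        unfolding Q_def distrib_left using \<eta> g D by (intro add_mono mult_right_mono) auto
      finally have "C0 * (K0 powr (1 - t) * K1 powr t) * sqrt (\<Sum>n\<le>L. (cc n)\<^sup>2)
         \<le> C0 * (K0 powr (1 - t) * K1 powr t) * (Q * (sqrt ?s + \<eta>))"
        using C0 K by (intro mult_left_mono) auto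
      then show "C0 * (K0 powr (1 - t) * K1 powr t) * sqrt (\<Sum>n\<le>L. (cc n)\<^sup>2)
         \<le> C0 * Q * (K0 powr (1 - t) * K1 powr t) * (sqrt ?s + \<eta>)" by (simp add: mult_ac)
      have "AE y in lebesgue. S (h k) y = (\<Sum>n\<le>k. S (u n) y)" if "k < L" for k
        using that
      proof (induction k)
        case 0
        then show ?case by (simp add: u_def)
      next
        case (Suc k)
        have "(\<lambda>z. h k z + u (Suc k) z) = h (Suc k)" using Suc.prems by (auto simp: u_def)
        then show ?case using Sadd[OF hV[of k] uV[of "Suc k"]] Suc by auto
      qed
      from this[of L0] have "AE y in lebesgue. S (h L0) y = (\<Sum>n\<le>L0. S (u n) y)" by (simp add: L_def)
      moreover have "(\<lambda>z. h L0 z + u L z) = f" by (auto simp: u_def L_def)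
      ultimately have "AE y in lebesgue. S f y = (\<Sum>n\<le>L. S (u n) y)"
        using Sadd[OF hV[of L0] uV[of L]] by (auto simp: L_def)
      then have "AE y in lebesgue. norm (S f y) \<le> (\<Sum>n\<le>L. norm (S (u n) y))"
        by eventually_elim (simp add: norm_sum)
      then show "AE y in ?M. norm (S f y) \<le> (\<Sum>n\<le>L. norm (S (u n) y))"
        by (subst AE_restrict_space_iff) auto
    qed simp
  qed
  ultimately show thesis unfolding \<nu>t_def by (rule that)
qed

section \<open>Decay estimates\<close>

lemma exponent_bounds:
  fixes p :: ennreal
  assumes "2 \<le> p"
  shows "0 \<le> enn2real (1/p)" "enn2real (1/p) \<le> 1/2" "1/p = ennreal (enn2real (1/p))"
proof -
  have "enn2real (1/p) \<le> 1/2 \<and> 1/p = ennreal (enn2real (1/p))"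
  proof (cases p)
    case (real q)
    then have q: "q \<ge> 2" using assms by (metis ennreal_le_iff ennreal_numeral)
    then have "1 / p = ennreal (1/q)" using real divide_ennreal[of 1 q] by simp
    then show ?thesis using q by simp
  qed simp
  then show "enn2real (1/p) \<le> 1/2" "1/p = ennreal (enn2real (1/p))" by auto
qed simp

lemma interpolated_exponent:
  fixes p0 p1 p :: ennreal
  assumes p: "2 \<le> p0" "2 \<le> p1" and t: "0 \<le> t" "t \<le> 1"
    and eq: "1 / p = ennreal (1 - t) / p0 + ennreal t / p1"
  shows "2 \<le> p" "enn2real (1/p) = (1 - t) * enn2real (1/p0) + t * enn2real (1/p1)"
proof -
  let ?a = "(1 - t) * enn2real (1/p0) + t * enn2real (1/p1)"
  note b0 = exponent_bounds[OF p(1)] and b1 = exponent_bounds[OF p(2)]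
  have "1 / p = ennreal (1 - t) * (1 / p0) + ennreal t * (1 / p1)"
    using eq by (simp add: divide_ennreal_def)
  also have "\<dots> = ennreal (1 - t) * ennreal (enn2real (1/p0)) + ennreal t * ennreal (enn2real (1/p1))"
    using b0(3) b1(3) by simp
  also have "\<dots> = ennreal ?a"
    using t by (simp add: ennreal_mult[symmetric] ennreal_plus[symmetric] del: ennreal_plus)
  finally have pe: "1 / p = ennreal ?a" .
  moreover have "?a \<ge> 0" using t by simp
  ultimately show "enn2real (1/p) = ?a" by simp
  have "?a \<le> (1 - t) * (1/2) + t * (1/2)" using t b0 b1 by (intro add_mono mult_left_mono) auto
  then have a: "?a \<le> 1/2" by (simp add: field_simps)
  show "2 \<le> p"
  proof (cases p)
    case (real q)
    have "q \<noteq> 0"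
    proof
      assume "q = 0"
      then have "1 / p = top" using real by simp
      then show False using pe by simp
    qed
    then have q: "q > 0" using real by simp
    then have "1 / p = ennreal (1/q)" using real divide_ennreal[of 1 q] by simp
    then have "1/q = ?a" using pe \<open>?a \<ge> 0\<close> q by simp
    then have "1/q \<le> 1/2" using a by simp
    then have "2 \<le> q" using q by (simp add: field_simps)
    then show ?thesis using real by (metis ennreal_le_iff ennreal_numeral q less_imp_le)
  qed simp
qed

text \<open>The factor of \<open>r\<close> and \<open>z\<close> in a decay estimate in dimension \<open>d\<close> with reciprocal exponent \<open>a\<close>.\<close>
definition decay_factor :: "nat \<Rightarrow> real \<Rightarrow> real \<Rightarrow> real \<Rightarrow> complex \<Rightarrow> real \<Rightarrow> real"
  where "decay_factor d a M N z r =
    r powr (- real d * (1/2 - a)) * max ((r\<^sup>2 / cmod z) powr M) ((r\<^sup>2 / cmod z) powr (- N))"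

lemma decay_factor_pos: "r > 0 \<Longrightarrow> z \<noteq> 0 \<Longrightarrow> decay_factor d a M N z r > 0"
  by (auto simp: decay_factor_def less_max_iff_disj)

lemma decay_factor_mono:
  assumes "r > 0" "z \<noteq> 0" "0 \<le> M" "0 \<le> N" "M \<le> M'" "N \<le> N'"
  shows "decay_factor d a M N z r \<le> decay_factor d a M' N' z r"
proof -
  let ?q = "r\<^sup>2 / cmod z"
  have q: "?q > 0" using assms by simp
  have "?q powr M \<le> max (?q powr M') (?q powr (- N'))"
  proof (cases "?q \<ge> 1")
    case True
    then have "?q powr M \<le> ?q powr M'" using assms by (intro powr_mono) auto
    then show ?thesis by simp
  next
    case False
    then have "?q powr M \<le> ?q powr (- N')" using assms q by (intro powr_mono') auto
    then show ?thesis by simp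
  qed
  moreover have "?q powr (- N) \<le> max (?q powr M') (?q powr (- N'))"
  proof (cases "?q \<ge> 1")
    case True
    then have "?q powr (- N) \<le> ?q powr M'" using assms by (intro powr_mono) auto
    then show ?thesis by simp
  next
    case False
    then have "?q powr (- N) \<le> ?q powr (- N')" using assms q by (intro powr_mono') auto
    then show ?thesis by simp
  qed
  ultimately show ?thesis unfolding decay_factor_def by (intro mult_left_mono) auto
qed

lemma decay_estimates_iff:
  fixes V :: "(real^'d::finite \<Rightarrow> 'a::euclidean_space) set"
    and T :: "complex \<Rightarrow> (real^'d \<Rightarrow> 'a) \<Rightarrow> (real^'d \<Rightarrow> 'b::euclidean_space)"
  assumes V: "V \<subseteq> L2_fields" and \<Omega>: "0 \<notin> \<Omega>"
    and T: "\<forall>z\<in>\<Omega>. \<forall>f\<in>V. T z f \<in> borel_measurable lebesgue"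
  shows "decay_estimates p \<nu> \<Omega> V T \<longleftrightarrow> 2 \<le> p \<and> 0 \<le> \<nu> \<and>
    (\<exists>M\<ge>0. \<exists>N\<ge>0. \<exists>C>0. \<forall>z\<in>\<Omega>. \<forall>x. \<forall>r>0. \<forall>f\<in>V. \<forall>e>0.
      ball_bound x r (enn2real (1/p)) \<nu> (C * decay_factor CARD('d) (enn2real (1/p)) M N z r) f e (T z f))"
proof -
  have eq: "Lp_norm p (ball x r) (T z f)
        \<le> ennreal (C * r powr (- real CARD('d) * (1/2 - enn2real (1 / p)))
                    * max ((r\<^sup>2 / cmod z) powr M) ((r\<^sup>2 / cmod z) powr (- N)))
          * ennreal_powr (\<Sum>n. ennreal (2 powr (- \<nu> * real n)) * (Lp_norm 2 (annulus x r n) f)\<^sup>2) (1/2)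
    \<longleftrightarrow> (\<forall>e>0. ball_bound x r (enn2real (1/p)) \<nu> (C * decay_factor CARD('d) (enn2real (1/p)) M N z r) f e (T z f))"
    if "2 \<le> p" "0 \<le> \<nu>" "C > 0" "z \<in> \<Omega>" "r > 0" "f \<in> V" for M N C z x r f
  proof -
    have f: "f \<in> L2_fields" using V that by blast
    have "z \<noteq> 0" using that \<Omega> by auto
    then have K: "C * decay_factor CARD('d) (enn2real (1/p)) M N z r > 0"
      using that decay_factor_pos by simp
    have w: "weighted_energy \<nu> x r f = ennreal (enn2real (weighted_energy \<nu> x r f))"
      using weighted_energy_finite[OF that(5) f that(2), of x] by simp
    have "(\<Sum>n. ennreal (2 powr (- \<nu> * real n)) * (Lp_norm 2 (annulus x r n) f)\<^sup>2) = weighted_energy \<nu> x r f"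
      by (simp add: weighted_energy_def Lp_norm_2_square)
    also note w
    finally show ?thesis
      using Lp_norm_le_sqrt_iff[OF that(1) K, of "enn2real (weighted_energy \<nu> x r f)" "ball x r" "T z f"] T that(4,6)
      by (simp add: decay_factor_def mult.assoc)
  qed
  show ?thesis
    unfolding decay_estimates_def
  proof (rule conj_cong[OF refl], rule conj_cong[OF refl])
    assume h: "2 \<le> p" "0 \<le> \<nu>"
    show "(\<exists>M\<ge>0. \<exists>N\<ge>0. \<exists>C>0. \<forall>z\<in>\<Omega>. \<forall>x. \<forall>r>0. \<forall>f\<in>V.
      Lp_norm p (ball x r) (T z f)
        \<le> ennreal (C * r powr (- real CARD('d) * (1/2 - enn2real (1 / p)))
                    * max ((r\<^sup>2 / cmod z) powr M) ((r\<^sup>2 / cmod z) powr (- N)))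
          * ennreal_powr (\<Sum>n. ennreal (2 powr (- \<nu> * real n)) * (Lp_norm 2 (annulus x r n) f)\<^sup>2) (1/2))
      \<longleftrightarrow> (\<exists>M\<ge>0. \<exists>N\<ge>0. \<exists>C>0. \<forall>z\<in>\<Omega>. \<forall>x. \<forall>r>0. \<forall>f\<in>V. \<forall>e>0.
      ball_bound x r (enn2real (1/p)) \<nu> (C * decay_factor CARD('d) (enn2real (1/p)) M N z r) f e (T z f))"
      by (intro arg_cong[where f=Ex] ext conj_cong[OF refl] ball_cong[OF refl] arg_cong[where f=All] imp_cong[OF refl] eq h)
  qed
qed

lemma ball_volume:
  fixes x :: "real^'d::finite"
  assumes "r > 0"
  shows "emeasure (lebesgue_on (ball x r)) (space (lebesgue_on (ball x r)))
    = ennreal (unit_ball_vol (real CARD('d)) * r ^ CARD('d))"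
  using assms by (simp add: space_restrict_space emeasure_restrict_space emeasure_ball)

text \<open>The power of \<open>r\<close> in the volume of the ball is exactly the difference of the powers in the two decay factors.\<close>
lemma decay_estimates_weaken:
  fixes V :: "(real^'d::finite \<Rightarrow> 'a::euclidean_space) set"
    and T :: "complex \<Rightarrow> (real^'d \<Rightarrow> 'a) \<Rightarrow> (real^'d \<Rightarrow> 'b::euclidean_space)"
  assumes V: "V \<subseteq> L2_fields" and \<Omega>: "0 \<notin> \<Omega>"
    and T: "\<forall>z\<in>\<Omega>. \<forall>f\<in>V. T z f \<in> borel_measurable lebesgue"
    and dec: "decay_estimates q \<mu> \<Omega> V T" and p: "2 \<le> p" and le: "enn2real (1/q) \<le> enn2real (1/p)"
    and \<nu>: "0 \<le> \<nu>" "\<nu> \<le> \<mu>"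
  shows "decay_estimates p \<nu> \<Omega> V T"
proof -
  let ?a = "enn2real (1/q)" and ?b = "enn2real (1/p)" and ?d = "CARD('d)"
  obtain M N C where q: "2 \<le> q" and MN: "M \<ge> 0" "N \<ge> 0" "C > 0" and
    H_all: "\<forall>z\<in>\<Omega>. \<forall>x. \<forall>r>0. \<forall>f\<in>V. \<forall>e>0.
      ball_bound x r ?a \<mu> (C * decay_factor ?d ?a M N z r) f e (T z f)"
    using dec unfolding decay_estimates_iff[where T=T, OF V \<Omega> T] by (elim conjE exE) (rule that)
  note H = H_all[rule_format]
  define \<omega> where "\<omega> = unit_ball_vol (real ?d)"
  have \<omega>: "\<omega> > 0" by (simp add: \<omega>_def)
  define C' where "C' = C * \<omega> powr (?b - ?a)"
  have "C' > 0" using MN \<omega> by (simp add: C'_def)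
  have "ball_bound x r ?b \<nu> (C' * decay_factor ?d ?b M N z r) f e (T z f)"
    if z: "z \<in> \<Omega>" and r: "r > 0" and f: "f \<in> V" and e: "e > 0" for z x r f e
  proof -
    let ?v = "\<omega> * r ^ ?d" and ?K = "C * decay_factor ?d ?a M N z r * (sqrt (enn2real (weighted_energy \<mu> x r f)) + e)"
    have "z \<noteq> 0" using z \<Omega> by auto
    then have K: "?K > 0"
      using MN r e decay_factor_pos by (intro mult_pos_pos add_nonneg_pos) auto
    have fields: "f \<in> L2_fields" using f V by blast
    have [measurable]: "T z f \<in> borel_measurable lebesgue" using T z f by blast
    have m: "(\<lambda>y. norm (T z f y)) \<in> borel_measurable (lebesgue_on (ball x r))"
      by (intro measurable_restrict_space1) measurable
    have "Lp_bounded (lebesgue_on (ball x r)) ?b (?v powr (?b - ?a) * ?K) (\<lambda>y. norm (T z f y))"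
      using H[OF z r f e] le K ball_volume[OF r] r \<omega> m exponent_bounds[OF q]
      by (intro Lp_bounded_raise) (auto simp: \<omega>_def)
    then show ?thesis
    proof (rule Lp_bounded_mono)
      have v1: "?v powr (?b - ?a) = \<omega> powr (?b - ?a) * r powr (real ?d * (?b - ?a))"
        using \<omega> r by (simp add: powr_mult powr_powr powr_realpow[symmetric])
      have v2: "r powr (real ?d * (?b - ?a)) * decay_factor ?d ?a M N z r = decay_factor ?d ?b M N z r"
        unfolding decay_factor_def mult.assoc[symmetric] powr_add[symmetric]
        by (simp add: algebra_simps)
      have "?v powr (?b - ?a) * ?K
        = C * \<omega> powr (?b - ?a) * (r powr (real ?d * (?b - ?a)) * decay_factor ?d ?a M N z r)
          * (sqrt (enn2real (weighted_energy \<mu> x r f)) + e)"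
        unfolding v1 by (simp only: mult_ac)
      also have "\<dots> = C' * decay_factor ?d ?b M N z r * (sqrt (enn2real (weighted_energy \<mu> x r f)) + e)"
        unfolding v2 C'_def ..
      also have "\<dots> \<le> C' * decay_factor ?d ?b M N z r * (sqrt (enn2real (weighted_energy \<nu> x r f)) + e)"
        using \<open>C' > 0\<close> decay_factor_pos[OF r \<open>z \<noteq> 0\<close>] weighted_energy_finite[OF r fields \<nu>(1)] weighted_energy_antimono[OF \<nu>(2)]
        by (intro mult_left_mono add_right_mono real_sqrt_le_mono enn2real_mono) (auto simp: less_imp_le)
      finally show "?v powr (?b - ?a) * ?K \<le> \<dots>" .
      show "0 < ?v powr (?b - ?a) * ?K" using K \<omega> r by simp
    qed auto
  qed
  then show ?thesis
    unfolding decay_estimates_iff[where T=T, OF V \<Omega> T]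
    by (intro conjI exI[of _ M] exI[of _ N] exI[of _ C'] ballI allI impI p \<nu>(1) MN(1,2) \<open>C' > 0\<close>)
qed

text \<open>The product of the two decay factors to the powers \<open>1 - t\<close> and \<open>t\<close> is the decay factor of the interpolated exponent, once \<open>M\<close> and \<open>N\<close> are made equal by
enlarging them.\<close>
lemma decay_estimates_interpolate_strict:
  fixes V :: "(real^'d::finite \<Rightarrow> 'a::euclidean_space) set"
    and T :: "complex \<Rightarrow> (real^'d \<Rightarrow> 'a) \<Rightarrow> (real^'d \<Rightarrow> 'b::euclidean_space)"
  assumes V: "truncatable V" "V \<subseteq> L2_fields" "\<forall>f\<in>V. \<forall>g\<in>V. (\<lambda>y. f y - g y) \<in> V"
    and \<Omega>: "0 \<notin> \<Omega>"
    and T: "\<forall>z\<in>\<Omega>. \<forall>f\<in>V. T z f \<in> borel_measurable lebesgue"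
    and Tadd: "\<forall>z\<in>\<Omega>. \<forall>u\<in>V. \<forall>v\<in>V. AE y in lebesgue. T z (\<lambda>y. u y + v y) y = T z u y + T z v y"
    and dec0: "decay_estimates p0 \<nu>0 \<Omega> V T" and dec1: "decay_estimates p1 \<nu>1 \<Omega> V T"
    and p: "2 \<le> p" and pt: "enn2real (1/p) = (1 - t) * enn2real (1/p0) + t * enn2real (1/p1)"
    and t: "0 < t" "t < 1" and ne: "enn2real (1/p0) \<noteq> enn2real (1/p1)" and \<nu>: "\<nu>1 < \<nu>0"
  shows "decay_estimates p (\<nu>0 * (1 - t) + \<nu>1 * t) \<Omega> V T"
proof -
  let ?a = "enn2real (1/p0)" and ?b = "enn2real (1/p1)" and ?d = "CARD('d)"
  obtain M0 N0 C0 where p0: "2 \<le> p0" and MN0: "M0 \<ge> 0" "N0 \<ge> 0" "C0 > 0" and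
    H0_all: "\<forall>z\<in>\<Omega>. \<forall>x. \<forall>r>0. \<forall>f\<in>V. \<forall>e>0.
      ball_bound x r ?a \<nu>0 (C0 * decay_factor ?d ?a M0 N0 z r) f e (T z f)"
    using dec0 unfolding decay_estimates_iff[where T=T, OF V(2) \<Omega> T] by (elim conjE exE) (rule that)
  note H0 = H0_all[rule_format]
  obtain M1 N1 C1 where p1: "2 \<le> p1" "0 \<le> \<nu>1" and MN1: "M1 \<ge> 0" "N1 \<ge> 0" "C1 > 0" and
    H1_all: "\<forall>z\<in>\<Omega>. \<forall>x. \<forall>r>0. \<forall>f\<in>V. \<forall>e>0.
      ball_bound x r ?b \<nu>1 (C1 * decay_factor ?d ?b M1 N1 z r) f e (T z f)"
    using dec1 unfolding decay_estimates_iff[where T=T, OF V(2) \<Omega> T] by (elim conjE exE) (rule that)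
  note H1 = H1_all[rule_format]
  note e0 = exponent_bounds[OF p0] and e1 = exponent_bounds[OF p1(1)]
  obtain C where C: "C > 0" and core:
    "\<And>x r K0 K1 (S :: (real^'d \<Rightarrow> 'a) \<Rightarrow> (real^'d \<Rightarrow> 'b)) f e.
      r > 0 \<Longrightarrow> K0 > 0 \<Longrightarrow> K1 > 0 \<Longrightarrow> f \<in> V \<Longrightarrow> e > 0 \<Longrightarrow>
      (\<And>u. u \<in> V \<Longrightarrow> S u \<in> borel_measurable lebesgue) \<Longrightarrow>
      (\<And>u v. u \<in> V \<Longrightarrow> v \<in> V \<Longrightarrow> AE y in lebesgue. S (\<lambda>z. u z + v z) y = S u y + S v y) \<Longrightarrow>
      (\<And>u e. u \<in> V \<Longrightarrow> e > 0 \<Longrightarrow> ball_bound x r ?a \<nu>0 K0 u e (S u)) \<Longrightarrow>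
      (\<And>u e. u \<in> V \<Longrightarrow> e > 0 \<Longrightarrow> ball_bound x r ?b \<nu>1 K1 u e (S u)) \<Longrightarrow>
      ball_bound x r ((1 - t) * ?a + t * ?b) (\<nu>0 * (1 - t) + \<nu>1 * t) (C * (K0 powr (1 - t) * K1 powr t)) f e (S f)"
    by (fact interpolation_core[OF V e0(1) e1(1) e0(2) e1(2) ne t p1(2) \<nu>])
  define M N where "M = max M0 M1" and "N = max N0 N1"
  define C' where "C' = C * (C0 powr (1 - t) * C1 powr t)"
  have "C' > 0" using C MN0 MN1 by (simp add: C'_def)
  have "ball_bound x r (enn2real (1/p)) (\<nu>0 * (1 - t) + \<nu>1 * t) (C' * decay_factor ?d (enn2real (1/p)) M N z r) f e (T z f)"
    if z: "z \<in> \<Omega>" and r: "r > 0" and f: "f \<in> V" and e: "e > 0" for z x r f e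
  proof -
    have "z \<noteq> 0" using z \<Omega> by auto
    note pos = decay_factor_pos[OF r this]
    let ?K0 = "C0 * decay_factor ?d ?a M0 N0 z r" and ?K1 = "C1 * decay_factor ?d ?b M1 N1 z r"
    have K: "?K0 > 0" "?K1 > 0" using MN0 MN1 pos by auto
    let ?W = "sqrt (enn2real (weighted_energy (\<nu>0 * (1 - t) + \<nu>1 * t) x r f)) + e"
    have W: "?W > 0" using e by (intro add_nonneg_pos) auto
    have "Lp_bounded (lebesgue_on (ball x r)) ((1 - t) * ?a + t * ?b)
      (C * (?K0 powr (1 - t) * ?K1 powr t) * ?W) (\<lambda>y. norm (T z f y))"
      by (rule core[OF r K f e]) (use T Tadd z H0 H1 r in auto)
    then show ?thesis
      unfolding pt
    proof (rule Lp_bounded_mono)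
      show "0 < C * (?K0 powr (1 - t) * ?K1 powr t) * ?W"
        by (intro mult_pos_pos C W) (simp_all only: powr_gt_zero K[THEN less_imp_neq, symmetric] not_False_eq_True)
      let ?m = "max ((r\<^sup>2 / cmod z) powr M) ((r\<^sup>2 / cmod z) powr (- N))"
      have "?K0 powr (1 - t) \<le> (C0 * decay_factor ?d ?a M N z r) powr (1 - t)"
        using K MN0 t r \<open>z \<noteq> 0\<close>
        by (intro powr_mono2 mult_left_mono decay_factor_mono) (auto simp: M_def N_def)
      moreover have "?K1 powr t \<le> (C1 * decay_factor ?d ?b M N z r) powr t"
        using K MN1 t r \<open>z \<noteq> 0\<close>
        by (intro powr_mono2 mult_left_mono decay_factor_mono) (auto simp: M_def N_def)
      ultimately have "?K0 powr (1 - t) * ?K1 powr t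
        \<le> (C0 * decay_factor ?d ?a M N z r) powr (1 - t) * (C1 * decay_factor ?d ?b M N z r) powr t"
        by (intro mult_mono) auto
      also have "\<dots> = (C0 powr (1 - t) * C1 powr t) *
         (decay_factor ?d ?a M N z r powr (1 - t) * decay_factor ?d ?b M N z r powr t)"
        using MN0 MN1 pos by (simp add: powr_mult less_imp_le mult_ac)
      also have "decay_factor ?d ?a M N z r powr (1 - t) * decay_factor ?d ?b M N z r powr t
        = decay_factor ?d ((1 - t) * ?a + t * ?b) M N z r"
      proof -
        have m: "?m > 0" using r \<open>z \<noteq> 0\<close> by (auto simp: less_max_iff_disj)
        have "decay_factor ?d ?a M N z r powr (1 - t) * decay_factor ?d ?b M N z r powr t
          = (r powr (- real ?d * (1/2 - ?a) * (1 - t)) * r powr (- real ?d * (1/2 - ?b) * t)) * (?m powr (1 - t) * ?m powr t)"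
          using m by (simp add: decay_factor_def powr_mult powr_powr mult_ac)
        also have "?m powr (1 - t) * ?m powr t = ?m" using m by (simp add: powr_add[symmetric])
        also have "r powr (- real ?d * (1/2 - ?a) * (1 - t)) * r powr (- real ?d * (1/2 - ?b) * t)
          = r powr (- real ?d * (1/2 - ((1 - t) * ?a + t * ?b)))"
          unfolding powr_add[symmetric] by (rule arg_cong[where f="\<lambda>s. r powr s"]) (simp add: field_simps)
        finally show ?thesis by (simp add: decay_factor_def)
      qed
      finally have "C * (?K0 powr (1 - t) * ?K1 powr t)
        \<le> C * ((C0 powr (1 - t) * C1 powr t) * decay_factor ?d ((1 - t) * ?a + t * ?b) M N z r)"
        using C by (intro mult_left_mono) auto
      then show "C * (?K0 powr (1 - t) * ?K1 powr t) * ?W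
        \<le> C' * decay_factor ?d ((1 - t) * ?a + t * ?b) M N z r * ?W"
        unfolding C'_def using W by (intro mult_right_mono) (auto simp: mult.assoc)
      show "0 \<le> (1 - t) * ?a + t * ?b" using t by simp
    qed auto
  qed
  moreover have "0 \<le> \<nu>0 * (1 - t) + \<nu>1 * t" using t \<nu> p1 by simp
  moreover have "M \<ge> 0" "N \<ge> 0" using MN0 by (auto simp: M_def N_def)
  ultimately show ?thesis
    unfolding decay_estimates_iff[where T=T, OF V(2) \<Omega> T]
    by (intro conjI exI[of _ M] exI[of _ N] exI[of _ C'] ballI allI impI p \<open>C' > 0\<close>)
qed

text \<open>If neither estimate is the stronger one in both respects, then one has the larger order and the other the smaller
reciprocal exponent; the two cases are exchanged by replacing \<open>t\<close> with \<open>1 - t\<close>.\<close>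
lemma decay_estimates_interpolate:
  fixes V :: "(real^'d::finite \<Rightarrow> 'a::euclidean_space) set"
    and T :: "complex \<Rightarrow> (real^'d \<Rightarrow> 'a) \<Rightarrow> (real^'d \<Rightarrow> 'b::euclidean_space)"
  assumes V: "truncatable V" "V \<subseteq> L2_fields" "\<forall>f\<in>V. \<forall>g\<in>V. (\<lambda>y. f y - g y) \<in> V"
    and \<Omega>: "0 \<notin> \<Omega>"
    and T: "\<forall>z\<in>\<Omega>. \<forall>f\<in>V. T z f \<in> borel_measurable lebesgue"
    and Tadd: "\<forall>z\<in>\<Omega>. \<forall>u\<in>V. \<forall>v\<in>V. AE y in lebesgue. T z (\<lambda>y. u y + v y) y = T z u y + T z v y"
    and dec0: "decay_estimates p0 \<nu>0 \<Omega> V T" and dec1: "decay_estimates p1 \<nu>1 \<Omega> V T"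
    and t: "0 \<le> t" "t \<le> 1" and eq: "1 / p = ennreal (1 - t) / p0 + ennreal t / p1"
  shows "decay_estimates p (\<nu>0 * (1 - t) + \<nu>1 * t) \<Omega> V T"
proof -
  let ?a = "enn2real (1/p0)" and ?b = "enn2real (1/p1)"
  let ?at = "(1 - t) * ?a + t * ?b" and ?\<nu>t = "\<nu>0 * (1 - t) + \<nu>1 * t"
  have p01: "2 \<le> p0" "2 \<le> p1" and \<nu>: "0 \<le> \<nu>0" "0 \<le> \<nu>1" using dec0 dec1 by (auto simp: decay_estimates_def)
  note p = interpolated_exponent[OF p01 t eq]
  have \<nu>t: "0 \<le> ?\<nu>t" using \<nu> t by simp
  have at0: "?at = ?a + t * (?b - ?a)" "?\<nu>t = \<nu>0 + t * (\<nu>1 - \<nu>0)" by (simp_all add: algebra_simps)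
  have at1: "?at = ?b + (1 - t) * (?a - ?b)" "?\<nu>t = \<nu>1 + (1 - t) * (\<nu>0 - \<nu>1)" by (simp_all add: algebra_simps)
  consider "?a \<le> ?at" "?\<nu>t \<le> \<nu>0" | "?b \<le> ?at" "?\<nu>t \<le> \<nu>1"
    | "0 < t" "t < 1" "?a \<noteq> ?b" "\<nu>1 < \<nu>0" | "0 < t" "t < 1" "?a \<noteq> ?b" "\<nu>0 < \<nu>1"
  proof (cases "t = 0 \<or> t = 1")
    case True
    then show thesis using that(1,2) by auto
  next
    case False
    then have t': "0 < t" "t < 1" using t by auto
    have "?a \<le> ?at" if "?a \<le> ?b" using that t unfolding at0(1) by simp
    moreover have "?\<nu>t \<le> \<nu>0" if "\<nu>1 \<le> \<nu>0" using that t unfolding at0(2) by (simp add: mult_nonneg_nonpos)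
    moreover have "?b \<le> ?at" if "?b \<le> ?a" using that t unfolding at1(1) by simp
    moreover have "?\<nu>t \<le> \<nu>1" if "\<nu>0 \<le> \<nu>1" using that t unfolding at1(2) by (simp add: mult_nonneg_nonpos)
    ultimately show thesis
      using that t' by (metis linorder_le_less_linear nle_le)
  qed
  then show ?thesis
  proof cases
    case 1
    then show ?thesis using decay_estimates_weaken[where T=T, OF V(2) \<Omega> T dec0 p(1)] p(2) \<nu>t by simp
  next
    case 2
    then show ?thesis using decay_estimates_weaken[where T=T, OF V(2) \<Omega> T dec1 p(1)] p(2) \<nu>t by simp
  next
    case 3
    then show ?thesis
      using decay_estimates_interpolate_strict[where T=T, OF V \<Omega> T Tadd dec0 dec1 p] by simp
  next
    case 4
    have "enn2real (1/p) = (1 - (1 - t)) * ?b + (1 - t) * ?a" using p(2) by simp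
    from decay_estimates_interpolate_strict[where T=T, OF V \<Omega> T Tadd dec1 dec0 p(1) this] 4
    have "decay_estimates p (\<nu>1 * (1 - (1 - t)) + \<nu>0 * (1 - t)) \<Omega> V T" by simp
    then show ?thesis by (simp add: add.commute)
  qed
qed

text \<open>With \<open>M = d/2 (1/2 - 1/p)\<close> the powers of \<open>r\<close> cancel in \<open>r\<^sup>-\<^sup>d\<^sup>(\<^sup>1\<^sup>/\<^sup>2\<^sup>-\<^sup>1\<^sup>/\<^sup>p\<^sup>) (r\<^sup>2/|z|)\<^sup>M\<close>.\<close>
lemma L2_Lp_bounds_imp_decay:
  fixes V :: "(real^'d::finite \<Rightarrow> 'a::euclidean_space) set"
    and T :: "complex \<Rightarrow> (real^'d \<Rightarrow> 'a) \<Rightarrow> (real^'d \<Rightarrow> 'b::euclidean_space)"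
  assumes V: "V \<subseteq> L2_fields" and \<Omega>: "0 \<notin> \<Omega>"
    and T: "\<forall>z\<in>\<Omega>. \<forall>f\<in>V. T z f \<in> borel_measurable lebesgue"
    and bounds: "L2_Lp_bounds p \<Omega> V T"
  shows "decay_estimates p 0 \<Omega> V T"
proof -
  let ?a = "enn2real (1/p)" and ?d = "CARD('d)"
  obtain C where p: "2 \<le> p" and C: "C > 0" and
    H: "\<And>z f. z \<in> \<Omega> \<Longrightarrow> f \<in> V \<Longrightarrow> Lp_norm p UNIV (T z f)
      \<le> ennreal (C * cmod z powr (- (real ?d / 2) * (1/2 - ?a))) * Lp_norm 2 UNIV f"
    using bounds unfolding L2_Lp_bounds_def by blast
  define M where "M = real ?d / 2 * (1/2 - ?a)"
  have M: "M \<ge> 0" using exponent_bounds[OF p] by (simp add: M_def)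
  have "ball_bound x r ?a 0 (C * decay_factor ?d ?a M 0 z r) f e (T z f)"
    if z: "z \<in> \<Omega>" and r: "r > 0" and f: "f \<in> V" and e: "e > 0" for z x r f e
  proof -
    have "z \<noteq> 0" using z \<Omega> by auto
    let ?K = "C * cmod z powr (- (real ?d / 2) * (1/2 - ?a))"
    have K: "?K > 0" using C \<open>z \<noteq> 0\<close> by simp
    have f': "f \<in> borel_measurable lebesgue" "energy UNIV f < top"
      using f V L2_fields_iff[of f] by auto
    have w: "weighted_energy 0 x r f = energy UNIV f" by (simp add: weighted_energy_def energy_annuli(1)[OF r f'(1)])
    have "energy UNIV f = ennreal (enn2real (energy UNIV f))" using f'(2) by simp
    then have "Lp_norm p UNIV (T z f) \<le> ennreal ?K * ennreal_powr (ennreal (enn2real (energy UNIV f))) (1/2)"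
      using H[OF z f] by (simp add: Lp_norm_2)
    then have "Lp_bounded (lebesgue_on UNIV) ?a (?K * (sqrt (enn2real (energy UNIV f)) + e)) (\<lambda>y. norm (T z f y))"
      using Lp_norm_le_sqrt_iff[OF p K, of _ UNIV "T z f"] T z f e by simp
    then have "Lp_bounded (lebesgue_on (ball x r)) ?a (?K * (sqrt (enn2real (energy UNIV f)) + e)) (\<lambda>y. norm (T z f y))"
      by (intro Lp_bounded_restrict) (simp_all add: lebesgue_on_UNIV_eq)
    then show ?thesis
      unfolding w
    proof (rule Lp_bounded_mono)
      have W: "sqrt (enn2real (energy UNIV f)) + e > 0" using e by (intro add_nonneg_pos) auto
      then show "0 < ?K * (sqrt (enn2real (energy UNIV f)) + e)" using K by simp
      have "cmod z powr (- (real ?d / 2) * (1/2 - ?a))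
          = r powr (- real ?d * (1/2 - ?a)) * (r\<^sup>2 / cmod z) powr M"
      proof -
        have "(r\<^sup>2 / cmod z) powr M = (r\<^sup>2) powr M / cmod z powr M"
          using r by (simp add: powr_divide)
        also have "(r\<^sup>2) powr M = (r powr 2) powr M" using r by simp
        also have "(r powr 2) powr M = r powr (2 * M)" by (rule powr_powr)
        also have "r powr (2 * M) / cmod z powr M = r powr (2 * M) * cmod z powr (- M)"
          by (simp add: powr_minus divide_inverse)
        finally have "r powr (- real ?d * (1/2 - ?a)) * (r\<^sup>2 / cmod z) powr M
          = (r powr (- real ?d * (1/2 - ?a)) * r powr (2 * M)) * cmod z powr (- M)" by (simp add: mult.assoc)
        also have "r powr (- real ?d * (1/2 - ?a)) * r powr (2 * M) = 1"
          using r unfolding powr_add[symmetric] by (simp add: M_def)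
        finally show ?thesis by (simp add: M_def)
      qed
      also have "\<dots> \<le> decay_factor ?d ?a M 0 z r" unfolding decay_factor_def by (intro mult_left_mono) auto
      finally show "?K * (sqrt (enn2real (energy UNIV f)) + e)
        \<le> C * decay_factor ?d ?a M 0 z r * (sqrt (enn2real (energy UNIV f)) + e)"
        using C W by (intro mult_right_mono mult_left_mono) auto
    qed auto
  qed
  then show ?thesis
    unfolding decay_estimates_iff[where T=T, OF V \<Omega> T] 
    by (intro conjI exI[of _ M] exI[of _ 0] exI[of _ C] ballI allI impI p M C order_refl)
qed

lemma decay_interpolation:
  fixes V :: "(real^'d::finite \<Rightarrow> 'a::{euclidean_space, complex_scale}) set"
    and W :: "(real^'d \<Rightarrow> 'b::{euclidean_space, complex_scale}) set"
  assumes V: "truncatable V" "V \<subseteq> L2_fields" "\<forall>f\<in>V. \<forall>g\<in>V. (\<lambda>y. f y - g y) \<in> V"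
    and W: "W \<subseteq> L2_fields" and \<Omega>: "\<Omega> \<subseteq> UNIV - {0}"
    and t: "0 \<le> t" "t \<le> 1" and eq: "1 / p = ennreal (1 - t) / p0 + ennreal t / p1"
  shows "\<forall>T. (\<forall>z\<in>\<Omega>. T z \<in> bounded_ops V W) \<longrightarrow>
           (\<forall>\<nu>0\<ge>0. \<forall>\<nu>1\<ge>0.
              decay_estimates p0 \<nu>0 \<Omega> V T \<and> decay_estimates p1 \<nu>1 \<Omega> V T \<longrightarrow>
              decay_estimates p (\<nu>0 * (1 - t) + \<nu>1 * t) \<Omega> V T) \<and>
           (\<forall>\<nu>\<ge>0.
              decay_estimates p0 \<nu> \<Omega> V T \<and> L2_Lp_bounds p1 \<Omega> V T \<longrightarrow>
              decay_estimates p (\<nu> * (1 - t)) \<Omega> V T)"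
proof (intro allI impI)
  fix T assume T: "\<forall>z\<in>\<Omega>. T z \<in> bounded_ops V W"
  have z: "0 \<notin> \<Omega>" using \<Omega> by auto
  have Tm: "\<forall>z\<in>\<Omega>. \<forall>f\<in>V. T z f \<in> borel_measurable lebesgue"
  proof (intro ballI)
    fix z f assume "z \<in> \<Omega>" "f \<in> V"
    then have "T z f \<in> L2_fields" using T W unfolding bounded_ops_def by blast
    then show "T z f \<in> borel_measurable lebesgue" by (simp add: L2_fields_iff)
  qed
  have Ta: "\<forall>z\<in>\<Omega>. \<forall>u\<in>V. \<forall>v\<in>V. AE y in lebesgue. T z (\<lambda>y. u y + v y) y = T z u y + T z v y"
    using T by (auto simp: bounded_ops_def)
  note interpolate = decay_estimates_interpolate[where T=T, OF V z Tm Ta _ _ t eq]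
  show "(\<forall>\<nu>0\<ge>0. \<forall>\<nu>1\<ge>0.
              decay_estimates p0 \<nu>0 \<Omega> V T \<and> decay_estimates p1 \<nu>1 \<Omega> V T \<longrightarrow>
              decay_estimates p (\<nu>0 * (1 - t) + \<nu>1 * t) \<Omega> V T) \<and>
           (\<forall>\<nu>\<ge>0.
              decay_estimates p0 \<nu> \<Omega> V T \<and> L2_Lp_bounds p1 \<Omega> V T \<longrightarrow>
              decay_estimates p (\<nu> * (1 - t)) \<Omega> V T)"
  proof (intro conjI allI impI; elim conjE)
    show "decay_estimates p (\<nu>0 * (1 - t) + \<nu>1 * t) \<Omega> V T"
      if "decay_estimates p0 \<nu>0 \<Omega> V T" "decay_estimates p1 \<nu>1 \<Omega> V T" for \<nu>0 \<nu>1
      by (rule interpolate[OF that])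
    show "decay_estimates p (\<nu> * (1 - t)) \<Omega> V T"
      if "decay_estimates p0 \<nu> \<Omega> V T" "L2_Lp_bounds p1 \<Omega> V T" for \<nu>
      using interpolate[OF that(1) L2_Lp_bounds_imp_decay[where T=T, OF V(2) z Tm that(2)]] by simp
  qed
qed

theorem proposition4p11:
  fixes p\<^sub>0 p\<^sub>1 p\<theta> :: ennreal and \<theta> :: real and \<Omega> :: "complex set"
  assumes "CARD('d::finite) \<ge> 2"
    and "2 \<le> p\<^sub>0" and "2 \<le> p\<^sub>1"
    and "open \<Omega>" and "\<Omega> \<subseteq> UNIV - {0}"
    and "0 \<le> \<theta>" and "\<theta> \<le> 1"
    and "1 / p\<theta> = ennreal (1 - \<theta>) / p\<^sub>0 + ennreal \<theta> / p\<^sub>1"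
  shows "(\<forall>T :: complex \<Rightarrow> (real^'d \<Rightarrow> complex^'d) \<Rightarrow> (real^'d \<Rightarrow> complex^'d).
           (\<forall>z\<in>\<Omega>. T z \<in> bounded_ops L2_sigma L2_sigma) \<longrightarrow>
           (\<forall>\<nu>\<^sub>0\<ge>0. \<forall>\<nu>\<^sub>1\<ge>0.
              decay_estimates p\<^sub>0 \<nu>\<^sub>0 \<Omega> L2_sigma T \<and> decay_estimates p\<^sub>1 \<nu>\<^sub>1 \<Omega> L2_sigma T \<longrightarrow>
              decay_estimates p\<theta> (\<nu>\<^sub>0 * (1 - \<theta>) + \<nu>\<^sub>1 * \<theta>) \<Omega> L2_sigma T) \<and>
           (\<forall>\<nu>\<ge>0.
              decay_estimates p\<^sub>0 \<nu> \<Omega> L2_sigma T \<and> L2_Lp_bounds p\<^sub>1 \<Omega> L2_sigma T \<longrightarrow>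
              decay_estimates p\<theta> (\<nu> * (1 - \<theta>)) \<Omega> L2_sigma T)) \<and>
         (\<forall>T :: complex \<Rightarrow> (real^'d \<Rightarrow> complex^'d) \<Rightarrow> (real^'d \<Rightarrow> complex^'d^'d).
           (\<forall>z\<in>\<Omega>. T z \<in> bounded_ops L2_sigma L2_fields) \<longrightarrow>
           (\<forall>\<nu>\<^sub>0\<ge>0. \<forall>\<nu>\<^sub>1\<ge>0.
              decay_estimates p\<^sub>0 \<nu>\<^sub>0 \<Omega> L2_sigma T \<and> decay_estimates p\<^sub>1 \<nu>\<^sub>1 \<Omega> L2_sigma T \<longrightarrow>
              decay_estimates p\<theta> (\<nu>\<^sub>0 * (1 - \<theta>) + \<nu>\<^sub>1 * \<theta>) \<Omega> L2_sigma T) \<and>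
           (\<forall>\<nu>\<ge>0.
              decay_estimates p\<^sub>0 \<nu> \<Omega> L2_sigma T \<and> L2_Lp_bounds p\<^sub>1 \<Omega> L2_sigma T \<longrightarrow>
              decay_estimates p\<theta> (\<nu> * (1 - \<theta>)) \<Omega> L2_sigma T)) \<and>
         (\<forall>T :: complex \<Rightarrow> (real^'d \<Rightarrow> complex^'d^'d) \<Rightarrow> (real^'d \<Rightarrow> complex^'d).
           (\<forall>z\<in>\<Omega>. T z \<in> bounded_ops L2_fields L2_sigma) \<longrightarrow>
           (\<forall>\<nu>\<^sub>0\<ge>0. \<forall>\<nu>\<^sub>1\<ge>0.
              decay_estimates p\<^sub>0 \<nu>\<^sub>0 \<Omega> L2_fields T \<and> decay_estimates p\<^sub>1 \<nu>\<^sub>1 \<Omega> L2_fields T \<longrightarrow>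
              decay_estimates p\<theta> (\<nu>\<^sub>0 * (1 - \<theta>) + \<nu>\<^sub>1 * \<theta>) \<Omega> L2_fields T) \<and>
           (\<forall>\<nu>\<ge>0.
              decay_estimates p\<^sub>0 \<nu> \<Omega> L2_fields T \<and> L2_Lp_bounds p\<^sub>1 \<Omega> L2_fields T \<longrightarrow>
              decay_estimates p\<theta> (\<nu> * (1 - \<theta>)) \<Omega> L2_fields T)) \<and>
         (\<forall>T :: complex \<Rightarrow> (real^'d \<Rightarrow> complex^'d^'d) \<Rightarrow> (real^'d \<Rightarrow> complex^'d^'d).
           (\<forall>z\<in>\<Omega>. T z \<in> bounded_ops L2_fields L2_fields) \<longrightarrow>
           (\<forall>\<nu>\<^sub>0\<ge>0. \<forall>\<nu>\<^sub>1\<ge>0.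
              decay_estimates p\<^sub>0 \<nu>\<^sub>0 \<Omega> L2_fields T \<and> decay_estimates p\<^sub>1 \<nu>\<^sub>1 \<Omega> L2_fields T \<longrightarrow>
              decay_estimates p\<theta> (\<nu>\<^sub>0 * (1 - \<theta>) + \<nu>\<^sub>1 * \<theta>) \<Omega> L2_fields T) \<and>
           (\<forall>\<nu>\<ge>0.
              decay_estimates p\<^sub>0 \<nu> \<Omega> L2_fields T \<and> L2_Lp_bounds p\<^sub>1 \<Omega> L2_fields T \<longrightarrow>
              decay_estimates p\<theta> (\<nu> * (1 - \<theta>)) \<Omega> L2_fields T))"
proof -
  have sigma: "truncatable (L2_sigma :: (real^'d \<Rightarrow> complex^'d) set)"
    by (rule truncatable_L2_sigma[OF assms(1)])
  have sub: "L2_sigma \<subseteq> (L2_fields :: (real^'d \<Rightarrow> complex^'d) set)" by (auto simp: L2_sigma_def)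
  have sdiff: "\<forall>f\<in>L2_sigma. \<forall>g\<in>L2_sigma. (\<lambda>y. f y - g y) \<in> (L2_sigma :: (real^'d \<Rightarrow> complex^'d) set)"
    using L2_sigma_diff by blast
  have fdiff: "\<forall>f\<in>L2_fields. \<forall>g\<in>L2_fields. (\<lambda>y. f y - g y) \<in> (L2_fields :: (real^'d \<Rightarrow> complex^'d^'d) set)"
    using L2_fields_diff by blast
  note s = decay_interpolation[OF sigma sub sdiff _ assms(5-8)]
    and f = decay_interpolation[OF truncatable_L2_fields order_refl fdiff _ assms(5-8)]
  show ?thesis
    by (intro conjI s f sub order_refl)
qed

end
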